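(* Let $H$ be a separable real Hilbert space, and let $A$ be a nonnegative self-adjoint linear operator on $H$ with dense domain. Assume that the spectrum of $A$ consists of a sequence $\{\lambda_{k}^{2}\}_{k\in\mathbb{N}}$ of eigenvalues, with $\lambda_{k}\geq 0$, such that $\lambda_{k+1}\geq e^{\lambda_{k}}$ for every $k\in\mathbb{N}$. Let $m:[0,+\infty)\to(0,+\infty)$ be a locally Lipschitz continuous function such that $\inf_{\sigma\geq 0}m(\sigma)>0$. Then for every $\alpha>1/4$ and every pair of initial conditions $(u_{0},u_{1})\in D(A^{\alpha+1/2})\times D(A^{\alpha})$, the Cauchy problem $$u''(t)+m\left(|A^{1/2}u(t)|^{2}\right)Au(t)=0\quad\forall t\geq 0,\qquad u(0)=u_{0},\quad u'(0)=u_{1},$$ admits a unique global solution $$u\in C^{1}\left([0,+\infty);D(A^{\alpha})\right)\cap C^{0}\left([0,+\infty);D(A^{\alpha+1/2})\right).$$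
   Context: $|x|$ and $\langle x,y\rangle$ denote the norm and scalar product of $H$. Powers $A^{\beta}$ ($\beta\geq 0$) are defined by the spectral theorem, and $D(A^{\beta})$ is endowed with the graph norm. Notion of solution: the equation is understood weakly (component-wise): for every $v\in D(A)$ the function $t\mapsto\langle u(t),v\rangle$ is of class $C^{2}$ and $\frac{d^{2}}{dt^{2}}\langle u(t),v\rangle+m(|A^{1/2}u(t)|^{2})\langle u(t),Av\rangle=0$ for all $t\geq 0$. *)

theory Defs
  imports "HOL-Analysis.Analysis"
begin

text \<open>
  An unbounded operator on a real Hilbert space is a pair of a domain \<open>D\<close> and a total
  function \<open>A\<close>, of which only the values on \<open>D\<close> matter.
\<close>

definition linear_operator_on :: "'a::real_vector set \<Rightarrow> ('a \<Rightarrow> 'a) \<Rightarrow> bool" where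
  "linear_operator_on D A \<longleftrightarrow> subspace D \<and>
     (\<forall>x\<in>D. \<forall>y\<in>D. A (x + y) = A x + A y) \<and> (\<forall>c. \<forall>x\<in>D. A (c *\<^sub>R x) = c *\<^sub>R A x)"

definition adjoint_graph :: "'a::real_inner set \<Rightarrow> ('a \<Rightarrow> 'a) \<Rightarrow> ('a \<times> 'a) set" where
  "adjoint_graph D A = {(v, w). \<forall>x\<in>D. inner (A x) v = inner x w}"

definition self_adjoint_operator :: "'a::real_inner set \<Rightarrow> ('a \<Rightarrow> 'a) \<Rightarrow> bool" where
  "self_adjoint_operator D A \<longleftrightarrow> linear_operator_on D A \<and> closure D = UNIV \<and>
     adjoint_graph D A = {(v, A v) | v. v \<in> D}"

definition nonnegative_operator :: "'a::real_inner set \<Rightarrow> ('a \<Rightarrow> 'a) \<Rightarrow> bool" where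
  "nonnegative_operator D A \<longleftrightarrow> (\<forall>x\<in>D. 0 \<le> inner (A x) x)"

definition op_resolvent_set :: "'a::real_normed_vector set \<Rightarrow> ('a \<Rightarrow> 'a) \<Rightarrow> real set" where
  "op_resolvent_set D A = {\<mu>. \<exists>R. bounded_linear R \<and>
     (\<forall>y. R y \<in> D \<and> A (R y) - \<mu> *\<^sub>R R y = y) \<and> (\<forall>x\<in>D. R (A x - \<mu> *\<^sub>R x) = x)}"

text \<open>
  For a self-adjoint operator the spectrum of the complexification is real and coincides
  with the following set.
\<close>

definition op_spectrum :: "'a::real_normed_vector set \<Rightarrow> ('a \<Rightarrow> 'a) \<Rightarrow> real set" where
  "op_spectrum D A = - op_resolvent_set D A"

definition op_eigenvalue :: "'a::real_vector set \<Rightarrow> ('a \<Rightarrow> 'a) \<Rightarrow> real \<Rightarrow> bool" where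
  "op_eigenvalue D A \<mu> \<longleftrightarrow> (\<exists>x\<in>D. x \<noteq> 0 \<and> A x = \<mu> *\<^sub>R x)"


subsection \<open>Powers by the spectral theorem\<close>

definition projection_valued_measure :: "(real set \<Rightarrow> 'a::real_inner \<Rightarrow> 'a) \<Rightarrow> bool" where
  "projection_valued_measure E \<longleftrightarrow>
     (\<forall>B\<in>sets borel. bounded_linear (E B) \<and> (\<forall>x. E B (E B x) = E B x) \<and>
        (\<forall>x y. inner (E B x) y = inner x (E B y))) \<and>
     E UNIV = (\<lambda>x. x) \<and>
     (\<forall>B :: nat \<Rightarrow> real set. range B \<subseteq> sets borel \<longrightarrow> disjoint_family B \<longrightarrow>
        (\<forall>x. (\<lambda>n. E (B n) x) sums E (\<Union>n. B n) x))"

definition scalar_measure :: "(real set \<Rightarrow> 'a::real_inner \<Rightarrow> 'a) \<Rightarrow> 'a \<Rightarrow> real measure" where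
  "scalar_measure E x = measure_of UNIV (sets borel) (\<lambda>B. ennreal (inner (E B x) x))"

text \<open>
  The operator \<open>\<integral> f dE\<close>: its domain consists of the \<open>x\<close> with \<open>f \<in> L\<^sup>2(\<langle>E x, x\<rangle>)\<close>, and
  its value \<open>w\<close> at \<open>x\<close> is determined by \<open>\<langle>w, y\<rangle> = \<integral> f d\<langle>E x, y\<rangle>\<close> for all \<open>y\<close> in
  the (dense) domain. The signed measure \<open>\<langle>E x, y\<rangle>\<close> is written by polarization as
  \<open>(\<langle>E (x + y), x + y\<rangle> - \<langle>E (x - y), x - y\<rangle>) / 4\<close>.
\<close>

definition spectral_dom ::
  "(real set \<Rightarrow> 'a::real_inner \<Rightarrow> 'a) \<Rightarrow> (real \<Rightarrow> real) \<Rightarrow> 'a set" where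
  "spectral_dom E f = {x. integrable (scalar_measure E x) (\<lambda>s. (f s)\<^sup>2)}"

definition spectral_integral ::
  "(real set \<Rightarrow> 'a::real_inner \<Rightarrow> 'a) \<Rightarrow> (real \<Rightarrow> real) \<Rightarrow> 'a \<Rightarrow> 'a" where
  "spectral_integral E f x = (THE w. \<forall>y\<in>spectral_dom E f.
     inner w y = ((LINT s|scalar_measure E (x + y). f s) - (LINT s|scalar_measure E (x - y). f s)) / 4)"

definition is_spectral_measure_of ::
  "'a::real_inner set \<Rightarrow> ('a \<Rightarrow> 'a) \<Rightarrow> (real set \<Rightarrow> 'a \<Rightarrow> 'a) \<Rightarrow> bool" where
  "is_spectral_measure_of D A E \<longleftrightarrow> projection_valued_measure E \<and>
     D = spectral_dom E (\<lambda>s. s) \<and> (\<forall>x\<in>D. A x = spectral_integral E (\<lambda>s. s) x)"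

text \<open>
  For self-adjoint \<open>A\<close> the spectral theorem gives existence, and uniqueness on Borel sets;
  the values on non-Borel sets are arbitrary and never used.
\<close>

definition spectral_measure_of ::
  "'a::real_inner set \<Rightarrow> ('a \<Rightarrow> 'a) \<Rightarrow> real set \<Rightarrow> 'a \<Rightarrow> 'a" where
  "spectral_measure_of D A = (SOME E. is_spectral_measure_of D A E)"

text \<open>
  The case distinction makes the zeroth power the identity, since \<open>0 powr 0 = 0\<close>. Negative
  \<open>s\<close> are irrelevant, as the spectral measure of a nonnegative operator lives on \<open>[0, \<infinity>)\<close>.
\<close>

definition power_fun :: "real \<Rightarrow> real \<Rightarrow> real" where
  "power_fun \<beta> s = (if \<beta> = 0 then 1 else s powr \<beta>)"

definition op_power_dom :: "'a::real_inner set \<Rightarrow> ('a \<Rightarrow> 'a) \<Rightarrow> real \<Rightarrow> 'a set" where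
  "op_power_dom D A \<beta> = spectral_dom (spectral_measure_of D A) (power_fun \<beta>)"

definition op_power :: "'a::real_inner set \<Rightarrow> ('a \<Rightarrow> 'a) \<Rightarrow> real \<Rightarrow> 'a \<Rightarrow> 'a" where
  "op_power D A \<beta> = spectral_integral (spectral_measure_of D A) (power_fun \<beta>)"


subsection \<open>Function spaces and solutions\<close>

text \<open>
  The map \<open>x \<mapsto> (x, B x)\<close> is a linear isometry from the domain of \<open>B\<close> with the graph norm
  \<open>sqrt (|x|\<^sup>2 + |B x|\<^sup>2)\<close> onto the graph of \<open>B\<close> in \<open>H \<times> H\<close>. Continuity and
  differentiability with respect to the graph norm are expressed through it. The derivative
  is required to belong to the domain, so that it is a derivative in that space.
\<close>

definition graph_embed :: "('a \<Rightarrow> 'a) \<Rightarrow> 'a \<Rightarrow> 'a \<times> 'a" where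
  "graph_embed B x = (x, B x)"

definition C0_into :: "'a::real_normed_vector set \<Rightarrow> ('a \<Rightarrow> 'a) \<Rightarrow> (real \<Rightarrow> 'a) \<Rightarrow> bool" where
  "C0_into X B u \<longleftrightarrow> (\<forall>t\<ge>0. u t \<in> X) \<and> continuous_on {0..} (\<lambda>t. graph_embed B (u t))"

definition C1_into :: "'a::real_normed_vector set \<Rightarrow> ('a \<Rightarrow> 'a) \<Rightarrow> (real \<Rightarrow> 'a) \<Rightarrow> bool" where
  "C1_into X B u \<longleftrightarrow> C0_into X B u \<and> (\<exists>u'. C0_into X B u' \<and>
     (\<forall>t\<ge>0. ((\<lambda>s. graph_embed B (u s)) has_vector_derivative graph_embed B (u' t)) (at t within {0..})))"

definition kirchhoff_solution ::
  "'a::real_inner set \<Rightarrow> ('a \<Rightarrow> 'a) \<Rightarrow> (real \<Rightarrow> real) \<Rightarrow> 'a \<Rightarrow> 'a \<Rightarrow> (real \<Rightarrow> 'a) \<Rightarrow> bool" where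
  "kirchhoff_solution D A m u0 u1 u \<longleftrightarrow>
     (\<forall>v\<in>D. \<exists>g1 g2.
        (\<forall>t\<ge>0. ((\<lambda>s. inner (u s) v) has_real_derivative g1 t) (at t within {0..})) \<and>
        (\<forall>t\<ge>0. (g1 has_real_derivative g2 t) (at t within {0..})) \<and>
        continuous_on {0..} g2 \<and>
        (\<forall>t\<ge>0. g2 t + m ((norm (op_power D A (1/2) (u t)))\<^sup>2) * inner (u t) (A v) = 0)) \<and>
     u 0 = u0 \<and> (u has_vector_derivative u1) (at 0 within {0..})"

definition kirchhoff_class_solution ::
  "'a::real_inner set \<Rightarrow> ('a \<Rightarrow> 'a) \<Rightarrow> (real \<Rightarrow> real) \<Rightarrow> real \<Rightarrow> 'a \<Rightarrow> 'a \<Rightarrow> (real \<Rightarrow> 'a) \<Rightarrow> bool" where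
  "kirchhoff_class_solution D A m \<alpha> u0 u1 u \<longleftrightarrow>
     kirchhoff_solution D A m u0 u1 u \<and>
     C1_into (op_power_dom D A \<alpha>) (op_power D A \<alpha>) u \<and>
     C0_into (op_power_dom D A (\<alpha> + 1/2)) (op_power D A (\<alpha> + 1/2)) u"

end

theory Submission
  imports Defs
begin

text \<open>
  Eigenvectors span \<open>H\<close>, so the equation splits into components \<open>u\<^sub>k'' + c(t) \<lambda>\<^sub>k\<^sup>2 u\<^sub>k = 0\<close>
  that are coupled only through \<open>c(t) = m(\<bar>A\<^bsup>1/2\<^esup> u\<bar>\<^sup>2)\<close>. If \<open>c\<close> is Lipschitz with constant \<open>L\<close>, the
  energy of every component grows at most like \<open>exp (L t / \<nu>)\<close>, and \<open>L\<close> is controlled by the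
  norm of \<open>(u, u')\<close> in \<open>D(A\<^bsup>3/4\<^esup>) \<times> D(A\<^bsup>1/4\<^esup>)\<close>. By conservation of the Hamiltonian the modes up to
  \<open>n\<close> contribute at most \<open>C \<lambda>\<^sub>n\<close> to that norm; by the gap condition the modes above \<open>n\<close> start
  with a contribution of order \<open>\<lambda>\<^bsub>n+1\<^esub>\<^bsup>-(4\<alpha>-1)\<^esup> \<le> exp (- (4 \<alpha> - 1) \<lambda>\<^sub>n)\<close>. Hence the high modes stay small on a
  time interval whose length depends only on the Hamiltonian and on \<open>\<alpha>\<close>, and since the norm in
  \<open>D(A\<^bsup>\<alpha> + 1/2\<^esup>) \<times> D(A\<^sup>\<alpha>)\<close> is still finite at its end, the argument can be repeated. These bounds are
  uniform for solutions with finitely many modes, which converge to the solution.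
\<close>

section \<open>Hilbert space preliminaries\<close>

text \<open>Powers come from an arbitrarily chosen spectral measure and from \<open>THE\<close>, so
  they must first be identified with multipliers on an eigenspace decomposition; for a vector in the
  kernel of A, the value 0 of A could be a mere default. For the equation there are two obstacles.
  First, \<open>m\<close> is only locally Lipschitz and is replaced by a function constant beyond a
  radius \<open>R\<close>. The Hamiltonian estimate behind \<open>R\<close> bounds \<open>m\<close>
  from above only between 0 and the initial value of |A^(1/2) u|^2, so it is independent of the
  clamping and the solution never feels it. Second, comparing two solutions loses regularity, so
  Galerkin solutions are seen to be close only in too weak a norm. Strong convergence is recovered
  because the growth factor is the same for all modes: each mode of each approximation is dominated
  by a fixed multiple of that mode of the data, and tails are uniformly small. The exponent 4
  \<alpha> - 1 is a surplus: the Lipschitz bound for the coefficient needs one power of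
  \<open>lam\<close>, the data provide \<open>lam\<close> to the power 4 \<alpha>.\<close>

lemma norm_add_sq: "(norm (x + y))\<^sup>2 = (norm x)\<^sup>2 + 2 * inner x y + (norm y)\<^sup>2"
  for x y :: "'a::real_inner"
  by (simp add: power2_norm_eq_inner inner_simps inner_commute)

lemma norm_diff_sq: "(norm (x - y))\<^sup>2 = (norm x)\<^sup>2 - 2 * inner x y + (norm y)\<^sup>2"
  for x y :: "'a::real_inner"
  by (simp add: power2_norm_eq_inner inner_simps inner_commute)

lemma norm_add_sq_le: "(norm (x + y))\<^sup>2 \<le> 2 * (norm x)\<^sup>2 + 2 * (norm y)\<^sup>2"
  for x y :: "'a::real_inner"
  using norm_add_sq[of x y] norm_diff_sq[of x y] zero_le_power2[of "norm (x - y)"] by linarith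

lemma norm_diff_sq_le: "(norm (x - y))\<^sup>2 \<le> 2 * (norm x)\<^sup>2 + 2 * (norm y)\<^sup>2"
  for x y :: "'a::real_inner"
  using norm_add_sq[of x y] norm_diff_sq[of x y] zero_le_power2[of "norm (x + y)"] by linarith

text \<open>A minimizing sequence for the distance from \<open>x\<close> to \<open>S\<close> is
  Cauchy by the parallelogram identity; its limit is the foot of the perpendicular.\<close>

lemma orthogonal_projection_exists:
  fixes S :: "'a::{real_inner,complete_space} set"
  assumes S: "subspace S" "closed S"
  obtains p where "p \<in> S" "\<And>s. s \<in> S \<Longrightarrow> inner (x - p) s = 0"
proof -
  define d where "d = (INF s\<in>S. (norm (x - s))\<^sup>2)"
  have bdd: "bdd_below ((\<lambda>s. (norm (x - s))\<^sup>2) ` S)" by (rule bdd_belowI[of _ 0]) auto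
  have ne: "S \<noteq> {}" using S(1) subspace_0 by auto
  have dle: "d \<le> (norm (x - s))\<^sup>2" if "s \<in> S" for s
    unfolding d_def using bdd that by (rule cINF_lower)
  have "\<exists>s\<in>S. (norm (x - s))\<^sup>2 < d + inverse (real (Suc n))" for n
    using cINF_less_iff[OF ne bdd, of "d + inverse (real (Suc n))"] by (auto simp: d_def)
  then obtain f where f: "\<And>n. f n \<in> S" "\<And>n. (norm (x - f n))\<^sup>2 < d + inverse (real (Suc n))"
    by metis
  \<comment> \<open>The midpoint of \<open>a\<close> and \<open>b\<close> lies in \<open>S\<close>,
    so its squared distance is at least \<open>d\<close>; the parallelogram identity bounds
    \<open>a - b\<close> by the two excesses over \<open>d\<close>.\<close>
  have par: "(norm (a - b))\<^sup>2 \<le> 2 * ((norm (x - a))\<^sup>2 - d) + 2 * ((norm (x - b))\<^sup>2 - d)"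
    if "a \<in> S" "b \<in> S" for a b
  proof -
    have "(1/2) *\<^sub>R (a + b) \<in> S" using that S(1) by (simp add: subspace_add subspace_scale)
    from dle[OF this] have "4 * d \<le> (norm (2 *\<^sub>R (x - (1/2) *\<^sub>R (a + b))))\<^sup>2"
      unfolding norm_scaleR by (simp add: power_mult_distrib)
    also have "2 *\<^sub>R (x - (1/2) *\<^sub>R (a + b)) = (x - a) + (x - b)"
      by (simp add: algebra_simps scaleR_2)
    finally have *: "4 * d \<le> (norm ((x - a) + (x - b)))\<^sup>2" .
    have "(norm (a - b))\<^sup>2 = (norm ((x - a) - (x - b)))\<^sup>2"
      by (simp add: norm_minus_commute)
    then show ?thesis
      using * norm_add_sq[of "x - a" "x - b"] norm_diff_sq[of "x - a" "x - b"] by (smt (verit))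
  qed
  have lin: "A < q" if "A \<le> 2 * (B - d) + 2 * (C - d)" "B < d + b" "C < d + c" "b \<le> r" "c \<le> r" "r < q / 4"
    for A B C b c r q :: real
  proof -
    have "A < 2 * b + 2 * c" using that(1-3) by argo
    also have "\<dots> \<le> 4 * r" using that(4,5) by linarith
    also have "\<dots> < q" using that(6) by simp
    finally show ?thesis .
  qed
  have "Cauchy f"
  proof (rule metric_CauchyI)
    fix e :: real assume e: "e > 0"
    obtain M where M: "inverse (real (Suc M)) < e\<^sup>2 / 4"
      using e reals_Archimedean[of "e\<^sup>2/4"] by auto
    show "\<exists>M. \<forall>m\<ge>M. \<forall>n\<ge>M. dist (f m) (f n) < e"
    proof (intro exI allI impI)
      fix m n assume mn: "M \<le> m" "M \<le> n"
      have "inverse (real (Suc m)) \<le> inverse (real (Suc M))" "inverse (real (Suc n)) \<le> inverse (real (Suc M))"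
        using mn by (auto intro!: le_imp_inverse_le)
      then have "(norm (f m - f n))\<^sup>2 < e\<^sup>2"
        using lin[OF par[OF f(1) f(1)] f(2) f(2) _ _ M] by blast
      then show "dist (f m) (f n) < e" using e by (simp add: dist_norm power_less_imp_less_base)
    qed
  qed
  then obtain p where p: "f \<longlonglongrightarrow> p" using Cauchy_convergent convergent_def by blast
  have pS: "p \<in> S" using closed_sequentially[OF S(2)] f(1) p by blast
  have "(\<lambda>n. (norm (x - f n))\<^sup>2) \<longlonglongrightarrow> (norm (x - p))\<^sup>2" by (intro tendsto_intros p)
  moreover have "(\<lambda>n. d + inverse (real (Suc n))) \<longlonglongrightarrow> d + 0"
    by (intro tendsto_intros LIMSEQ_inverse_real_of_nat)
  ultimately have dp: "(norm (x - p))\<^sup>2 \<le> d"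
    by (metis (no_types, lifting) LIMSEQ_le add.right_neutral f(2) less_imp_le)
  have "inner (x - p) s = 0" if s: "s \<in> S" for s
  proof (cases "s = 0")
    case False
    \<comment> \<open>This \<open>t\<close> minimizes the distance along \<open>s\<close>; the
      comparison with \<open>p + t s\<close> then leaves minus a square, which must vanish.\<close>
    define t where "t = inner (x - p) s / (norm s)\<^sup>2"
    have "p + t *\<^sub>R s \<in> S" using pS s S(1) by (simp add: subspace_add subspace_scale)
    from dle[OF this] dp have "(norm (x - p))\<^sup>2 \<le> (norm ((x - p) - t *\<^sub>R s))\<^sup>2"
      by (metis diff_diff_eq order_trans)
    then have "0 \<le> - 2 * t * inner (x - p) s + t\<^sup>2 * (norm s)\<^sup>2"
      by (simp add: norm_diff_sq power_mult_distrib)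
    also have "\<dots> = - ((inner (x - p) s)\<^sup>2 / (norm s)\<^sup>2)"
      using False by (simp add: t_def power2_eq_square field_simps)
    finally have "(inner (x - p) s)\<^sup>2 / (norm s)\<^sup>2 \<le> 0" by simp
    then show ?thesis using False by (simp add: divide_le_0_iff)
  qed simp
  with pS show thesis using that by blast
qed

text \<open>A vector \<open>q\<close> perpendicular to the kernel carries all of \<open>f\<close>,
  since subtracting \<open>(f v / f q) q\<close> from \<open>v\<close> lands in the kernel.\<close>

lemma Riesz_representation:
  fixes f :: "'a::{real_inner,complete_space} \<Rightarrow> real"
  assumes "bounded_linear f"
  obtains z where "\<And>v. f v = inner z v"
proof (cases "\<forall>v. f v = 0")
  case True
  then show thesis using that[of 0] by simp
next
  case False
  interpret bounded_linear f by fact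
  obtain x where x: "f x \<noteq> 0" using False by auto
  have sub: "subspace {v. f v = 0}" by (auto simp: subspace_def add scaleR)
  have clo: "closed {v. f v = 0}"
    by (intro closed_Collect_eq continuous_intros linear_continuous_on assms)
  obtain p where p: "f p = 0" "\<And>s. f s = 0 \<Longrightarrow> inner (x - p) s = 0"
    using orthogonal_projection_exists[OF sub clo, of x] by auto
  define q where "q = x - p"
  have fq: "f q \<noteq> 0" using x p by (simp add: q_def diff)
  then have q0: "inner q q \<noteq> 0" by (auto simp: zero)
  have "f v = inner ((f q / inner q q) *\<^sub>R q) v" for v
  proof -
    have "f (v - (f v / f q) *\<^sub>R q) = 0" using fq by (simp add: diff scaleR)
    from p(2)[OF this] have "inner q v = (f v / f q) * inner q q"
      by (simp add: q_def[symmetric] inner_simps)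
    then show ?thesis using fq q0 by (simp add: field_simps)
  qed
  then show thesis using that by blast
qed

text \<open>The integral is built weakly: the scalar integrals of \<open>inner (f s) v\<close> form
  a bounded functional of \<open>v\<close>, which the Riesz theorem represents by a vector.
  Differentiability in norm follows by testing the remainder against itself.\<close>

lemma antiderivative_exists:
  fixes f :: "real \<Rightarrow> 'a::{real_inner,complete_space}"
  assumes f: "continuous_on {0..} f"
  obtains F where "F 0 = 0" "\<And>t. 0 \<le> t \<Longrightarrow> (F has_vector_derivative f t) (at t within {0..})"
proof -
  have int: "(\<lambda>s. inner (f s) v) integrable_on {a..b}" if "0 \<le> a" for v a b
    using that by (intro integrable_continuous_real continuous_intros continuous_on_subset[OF f]) auto
  have "\<exists>z. \<forall>v. integral {0..t} (\<lambda>s. inner (f s) v) = inner z v" for t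
  proof -
    have "compact (f ` {0..t})"
      by (intro compact_continuous_image continuous_on_subset[OF f]) auto
    then obtain B where B: "\<And>s. s \<in> {0..t} \<Longrightarrow> norm (f s) \<le> B"
      by (meson bounded_iff compact_imp_bounded image_eqI)
    have "bounded_linear (\<lambda>v. integral {0..t} (\<lambda>s. inner (f s) v))"
    proof (rule bounded_linear_intro[where K="max 0 t * B"])
      fix x y r
      show "integral {0..t} (\<lambda>s. inner (f s) (x + y)) =
          integral {0..t} (\<lambda>s. inner (f s) x) + integral {0..t} (\<lambda>s. inner (f s) y)"
        by (simp add: inner_add_right integral_add int)
      show "integral {0..t} (\<lambda>s. inner (f s) (r *\<^sub>R x)) = r *\<^sub>R integral {0..t} (\<lambda>s. inner (f s) x)"
        by (simp add: int)
      show "norm (integral {0..t} (\<lambda>s. inner (f s) x)) \<le> norm x * (max 0 t * B)"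
      proof (cases "t \<ge> 0")
        case True
        have "norm (integral {0..t} (\<lambda>s. inner (f s) x)) \<le> (B * norm x) * (t - 0)"
          using True
          by (intro integral_bound continuous_intros continuous_on_subset[OF f])
             (auto intro!: order_trans[OF Cauchy_Schwarz_ineq2] mult_right_mono B)
        then show ?thesis using True by (simp add: mult_ac)
      qed simp
    qed
    from Riesz_representation[OF this] show ?thesis by metis
  qed
  then obtain F where F: "\<And>t v. integral {0..t} (\<lambda>s. inner (f s) v) = inner (F t) v" by metis
  have diff: "inner (F s - F t - (s - t) *\<^sub>R w) v = integral {t..s} (\<lambda>r. inner (f r - w) v)"
    if "0 \<le> t" "t \<le> s" for s t v w
  proof -
    have "integral {0..t} (\<lambda>r. inner (f r) v) + integral {t..s} (\<lambda>r. inner (f r) v) = integral {0..s} (\<lambda>r. inner (f r) v)"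
      using that by (intro Henstock_Kurzweil_Integration.integral_combine int) auto
    moreover have "integral {t..s} (\<lambda>r. inner (f r) v - inner w v)
        = integral {t..s} (\<lambda>r. inner (f r) v) - integral {t..s} (\<lambda>r. inner w v)"
      using that by (intro integral_diff int) auto
    ultimately show ?thesis using that by (simp add: F inner_diff_left)
  qed
  have "(F has_vector_derivative f t) (at t within {0..})" if t: "0 \<le> t" for t
    unfolding has_vector_derivative_def has_derivative_within_alt2
  proof (intro conjI allI impI)
    fix e :: real assume e: "e > 0"
    obtain d where d: "d > 0" "\<And>r. 0 \<le> r \<Longrightarrow> dist r t < d \<Longrightarrow> dist (f r) (f t) < e"
      using f t e unfolding continuous_on_iff by force
    \<comment> \<open>Testing with \<open>w\<close> itself turns the scalar identity into
      \<open>|w|^2 \<le> e |w| |s - t|\<close>. The sign \<open>c\<close> covers \<open>s\<close> on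
      either side of \<open>t\<close>.\<close>
    have bound: "norm w \<le> e * \<bar>s - t\<bar>"
      if w: "inner w w = integral {min s t..max s t} (\<lambda>r. inner (f r - f t) (c *\<^sub>R w))"
        and s: "0 \<le> s" "\<bar>s - t\<bar> < d" and c: "\<bar>c\<bar> = 1" for w s c
    proof (cases "w = 0")
      case False
      have "norm (integral {min s t..max s t} (\<lambda>r. inner (f r - f t) (c *\<^sub>R w))) \<le> (e * norm w) * (max s t - min s t)"
      proof (rule integral_bound)
        show "continuous_on {min s t..max s t} (\<lambda>r. inner (f r - f t) (c *\<^sub>R w))"
          using s t by (intro continuous_intros continuous_on_subset[OF f]) auto
        fix r assume r: "r \<in> {min s t..max s t}"
        then have "norm (f r - f t) \<le> e" using d(2)[of r] s t by (cases "s \<le> t") (auto simp: dist_norm intro: less_imp_le)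
        then show "norm (inner (f r - f t) (c *\<^sub>R w)) \<le> e * norm w"
          using c by (auto intro!: order_trans[OF Cauchy_Schwarz_ineq2] mult_right_mono simp: abs_mult)
      qed auto
      then have "inner w w \<le> e * norm w * \<bar>s - t\<bar>" using w by (auto simp: abs_if max_def min_def split: if_splits)
      then have "norm w * norm w \<le> norm w * (e * \<bar>s - t\<bar>)"
        by (simp add: dot_square_norm power2_eq_square mult_ac)
      then show ?thesis using False by (simp add: mult_le_cancel_left)
    qed (use e in auto)
    have "norm (F s - F t - (s - t) *\<^sub>R f t) \<le> e * norm (s - t)" if s: "0 \<le> s" "\<bar>s - t\<bar> < d" for s
    proof (cases "t \<le> s")
      case True
      have "min s t = t" "max s t = s" using True by auto
      then show ?thesis using bound[OF _ s, of "F s - F t - (s - t) *\<^sub>R f t" 1] diff[OF t True, of "f t" "F s - F t - (s - t) *\<^sub>R f t"] True by simp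
    next
      case False
      let ?w = "F s - F t - (s - t) *\<^sub>R f t"
      have w: "?w = - (F t - F s - (t - s) *\<^sub>R f t)" by (simp add: algebra_simps)
      have "inner ?w ?w = integral {s..t} (\<lambda>r. inner (f r - f t) ((-1) *\<^sub>R ?w))"
        using diff[OF s(1), of t "f t" ?w] False unfolding w
        by (simp only: inner_minus_left inner_minus_right scaleR_minus1_left minus_minus integral_neg)
      then show ?thesis using bound[of ?w s "-1"] False s by (auto simp: min_def max_def)
    qed
    then have "\<forall>s\<in>{0..}. dist s t < d \<longrightarrow> norm (F s - F t - (s - t) *\<^sub>R f t) \<le> e * norm (s - t)"
      by (auto simp: dist_real_def)
    then show "\<forall>\<^sub>F y in at t within {0..}. norm (F y - F t - (y - t) *\<^sub>R f t) \<le> e * norm (y - t)"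
      unfolding eventually_at using d(1) by blast
  qed (rule bounded_linear_scaleR_left)
  moreover have "F 0 = 0" using F[of 0 "F 0"] by simp
  ultimately show thesis using that by blast
qed

lemma zero_derivative_constant:
  fixes F :: "real \<Rightarrow> 'a::real_inner"
  assumes "\<And>t. 0 \<le> t \<Longrightarrow> (F has_vector_derivative 0) (at t within {0..})" and "0 \<le> t"
  shows "F t = F 0"
proof -
  have "inner (F t) v = inner (F 0) v" for v
  proof -
    have "\<exists>c. \<forall>s\<in>{0..}. inner (F s) v = c"
    proof (rule has_derivative_zero_constant)
      fix s :: real assume "s \<in> {0..}"
      then have "((\<lambda>s. inner (F s) v) has_vector_derivative inner 0 v) (at s within {0..})"
        by (intro bounded_linear.has_vector_derivative[OF bounded_linear_inner_left] assms) auto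
      then show "((\<lambda>s. inner (F s) v) has_derivative (\<lambda>h. 0)) (at s within {0..})"
        by (simp add: has_vector_derivative_def)
    qed simp
    then show ?thesis using assms(2) by auto
  qed
  from this[of "F t - F 0"] have "inner (F t - F 0) (F t - F 0) = 0" by (simp add: inner_diff_left)
  then show ?thesis by simp
qed

text \<open>The differences \<open>f m - f n\<close> have a small Lipschitz constant up to
  \<open>t + 1\<close>; letting \<open>m\<close> tend to infinity transfers it to
  \<open>g - f n\<close>, and then a single good \<open>n\<close> suffices.\<close>

lemma has_vector_derivative_uniform_limit:
  fixes f :: "nat \<Rightarrow> real \<Rightarrow> 'a::real_normed_vector"
  assumes df: "\<And>n t. 0 \<le> t \<Longrightarrow> (f n has_vector_derivative f' n t) (at t within {0..})"
    and f: "\<And>t. 0 \<le> t \<Longrightarrow> (\<lambda>n. f n t) \<longlonglongrightarrow> g t"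
    and f': "\<And>T. uniform_limit {0..T} f' g' sequentially"
    and t: "0 \<le> t"
  shows "(g has_vector_derivative g' t) (at t within {0..})"
proof -
  have lip: "\<exists>N. \<forall>m\<ge>N. \<forall>n\<ge>N. \<forall>x\<in>{0..t+1}. \<forall>y\<in>{0..t+1}.
      norm ((f m x - f n x) - (f m y - f n y)) \<le> e * norm (x - y)" if e: "e > 0" for e
  proof (rule has_derivative_sequence_Lipschitz[where f' = "\<lambda>n x h. h *\<^sub>R f' n x" and g' = "\<lambda>x h. h *\<^sub>R g' x"])
    fix n x assume "x \<in> {0..t+1}"
    then show "(f n has_derivative (\<lambda>h. h *\<^sub>R f' n x)) (at x within {0..t + 1})"
      using df[of x n] unfolding has_vector_derivative_def
      by (auto intro: has_derivative_subset)
  next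
    fix e :: real assume "e > 0"
    then have "\<forall>\<^sub>F n in sequentially. \<forall>x\<in>{0..t+1}. dist (f' n x) (g' x) < e"
      using f' uniform_limitD by blast
    then show "\<forall>\<^sub>F n in sequentially. \<forall>x\<in>{0..t + 1}. \<forall>h. norm (h *\<^sub>R f' n x - h *\<^sub>R g' x) \<le> e * norm h"
      by eventually_elim
         (auto simp: dist_norm scaleR_diff_right[symmetric] mult.commute[of e] intro!: mult_left_mono intro: less_imp_le)
  qed (use e in auto)
  show ?thesis
    unfolding has_vector_derivative_def has_derivative_within_alt2
  proof (intro conjI allI impI)
    fix e :: real assume "e > 0"
    then have e: "e / 3 > 0" by simp
    obtain N where N: "\<And>m n x y. m \<ge> N \<Longrightarrow> n \<ge> N \<Longrightarrow> x \<in> {0..t+1} \<Longrightarrow> y \<in> {0..t+1} \<Longrightarrow>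
      norm ((f m x - f n x) - (f m y - f n y)) \<le> (e/3) * norm (x - y)" using lip[OF e] by blast
    have "\<forall>\<^sub>F n in sequentially. \<forall>x\<in>{0..t}. dist (f' n x) (g' x) < e/3"
      using f' e uniform_limitD by blast
    then obtain n where n: "n \<ge> N" "norm (f' n t - g' t) < e/3"
      using t unfolding eventually_sequentially by (metis atLeastAtMost_iff dist_norm linear order_refl)
    have lim: "norm ((g x - f n x) - (g t - f n t)) \<le> (e/3) * norm (x - t)" if x: "x \<in> {0..t+1}" for x
    proof (rule LIMSEQ_le_const2)
      show "(\<lambda>m. norm ((f m x - f n x) - (f m t - f n t))) \<longlonglongrightarrow> norm ((g x - f n x) - (g t - f n t))"
        using x t by (intro tendsto_intros f) auto
      show "\<exists>M. \<forall>m\<ge>M. norm (f m x - f n x - (f m t - f n t)) \<le> e / 3 * norm (x - t)"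
        using N n x t by (intro exI[of _ N]) auto
    qed
    have "\<forall>\<^sub>F y in at t within {0..}. norm (f n y - f n t - (y - t) *\<^sub>R f' n t) \<le> (e/3) * norm (y - t)"
      using df[OF t, of n] e unfolding has_vector_derivative_def has_derivative_within_alt2 by blast
    moreover have "\<forall>\<^sub>F y in at t within {0..}. y \<in> {0..t+1}"
      unfolding eventually_at by (intro exI[of _ 1]) (auto simp: dist_real_def)
    ultimately show "\<forall>\<^sub>F y in at t within {0..}. norm (g y - g t - (y - t) *\<^sub>R g' t) \<le> e * norm (y - t)"
    proof eventually_elim
      case (elim y)
      have eq: "g y - g t - (y - t) *\<^sub>R g' t = ((g y - f n y) - (g t - f n t)) +
          (f n y - f n t - (y - t) *\<^sub>R f' n t) + (y - t) *\<^sub>R (f' n t - g' t)"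
        by (simp add: algebra_simps)
      have "norm (g y - g t - (y - t) *\<^sub>R g' t) \<le> (e/3) * norm (y - t) + (e/3) * norm (y - t) + (e/3) * norm (y - t)"
        unfolding eq using lim[of y] elim n(2)
        by (intro order_trans[OF norm_triangle_ineq] add_mono)
           (simp_all only: norm_scaleR real_norm_def mult.commute[of "e/3"] mult_left_mono abs_ge_zero atLeastAtMost_iff less_imp_le)
      then show ?case by simp
    qed
  qed (rule bounded_linear_scaleR_left)
qed

section \<open>Orthogonal decompositions and multipliers\<close>

lemma norm_sum_Pythagoras:
  fixes y :: "'i \<Rightarrow> 'a::real_inner"
  assumes "finite A" "\<forall>j\<in>A. \<forall>k\<in>A. j \<noteq> k \<longrightarrow> inner (y j) (y k) = 0"
  shows "(norm (\<Sum>k\<in>A. y k))\<^sup>2 = (\<Sum>k\<in>A. (norm (y k))\<^sup>2)"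
  using assms
proof (induction A rule: finite_induct)
  case (insert a A)
  have "inner (y a) (\<Sum>k\<in>A. y k) = 0"
    using insert by (auto simp: inner_sum_right intro!: sum.neutral)
  then show ?case using insert by (simp add: norm_add_sq)
qed simp

lemma orthogonal_series_sums:
  fixes y :: "nat \<Rightarrow> 'a::{real_inner,complete_space}"
  assumes orth: "\<And>j k. j \<noteq> k \<Longrightarrow> inner (y j) (y k) = 0"
    and summ: "summable (\<lambda>k. (norm (y k))\<^sup>2)"
  obtains z where "y sums z"
proof -
  have "Cauchy (\<lambda>n. \<Sum>k<n. y k)"
  proof (rule metric_CauchyI)
    fix e :: real assume e: "e > 0"
    obtain M where M: "\<And>m n. m \<ge> M \<Longrightarrow> norm (\<Sum>k=m..<n. (norm (y k))\<^sup>2) < e\<^sup>2"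
      using summ e unfolding summable_Cauchy by (meson zero_less_power)
    have less: "dist (\<Sum>k<m. y k) (\<Sum>k<n. y k) < e" if mn: "M \<le> m" "m \<le> n" for m n
    proof -
      have "(\<Sum>k<n. y k) = (\<Sum>k<m. y k) + (\<Sum>k=m..<n. y k)"
        using mn by (simp add: lessThan_atLeast0 sum.atLeastLessThan_concat)
      then have "(dist (\<Sum>k<m. y k) (\<Sum>k<n. y k))\<^sup>2 = (\<Sum>k=m..<n. (norm (y k))\<^sup>2)"
        using norm_sum_Pythagoras[of "{m..<n}" y] orth by (simp add: dist_norm)
      also have "\<dots> < e\<^sup>2" using M[of m n] mn by simp
      finally show ?thesis using e by (simp add: power_less_imp_less_base)
    qed
    show "\<exists>M. \<forall>m\<ge>M. \<forall>n\<ge>M. dist (\<Sum>k<m. y k) (\<Sum>k<n. y k) < e"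
      using less by (metis dist_commute nle_le)
  qed
  then obtain z where "(\<lambda>n. \<Sum>k<n. y k) \<longlonglongrightarrow> z" by (auto simp: Cauchy_convergent_iff convergent_def)
  then show thesis using that[of z] by (simp add: sums_def)
qed

locale orthogonal_decomposition =
  fixes P :: "nat \<Rightarrow> 'a::{real_inner,complete_space} \<Rightarrow> 'a"
  assumes P_bl: "bounded_linear (P k)"
    and P_idem: "P k (P k x) = P k x"
    and P_sym: "inner (P k x) y = inner x (P k y)"
    and P_orth: "j \<noteq> k \<Longrightarrow> P j (P k x) = 0"
    and P_sums: "(\<lambda>k. P k x) sums x"
begin

lemma P_add: "P k (x + y) = P k x + P k y"
  and P_diff: "P k (x - y) = P k x - P k y"
  and P_scaleR: "P k (c *\<^sub>R x) = c *\<^sub>R P k x"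
  and P_zero: "P k 0 = 0"
  and P_minus: "P k (- x) = - P k x"
  using P_bl[of k] by (auto simp: linear_simps)

lemma P_P: "P j (P k x) = (if j = k then P k x else 0)"
  using P_idem P_orth by auto

lemma inner_P_P: "j \<noteq> k \<Longrightarrow> inner (P j x) (P k y) = 0"
  by (metis P_orth P_sym inner_zero_right)

lemma inner_P: "inner (P k x) (P k y) = inner (P k x) y"
  by (metis P_idem P_sym)

lemma inner_sums: "(\<lambda>k. inner (P k x) (P k y)) sums inner x y"
  unfolding inner_P by (rule bounded_linear.sums[OF bounded_linear_inner_left P_sums])

lemma norm_sums: "(\<lambda>k. (norm (P k x))\<^sup>2) sums (norm x)\<^sup>2"
  using inner_sums[of x x] by (simp add: power2_norm_eq_inner)

lemma decomposition_eqI: "(\<And>k. P k x = P k y) \<Longrightarrow> x = y"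
  using sums_unique2[OF P_sums[of x], of y] P_sums[of y] by simp

text \<open>
  For an operator \<open>A\<close> with eigenprojections \<open>P k\<close> and eigenvalues \<open>\<mu> k\<close>, the multiplier by
  \<open>h k = f (\<mu> k)\<close> is \<open>f(A)\<close>.
\<close>

definition mdom :: "(nat \<Rightarrow> real) \<Rightarrow> 'a set" where
  "mdom h = {x. summable (\<lambda>k. (h k)\<^sup>2 * (norm (P k x))\<^sup>2)}"

definition mop :: "(nat \<Rightarrow> real) \<Rightarrow> 'a \<Rightarrow> 'a" where
  "mop h x = (\<Sum>k. h k *\<^sub>R P k x)"

lemma mop_sums:
  assumes "x \<in> mdom h"
  shows "(\<lambda>k. h k *\<^sub>R P k x) sums mop h x"
proof -
  have "summable (\<lambda>k. (norm (h k *\<^sub>R P k x))\<^sup>2)"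
    using assms by (simp add: mdom_def power_mult_distrib)
  then obtain z where "(\<lambda>k. h k *\<^sub>R P k x) sums z"
    using orthogonal_series_sums[of "\<lambda>k. h k *\<^sub>R P k x"] by (auto simp: inner_P_P)
  then show ?thesis by (simp add: mop_def sums_iff)
qed

lemma P_mop:
  assumes "x \<in> mdom h"
  shows "P k (mop h x) = h k *\<^sub>R P k x"
proof -
  have "(\<lambda>j. P k (h j *\<^sub>R P j x)) sums P k (mop h x)"
    by (rule bounded_linear.sums[OF P_bl mop_sums[OF assms]])
  moreover have "(\<lambda>j. P k (h j *\<^sub>R P j x)) = (\<lambda>j. if j = k then h k *\<^sub>R P k x else 0)"
    by (auto simp: P_P P_scaleR)
  moreover have "(\<lambda>j. if j = k then h k *\<^sub>R P k x else 0) sums (h k *\<^sub>R P k x)"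
    by (rule sums_single)
  ultimately show ?thesis by (simp add: sums_unique2)
qed

lemma norm_mop:
  assumes "x \<in> mdom h"
  shows "(\<lambda>k. (h k)\<^sup>2 * (norm (P k x))\<^sup>2) sums (norm (mop h x))\<^sup>2"
  using norm_sums[of "mop h x"] by (simp add: P_mop[OF assms] power_mult_distrib)

lemma inner_mop:
  assumes "x \<in> mdom h"
  shows "(\<lambda>k. h k * inner (P k x) (P k y)) sums inner (mop h x) y"
  using inner_sums[of "mop h x" y] by (simp add: P_mop[OF assms])

text \<open>The weighted components are those of an actual vector, hence square summable, so
  membership in the domain comes for free. Most identities for multipliers are reduced to components
  in this way.\<close>

lemma mop_eqI:
  assumes "\<And>k. P k y = h k *\<^sub>R P k x"
  shows "x \<in> mdom h" "mop h x = y"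
proof -
  show *: "x \<in> mdom h"
    using sums_summable[OF norm_sums[of y]] by (simp add: mdom_def assms power_mult_distrib)
  show "mop h x = y" by (rule decomposition_eqI) (simp add: P_mop[OF *] assms)
qed

lemma mop_add:
  assumes "x \<in> mdom h" "y \<in> mdom h"
  shows "x + y \<in> mdom h" "mop h (x + y) = mop h x + mop h y"
  by (rule mop_eqI[of "mop h x + mop h y"]; simp add: P_add P_mop assms scaleR_add_right)+

lemma mop_diff:
  assumes "x \<in> mdom h" "y \<in> mdom h"
  shows "x - y \<in> mdom h" "mop h (x - y) = mop h x - mop h y"
  by (rule mop_eqI[of "mop h x - mop h y"]; simp add: P_diff P_mop assms scaleR_diff_right)+

lemma mop_scaleR:
  assumes "x \<in> mdom h"
  shows "c *\<^sub>R x \<in> mdom h" "mop h (c *\<^sub>R x) = c *\<^sub>R mop h x"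
  by (rule mop_eqI[of "c *\<^sub>R mop h x"]; simp add: P_scaleR P_mop assms)+

lemma P_in_mdom: "P j x \<in> mdom h"
  by (rule mop_eqI(1)[of "h j *\<^sub>R P j x"]; simp add: P_P P_scaleR)

lemma mdom_finite: "(\<And>k. N \<le> k \<Longrightarrow> P k x = 0) \<Longrightarrow> x \<in> mdom h"
  unfolding mdom_def by (auto intro!: summable_finite[of "{..<N}"] simp: not_le) (meson not_le)

lemma mdom_mono:
  assumes "\<And>k. (h k)\<^sup>2 \<le> C * (1 + (g k)\<^sup>2)"
  shows "mdom g \<subseteq> mdom h"
proof
  fix x assume "x \<in> mdom g"
  then have "summable (\<lambda>k. C * ((norm (P k x))\<^sup>2 + (g k)\<^sup>2 * (norm (P k x))\<^sup>2))"
    unfolding mdom_def using sums_summable[OF norm_sums[of x]] by (intro summable_mult summable_add) auto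
  moreover have "norm ((h k)\<^sup>2 * (norm (P k x))\<^sup>2) \<le> C * ((norm (P k x))\<^sup>2 + (g k)\<^sup>2 * (norm (P k x))\<^sup>2)" for k
    using mult_right_mono[OF assms[of k], of "(norm (P k x))\<^sup>2"] by (simp add: algebra_simps)
  ultimately have "summable (\<lambda>k. (h k)\<^sup>2 * (norm (P k x))\<^sup>2)"
    by (rule summable_comparison_test'[where N=0])
  then show "x \<in> mdom h" by (simp add: mdom_def)
qed

text \<open>Each \<open>P k\<close> is continuous, so the relation between components survives the
  limit: multipliers are closed operators.\<close>

lemma mop_closed:
  assumes x: "\<And>n. x n \<in> mdom h" and lim: "x \<longlonglongrightarrow> y" "(\<lambda>n. mop h (x n)) \<longlonglongrightarrow> z"
  shows "y \<in> mdom h" "mop h y = z"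
proof -
  have "P k z = h k *\<^sub>R P k y" for k
  proof (rule LIMSEQ_unique)
    show "(\<lambda>n. P k (mop h (x n))) \<longlonglongrightarrow> P k z"
      by (rule bounded_linear.tendsto[OF P_bl lim(2)])
    show "(\<lambda>n. P k (mop h (x n))) \<longlonglongrightarrow> h k *\<^sub>R P k y"
      unfolding P_mop[OF x] by (intro tendsto_intros bounded_linear.tendsto[OF P_bl lim(1)])
  qed
  then show "y \<in> mdom h" "mop h y = z" by (rule mop_eqI)+
qed

lemma bounded_mop:
  assumes "\<And>k. \<bar>h k\<bar> \<le> C"
  shows "x \<in> mdom h" "norm (mop h x) \<le> C * norm x" "bounded_linear (mop h)"
proof -
  have C: "C \<ge> 0" using assms[of 0] by linarith
  have sq: "(h k)\<^sup>2 \<le> C\<^sup>2" for k using assms[of k] by (meson abs_ge_self abs_le_square_iff order_trans)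
  have dom: "x \<in> mdom h" for x
  proof -
    have "summable (\<lambda>k. C\<^sup>2 * (norm (P k x))\<^sup>2)"
      using sums_summable[OF norm_sums[of x]] by (intro summable_mult)
    then have "summable (\<lambda>k. (h k)\<^sup>2 * (norm (P k x))\<^sup>2)"
      by (rule summable_comparison_test'[where N=0]) (auto intro!: mult_right_mono sq)
    then show ?thesis by (simp add: mdom_def)
  qed
  have nrm: "norm (mop h x) \<le> C * norm x" for x
  proof (rule power2_le_imp_le)
    have "(norm (mop h x))\<^sup>2 \<le> C\<^sup>2 * (norm x)\<^sup>2"
      by (rule sums_le[OF _ norm_mop[OF dom] sums_mult[OF norm_sums]]) (auto intro: mult_right_mono sq)
    then show "(norm (mop h x))\<^sup>2 \<le> (C * norm x)\<^sup>2" by (simp add: power_mult_distrib)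
  qed (simp add: C)
  show "x \<in> mdom h" "norm (mop h x) \<le> C * norm x" using dom nrm by auto
  show "bounded_linear (mop h)"
    by (rule bounded_linear_intro[where K=C]) (simp_all add: mop_add(2)[OF dom dom] mop_scaleR(2)[OF dom] nrm mult.commute[of _ C])
qed

end

section \<open>Self-adjoint operators with uniformly discrete spectrum\<close>

lemma orthogonal_projection_operator:
  fixes S :: "'a::{real_inner,complete_space} set"
  assumes S: "subspace S" "closed S"
  obtains p where "bounded_linear p" "\<And>x. p x \<in> S" "\<And>x. x \<in> S \<Longrightarrow> p x = x"
    "\<And>x s. s \<in> S \<Longrightarrow> inner (p x) s = inner x s" "\<And>x y. inner (p x) y = inner x (p y)"
proof -
  have "\<exists>p\<in>S. \<forall>s\<in>S. inner (x - p) s = 0" for x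
    using orthogonal_projection_exists[OF S, of x] by metis
  then obtain p where p: "\<And>x. p x \<in> S" "\<And>x s. s \<in> S \<Longrightarrow> inner (x - p x) s = 0" by metis
  have uniq: "a = b" if "a \<in> S" "b \<in> S" "\<And>s. s \<in> S \<Longrightarrow> inner a s = inner b s" for a b
    using that(3)[of "a - b"] that(1,2) S(1)
    by (metis inner_diff_left inner_eq_zero_iff right_minus_eq subspace_diff)
  have ip: "inner (p x) s = inner x s" if "s \<in> S" for x s
    using p(2)[OF that, of x] by (simp add: inner_diff_left)
  have nrm: "norm (p x) \<le> norm x" for x
  proof (cases "p x = 0")
    case False
    have "(norm (p x))\<^sup>2 = inner x (p x)" using ip[OF p(1), of x x] by (simp add: power2_norm_eq_inner)
    also have "\<dots> \<le> norm x * norm (p x)" by (rule norm_cauchy_schwarz)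
    finally show ?thesis using False by (simp add: power2_eq_square)
  qed simp
  have "bounded_linear p"
  proof (rule bounded_linear_intro[where K=1])
    fix x y r
    show "p (x + y) = p x + p y"
      by (rule uniq) (auto simp: p(1) S(1) subspace_add ip inner_add_left)
    show "p (r *\<^sub>R x) = r *\<^sub>R p x"
      by (rule uniq) (auto simp: p(1) S(1) subspace_scale ip)
  qed (use nrm in simp)
  moreover have "p x = x" if "x \<in> S" for x by (rule uniq) (auto simp: p(1) that ip)
  moreover have "inner (p x) y = inner x (p y)" for x y
    by (metis ip inner_commute p(1))
  ultimately show thesis using that p(1) ip by blast
qed

lemma subspace_closure:
  fixes S :: "'a::real_normed_vector set"
  assumes S: "subspace S"
  shows "subspace (closure S)"
  unfolding subspace_def
proof (intro conjI ballI allI)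
  show "0 \<in> closure S" using S closure_subset subspace_0 by blast
next
  fix x y assume "x \<in> closure S" "y \<in> closure S"
  then obtain f g where "\<And>n. f n \<in> S" "f \<longlonglongrightarrow> x" "\<And>n. g n \<in> S" "g \<longlonglongrightarrow> y"
    unfolding closure_sequential by blast
  then show "x + y \<in> closure S"
    unfolding closure_sequential using S
    by (intro exI[of _ "\<lambda>n. f n + g n"]) (auto intro: tendsto_add subspace_add)
next
  fix c :: real and x assume "x \<in> closure S"
  then obtain f where "\<And>n. f n \<in> S" "f \<longlonglongrightarrow> x" unfolding closure_sequential by blast
  then show "c *\<^sub>R x \<in> closure S"
    unfolding closure_sequential using S
    by (intro exI[of _ "\<lambda>n. c *\<^sub>R f n"]) (auto intro: tendsto_scaleR subspace_scale)
qed

text \<open>With \<open>s\<close> the norm of \<open>S\<close> on \<open>K\<close>, unit vectors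
  satisfy \<open>|S S x - s^2 x|^2 \<le> 2 s^4 - 2 s^2 |S x|^2\<close>, which is small when
  \<open>x\<close> nearly attains the norm. This supplies approximate eigenvectors of
  \<open>S^2\<close> where no eigenvector need exist.\<close>

lemma approximate_norm_attainment:
  fixes S :: "'a::real_inner \<Rightarrow> 'a"
  assumes S: "bounded_linear S" "\<And>x y. inner (S x) y = inner x (S y)"
    and K: "subspace K" "\<And>x. x \<in> K \<Longrightarrow> S x \<in> K" and ne: "\<exists>x\<in>K. S x \<noteq> 0"
  obtains s where "s > 0" "\<And>x. x \<in> K \<Longrightarrow> norm (S x) \<le> s * norm x"
    "\<And>e. e > 0 \<Longrightarrow> \<exists>x\<in>K. norm x = 1 \<and> norm (S (S x) - s\<^sup>2 *\<^sub>R x) < e"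
proof -
  interpret S: bounded_linear S by fact
  define U where "U = {x \<in> K. norm x = 1}"
  define s where "s = (SUP x\<in>U. norm (S x))"
  obtain x0 where x0: "x0 \<in> K" "S x0 \<noteq> 0" using ne by auto
  then have x00: "x0 \<noteq> 0" by (auto simp: S.zero)
  have nU: "(1 / norm x) *\<^sub>R x \<in> U" if "x \<in> K" "x \<noteq> 0" for x
    using that K(1) by (simp add: U_def subspace_scale)
  have Une: "U \<noteq> {}" using nU[OF x0(1) x00] by auto
  obtain B where B: "\<And>x. norm (S x) \<le> norm x * B" using S.bounded by blast
  have bdd: "bdd_above ((\<lambda>x. norm (S x)) ` U)"
    by (rule bdd_aboveI[of _ B]) (auto simp: U_def intro: order_trans[OF B])
  have le: "norm (S x) \<le> s * norm x" if "x \<in> K" for x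
  proof (cases "x = 0")
    case False
    have "norm (S ((1 / norm x) *\<^sub>R x)) \<le> s"
      unfolding s_def by (rule cSUP_upper[OF nU[OF that False] bdd])
    then show ?thesis using False by (simp add: S.scaleR field_simps)
  qed (simp add: S.zero)
  have spos: "s > 0"
    using le[OF x0(1)] x0(2) x00
    by (smt (verit, best) mult_nonpos_nonneg norm_ge_zero zero_less_norm_iff)
  have "\<exists>x\<in>K. norm x = 1 \<and> norm (S (S x) - s\<^sup>2 *\<^sub>R x) < e" if e: "e > 0" for e
  proof -
    \<comment> \<open>The final estimate is \<open>4 s^3 d\<close>, which this \<open>d\<close>
      keeps below \<open>e^2\<close>; \<open>d \<le> s / 2\<close> keeps \<open>s - d\<close>
      positive for squaring.\<close>
    define d where "d = min (s / 2) (e\<^sup>2 / (4 * s ^ 3))"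
    have d: "0 < d" "d \<le> s / 2" "d \<le> e\<^sup>2 / (4 * s ^ 3)" using e spos by (auto simp: d_def)
    obtain x where x: "x \<in> U" "s - d < norm (S x)"
      using less_cSUP_iff[OF Une bdd, of "s - d"] d(1) by (auto simp: s_def)
    then have xK: "x \<in> K" "norm x = 1" by (auto simp: U_def)
    have "norm (S (S x)) \<le> s * (s * norm x)"
      using le[OF K(2)[OF xK(1)]] le[OF xK(1)] spos by (meson less_imp_le mult_left_mono order_trans)
    then have SS: "(norm (S (S x)))\<^sup>2 \<le> (s\<^sup>2)\<^sup>2"
      using xK by (intro power_mono) (auto simp: power2_eq_square)
    have "(s - d)\<^sup>2 < (norm (S x))\<^sup>2" using x(2) d spos by (intro power_strict_mono) auto
    then have "s\<^sup>2 - 2 * s * d < (norm (S x))\<^sup>2"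
      by (simp add: power2_diff) (smt (verit) zero_le_power2)
    then have Sx: "s\<^sup>2 * (s\<^sup>2 - 2 * s * d) < s\<^sup>2 * (norm (S x))\<^sup>2"
      using spos by (intro mult_strict_left_mono) auto
    have "(norm (S (S x) - s\<^sup>2 *\<^sub>R x))\<^sup>2 = (norm (S (S x)))\<^sup>2 - 2 * (s\<^sup>2 * (norm (S x))\<^sup>2) + (s\<^sup>2)\<^sup>2"
      using xK S(2)[of "S x" x] by (simp add: norm_diff_sq power_mult_distrib power2_norm_eq_inner[of "S x"])
    also have "\<dots> < 2 * (s\<^sup>2)\<^sup>2 - 2 * (s\<^sup>2 * (s\<^sup>2 - 2 * s * d))" using SS Sx by argo
    also have "\<dots> = 4 * s ^ 3 * d" by (simp add: power2_eq_square power3_eq_cube algebra_simps)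
    also have "\<dots> \<le> e\<^sup>2" using d(3) spos by (simp add: field_simps)
    finally have "norm (S (S x) - s\<^sup>2 *\<^sub>R x) < e"
      using e by (simp add: power_less_imp_less_base)
    then show ?thesis using xK by blast
  qed
  then show thesis using that spos le by blast
qed

section \<open>Resolvent bounds and completeness of the eigenspaces\<close>

locale self_adjoint =
  fixes D :: "'a::{real_inner,complete_space} set" and A :: "'a \<Rightarrow> 'a"
  assumes sa: "self_adjoint_operator D A"
begin

lemma D_subspace: "subspace D"
  and A_add: "x \<in> D \<Longrightarrow> y \<in> D \<Longrightarrow> A (x + y) = A x + A y"
  and A_scaleR: "x \<in> D \<Longrightarrow> A (c *\<^sub>R x) = c *\<^sub>R A x"
  and D_dense: "closure D = UNIV"
  using sa by (auto simp: self_adjoint_operator_def linear_operator_on_def)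

lemma A_diff: "x \<in> D \<Longrightarrow> y \<in> D \<Longrightarrow> A (x - y) = A x - A y"
  using A_add[of x "(-1) *\<^sub>R y"] A_scaleR[of y "-1"] D_subspace by (simp add: subspace_neg)

lemma A_sym: "x \<in> D \<Longrightarrow> y \<in> D \<Longrightarrow> inner (A x) y = inner x (A y)"
  using sa by (force simp: self_adjoint_operator_def adjoint_graph_def)

lemma A_adjointI:
  assumes "\<And>x. x \<in> D \<Longrightarrow> inner (A x) v = inner x w"
  shows "v \<in> D" "A v = w"
proof -
  have "(v, w) \<in> adjoint_graph D A" using assms by (simp add: adjoint_graph_def)
  then show "v \<in> D" "A v = w" using sa by (auto simp: self_adjoint_operator_def)
qed

lemma D_orthogonal: "(\<And>x. x \<in> D \<Longrightarrow> inner z x = 0) \<Longrightarrow> z = 0"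
proof -
  assume *: "\<And>x. x \<in> D \<Longrightarrow> inner z x = 0"
  have "closed {x. inner z x = 0}" by (intro closed_Collect_eq continuous_intros)
  then have "closure D \<subseteq> {x. inner z x = 0}" using * by (intro closure_minimal) auto
  then have "z \<in> {x. inner z x = 0}" using D_dense by blast
  then show "z = 0" by simp
qed

definition eigenspace :: "real \<Rightarrow> 'a set" where
  "eigenspace \<mu> = {x \<in> D. A x = \<mu> *\<^sub>R x}"

text \<open>Moving A onto the test vector describes the eigenspace by linear equations continuous in
  \<open>x\<close>; it is then visibly a closed subspace although A is unbounded.\<close>

lemma eigenspace_iff: "x \<in> eigenspace \<mu> \<longleftrightarrow> (\<forall>y\<in>D. inner (A y) x = \<mu> * inner y x)"
proof
  assume "x \<in> eigenspace \<mu>"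
  then show "\<forall>y\<in>D. inner (A y) x = \<mu> * inner y x" by (auto simp: eigenspace_def A_sym)
next
  assume "\<forall>y\<in>D. inner (A y) x = \<mu> * inner y x"
  then show "x \<in> eigenspace \<mu>"
    using A_adjointI[of x "\<mu> *\<^sub>R x"] by (auto simp: eigenspace_def)
qed

lemma eigenspace_subspace: "subspace (eigenspace \<mu>)"
  by (auto simp: subspace_def eigenspace_iff inner_simps algebra_simps)

lemma eigenspace_closed: "closed (eigenspace \<mu>)"
proof -
  have "eigenspace \<mu> = (\<Inter>y\<in>D. {x. inner (A y) x = \<mu> * inner y x})" by (auto simp: eigenspace_iff)
  then show ?thesis by (auto intro!: closed_INT closed_Collect_eq continuous_intros)
qed

lemma eigenspace_orthogonal:
  assumes "x \<in> eigenspace \<mu>" "y \<in> eigenspace \<nu>" "\<mu> \<noteq> \<nu>"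
  shows "inner x y = 0"
  using assms A_sym[of x y] by (auto simp: eigenspace_def)

lemma resolventE:
  assumes "c \<in> op_resolvent_set D A"
  obtains R where "bounded_linear R" "\<And>y. R y \<in> D" "\<And>y. A (R y) - c *\<^sub>R R y = y"
    "\<And>x. x \<in> D \<Longrightarrow> R (A x - c *\<^sub>R x) = x" "\<And>x y. inner (R x) y = inner x (R y)"
proof -
  obtain R where R: "bounded_linear R" "\<And>y. R y \<in> D" "\<And>y. A (R y) - c *\<^sub>R R y = y"
    "\<And>x. x \<in> D \<Longrightarrow> R (A x - c *\<^sub>R x) = x"
    using assms by (auto simp: op_resolvent_set_def)
  have "inner (R x) y = inner x (R y)" for x y
  proof -
    have "inner (R x) (A (R y) - c *\<^sub>R R y) = inner (A (R x) - c *\<^sub>R R x) (R y)"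
      using A_sym[OF R(2) R(2), of x y] by (simp add: inner_diff_left inner_diff_right)
    then show ?thesis by (simp add: R(3))
  qed
  then show thesis using that R by blast
qed

lemma resolvent_bounded_below:
  assumes "c \<in> op_resolvent_set D A"
  obtains \<beta> where "\<beta> > 0" "\<And>x. x \<in> D \<Longrightarrow> \<beta> * norm x \<le> norm (A x - c *\<^sub>R x)"
proof -
  obtain R where R: "bounded_linear R" "\<And>x. x \<in> D \<Longrightarrow> R (A x - c *\<^sub>R x) = x"
    using resolventE[OF assms] by metis
  obtain B where B: "B > 0" "\<And>x. norm (R x) \<le> norm x * B"
    using bounded_linear.pos_bounded[OF R(1)] by blast
  have "(1 / B) * norm x \<le> norm (A x - c *\<^sub>R x)" if "x \<in> D" for x
    using B(2)[of "A x - c *\<^sub>R x"] B(1) R(2)[OF that] by (simp add: field_simps)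
  then show thesis using that[of "1 / B"] B(1) by simp
qed

text \<open>If \<open>R = (A - c)\<^sup>-\<^sup>1\<close> and \<open>x = R y\<close>, then \<open>A x - (c + 1/s) x = - (R y - s y) / s\<close>.\<close>

lemma resolvent_shift_bounded_below:
  assumes R: "\<And>y. R y \<in> D" "\<And>y. A (R y) - c *\<^sub>R R y = y"
    and K: "\<And>x. x \<in> K \<Longrightarrow> R x \<in> K" and s: "s \<noteq> 0"
    and \<beta>: "\<beta> > 0" "\<And>x. x \<in> D \<Longrightarrow> x \<in> K \<Longrightarrow> \<beta> * norm x \<le> norm (A x - (c + 1 / s) *\<^sub>R x)"
  obtains \<gamma> where "\<gamma> > 0" "\<And>y. y \<in> K \<Longrightarrow> \<gamma> * norm y \<le> norm (R y - s *\<^sub>R y)"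
proof -
  let ?s = "\<bar>s\<bar>"
  have s': "?s > 0" using s by simp
  have "?s * (?s * \<beta>) / (1 + ?s * \<beta>) * norm y \<le> norm (R y - s *\<^sub>R y)" if y: "y \<in> K" for y
  proof -
    have "A (R y) - (c + 1 / s) *\<^sub>R R y = (A (R y) - c *\<^sub>R R y) - (1 / s) *\<^sub>R R y"
      by (simp add: algebra_simps)
    also have "\<dots> = (- 1 / s) *\<^sub>R (R y - s *\<^sub>R y)" using s by (simp add: R(2) algebra_simps)
    finally have "norm (A (R y) - (c + 1 / s) *\<^sub>R R y) = norm (R y - s *\<^sub>R y) / ?s" by simp
    then have "\<beta> * norm (R y) \<le> norm (R y - s *\<^sub>R y) / ?s"
      using \<beta>(2)[OF R(1) K[OF y]] by simp
    then have 1: "?s * \<beta> * norm (R y) \<le> norm (R y - s *\<^sub>R y)" using s' by (simp add: field_simps)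
    have "?s * norm y \<le> norm (R y) + norm (R y - s *\<^sub>R y)"
      using norm_triangle_sub[of "s *\<^sub>R y" "R y"] by (simp add: norm_minus_commute)
    then have "?s * \<beta> * (?s * norm y) \<le> ?s * \<beta> * (norm (R y) + norm (R y - s *\<^sub>R y))"
      using s' \<beta>(1) by (intro mult_left_mono) auto
    then have "?s * (?s * \<beta>) * norm y \<le> (1 + ?s * \<beta>) * norm (R y - s *\<^sub>R y)"
      using 1 by (simp add: algebra_simps)
    moreover have "1 + ?s * \<beta> > 0" using s' \<beta>(1) by (simp add: add_pos_nonneg)
    ultimately show ?thesis by (simp add: field_simps)
  qed
  moreover have "?s * (?s * \<beta>) / (1 + ?s * \<beta>) > 0" using s' \<beta>(1) by (simp add: add_pos_nonneg)
  ultimately show thesis using that by blast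
qed

text \<open>The points \<open>c + 1 / s\<close> and \<open>c - 1 / s\<close> for A correspond to
  \<open>s\<close> and \<open>- s\<close> for \<open>R\<close>. Since \<open>R^2 - s^2\<close> is
  the product of \<open>R - s\<close> and \<open>R + s\<close>, it would be bounded below on
  \<open>K\<close> if both factors were, against the approximate eigenvectors.\<close>

lemma not_both_shifts_bounded_below:
  assumes R: "bounded_linear R" "\<And>y. R y \<in> D" "\<And>y. A (R y) - c *\<^sub>R R y = y"
    and K: "\<And>x. x \<in> K \<Longrightarrow> R x \<in> K" "subspace K" and s: "s > 0"
    and appr: "\<And>e. e > 0 \<Longrightarrow> \<exists>x\<in>K. norm x = 1 \<and> norm (R (R x) - s\<^sup>2 *\<^sub>R x) < e"
    and \<beta>: "\<beta> > 0" "\<And>x. x \<in> D \<Longrightarrow> x \<in> K \<Longrightarrow> \<beta> * norm x \<le> norm (A x - (c + 1 / s) *\<^sub>R x)"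
    and \<beta>': "\<beta>' > 0" "\<And>x. x \<in> D \<Longrightarrow> x \<in> K \<Longrightarrow> \<beta>' * norm x \<le> norm (A x - (c - 1 / s) *\<^sub>R x)"
  shows False
proof -
  interpret R: bounded_linear R by fact
  obtain \<gamma> where g: "\<gamma> > 0" "\<And>y. y \<in> K \<Longrightarrow> \<gamma> * norm y \<le> norm (R y - s *\<^sub>R y)"
    using resolvent_shift_bounded_below[OF R(2,3) K(1), of s \<beta>] s \<beta> by auto
  obtain \<gamma>' where g': "\<gamma>' > 0" "\<And>y. y \<in> K \<Longrightarrow> \<gamma>' * norm y \<le> norm (R y - (- s) *\<^sub>R y)"
    using resolvent_shift_bounded_below[OF R(2,3) K(1), of "- s" \<beta>'] s \<beta>' by auto
  obtain x where x: "x \<in> K" "norm x = 1" "norm (R (R x) - s\<^sup>2 *\<^sub>R x) < \<gamma> * \<gamma>'"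
    using appr[of "\<gamma> * \<gamma>'"] g(1) g'(1) by auto
  define z where "z = R x - (- s) *\<^sub>R x"
  have z: "z \<in> K" using x(1) K by (simp add: z_def subspace_add subspace_scale)
  have "R z - s *\<^sub>R z = R (R x) - s\<^sup>2 *\<^sub>R x"
    by (simp add: z_def R.add R.scaleR algebra_simps power2_eq_square)
  then have "\<gamma> * norm z < \<gamma> * \<gamma>'" using g(2)[OF z] x(3) by simp
  moreover have "\<gamma>' \<le> norm z" using g'(2)[OF x(1)] x(2) by (simp add: z_def)
  ultimately show False using g(1) by simp
qed

text \<open>Let \<open>s\<close> be the norm of the resolvent at \<open>c\<close>. Were
  \<open>s > 1 / r\<close>, both \<open>c + 1 / s\<close> and \<open>c - 1 / s\<close> would lie in
  the gap, which \<open>not_both_shifts_bounded_below\<close> forbids.\<close>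

lemma spectral_gap_bound:
  assumes r: "r > 0" and gap: "{c - r<..<c + r} \<subseteq> op_resolvent_set D A" and x: "x \<in> D"
  shows "r * norm x \<le> norm (A x - c *\<^sub>R x)"
proof -
  have "c \<in> op_resolvent_set D A" using gap r by auto
  then obtain R where R: "bounded_linear R" "\<And>y. R y \<in> D" "\<And>y. A (R y) - c *\<^sub>R R y = y"
    "\<And>x. x \<in> D \<Longrightarrow> R (A x - c *\<^sub>R x) = x" "\<And>x y. inner (R x) y = inner x (R y)"
    using resolventE by blast
  show ?thesis
  proof (cases "\<exists>x\<in>UNIV. R x \<noteq> 0")
    case False
    then have "x = 0" using R(4)[OF x] by auto
    then show ?thesis by simp
  next
    case True
    obtain s where s: "s > 0" "\<And>x. norm (R x) \<le> s * norm x"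
      "\<And>e. e > 0 \<Longrightarrow> \<exists>x\<in>UNIV. norm x = 1 \<and> norm (R (R x) - s\<^sup>2 *\<^sub>R x) < e"
      using approximate_norm_attainment[OF R(1,5) subspace_UNIV UNIV_I True] by (metis UNIV_I)
    have "s * r \<le> 1"
    proof (rule ccontr)
      assume "\<not> s * r \<le> 1"
      then have "1 / s < r" "1 / s > 0" using s(1) by (auto simp: field_simps)
      then have "c + 1 / s \<in> {c - r<..<c + r}" "c - 1 / s \<in> {c - r<..<c + r}" using r unfolding greaterThanLessThan_iff by linarith+
      then have "c + 1 / s \<in> op_resolvent_set D A" "c - 1 / s \<in> op_resolvent_set D A"
        using gap by blast+
      then show False
        using not_both_shifts_bounded_below[OF R(1-3) _ subspace_UNIV s(1,3)]
        by (elim resolvent_bounded_below) auto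
    qed
    have "r * norm x \<le> r * (s * norm (A x - c *\<^sub>R x))"
      using s(2)[of "A x - c *\<^sub>R x"] R(4)[OF x] r by simp
    also have "\<dots> \<le> norm (A x - c *\<^sub>R x)"
      using mult_right_mono[OF \<open>s * r \<le> 1\<close>, of "norm (A x - c *\<^sub>R x)"] by (simp add: mult_ac)
    finally show ?thesis .
  qed
qed

text \<open>Functional calculus is avoided: with \<open>B = A - \<mu>\<close>, the gaps on both
  sides of \<mu> yield a quadratic form inequality, polarization makes it bilinear, and
  \<open>x\<close>, being a limit of vectors \<open>B (f n)\<close>, can be inserted into
  it.\<close>

lemma isolated_point_bound:
  assumes \<delta>: "\<delta> > 0" and iso: "\<And>\<nu>. \<nu> \<noteq> \<mu> \<Longrightarrow> \<bar>\<nu> - \<mu>\<bar> < \<delta> \<Longrightarrow> \<nu> \<in> op_resolvent_set D A"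
    and x: "x \<in> D" "\<And>y. y \<in> eigenspace \<mu> \<Longrightarrow> inner y x = 0"
  shows "\<delta> * norm x \<le> norm (A x - \<mu> *\<^sub>R x)"
proof -
  define B where "B = (\<lambda>x. A x - \<mu> *\<^sub>R x)"
  have B_sym: "inner (B x) y = inner x (B y)" if "x \<in> D" "y \<in> D" for x y
    using A_sym[OF that] by (simp add: B_def inner_diff_left inner_diff_right)
  have B_add: "B (x + y) = B x + B y" and B_diff: "B (x - y) = B x - B y"
    if "x \<in> D" "y \<in> D" for x y
    using that by (simp_all add: B_def A_add A_diff algebra_simps)
  have B_scaleR: "B (t *\<^sub>R x) = t *\<^sub>R B x" if "x \<in> D" for t x
    using that by (simp add: B_def A_scaleR algebra_simps)
  \<comment> \<open>On either side, \<open>\<mu> + \<sigma> \<delta> / 2\<close> is the centre of a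
    gap of radius \<open>\<delta> / 2\<close>; after squaring its \<open>spectral_gap_bound\<close>
    the terms with \<open>|y|^2\<close> cancel.\<close>
  have form: "\<delta> * \<bar>inner (B y) y\<bar> \<le> (norm (B y))\<^sup>2" if y: "y \<in> D" for y
  proof -
    have one: "\<sigma> * \<delta> * inner (B y) y \<le> (norm (B y))\<^sup>2" if \<sigma>: "\<bar>\<sigma>\<bar> = 1" for \<sigma>
    proof -
      have "\<bar>\<mu> + \<sigma> * (\<delta>/2) - \<nu>\<bar> < \<delta> / 2 \<Longrightarrow> \<nu> \<in> op_resolvent_set D A" for \<nu>
        using \<sigma> \<delta> by (intro iso) (auto simp: abs_if split: if_splits)
      then have "{\<mu> + \<sigma> * (\<delta>/2) - \<delta>/2<..<\<mu> + \<sigma> * (\<delta>/2) + \<delta>/2} \<subseteq> op_resolvent_set D A"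
        by (intro subsetI) (auto simp: abs_less_iff field_simps)
      from spectral_gap_bound[OF _ this y] \<delta>
      have "(\<delta>/2) * norm y \<le> norm (B y - (\<sigma> * (\<delta>/2)) *\<^sub>R y)" by (simp add: B_def algebra_simps)
      then have "((\<delta>/2) * norm y)\<^sup>2 \<le> (norm (B y - (\<sigma> * (\<delta>/2)) *\<^sub>R y))\<^sup>2"
        using \<delta> by (intro power_mono) auto
      moreover have "\<sigma>\<^sup>2 = 1" using \<sigma> by (metis power2_abs power_one)
      ultimately show ?thesis by (simp add: norm_diff_sq power_mult_distrib power_divide abs_mult)
    qed
    show ?thesis using one[of 1] one[of "-1"] \<delta> by (auto simp: abs_if)
  qed
  have bil: "2 * \<delta> * inner (B y) z \<le> (norm (B y))\<^sup>2 + (norm (B z))\<^sup>2" if yz: "y \<in> D" "z \<in> D" for y z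
  proof -
    have "4 * inner (B y) z = inner (B (y + z)) (y + z) - inner (B (y - z)) (y - z)"
      using B_sym[OF yz] yz by (simp add: B_add B_diff inner_simps inner_commute)
    then have "\<delta> * (4 * inner (B y) z) \<le> \<delta> * \<bar>inner (B (y + z)) (y + z)\<bar> + \<delta> * \<bar>inner (B (y - z)) (y - z)\<bar>"
      using \<delta> by (simp add: distrib_left[symmetric] del: distrib_left_numeral)
    also have "\<dots> \<le> (norm (B (y + z)))\<^sup>2 + (norm (B (y - z)))\<^sup>2"
      using yz D_subspace by (intro add_mono form) (auto simp: subspace_add subspace_diff)
    also have "\<dots> = 2 * (norm (B y))\<^sup>2 + 2 * (norm (B z))\<^sup>2"
      using yz by (simp add: B_add B_diff norm_add_sq norm_diff_sq)
    finally show ?thesis by simp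
  qed
  \<comment> \<open>The closed range of \<open>B\<close>. Whatever is perpendicular to it is an
    eigenvector for \<mu>, so the hypothesis on \<open>x\<close> places \<open>x\<close> in
    it.\<close>
  define S where "S = closure (B ` D)"
  have "subspace (B ` D)"
    unfolding subspace_def
  proof (intro conjI ballI allI)
    show "0 \<in> B ` D" using D_subspace B_scaleR[of 0 0]
      by (metis image_eqI scaleR_zero_left subspace_0)
    show "x + y \<in> B ` D" if "x \<in> B ` D" "y \<in> B ` D" for x y
      using that D_subspace by (auto simp: B_add[symmetric] subspace_add)
    show "c *\<^sub>R x \<in> B ` D" if "x \<in> B ` D" for c x
      using that D_subspace by (auto simp: B_scaleR[symmetric] subspace_scale)
  qed
  then have "subspace S"
    unfolding S_def by (rule subspace_closure)
  moreover have "closed S" by (simp add: S_def)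
  ultimately obtain p where p: "p \<in> S" "\<And>s. s \<in> S \<Longrightarrow> inner (x - p) s = 0"
    using orthogonal_projection_exists by blast
  have "inner (A y) (x - p) = \<mu> * inner y (x - p)" if "y \<in> D" for y
    using p(2)[of "B y"] that closure_subset[of "B ` D"]
    by (auto simp: S_def B_def inner_diff_left inner_diff_right inner_commute algebra_simps)
  then have "x - p \<in> eigenspace \<mu>" by (simp add: eigenspace_iff)
  then have "inner (x - p) (x - p) = 0" using x(2) p by (simp add: inner_diff_right)
  then have "x \<in> S" using p(1) by simp
  then obtain g where g: "\<And>n. g n \<in> B ` D" "g \<longlonglongrightarrow> x"
    unfolding S_def closure_sequential by blast
  from g(1) have "\<exists>f. \<forall>n. f n \<in> D \<and> g n = B (f n)" by (intro choice) auto
  then obtain f where f: "\<And>n. f n \<in> D" and "g = (\<lambda>n. B (f n))" by auto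
  with g(2) have lim: "(\<lambda>n. B (f n)) \<longlonglongrightarrow> x" by simp
  \<comment> \<open>The choice \<open>z = \<delta> f n\<close> balances the terms: in the limit
    \<open>B (f n)\<close> becomes \<open>x\<close>, and \<open>\<delta>^2 |x|^2\<close> can be
    subtracted from both sides.\<close>
  have "2 * \<delta> * (\<delta> * inner x (B (f n))) \<le> (norm (B x))\<^sup>2 + \<delta>\<^sup>2 * (norm (B (f n)))\<^sup>2" for n
    using bil[of x "\<delta> *\<^sub>R f n"] f x(1) D_subspace B_sym[OF x(1) f]
    by (simp add: B_scaleR subspace_scale power_mult_distrib)
  then have "2 * \<delta> * (\<delta> * inner x x) \<le> (norm (B x))\<^sup>2 + \<delta>\<^sup>2 * (norm x)\<^sup>2"
    by (intro LIMSEQ_le[of "\<lambda>n. 2 * \<delta> * (\<delta> * inner x (B (f n)))"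
          _ "\<lambda>n. (norm (B x))\<^sup>2 + \<delta>\<^sup>2 * (norm (B (f n)))\<^sup>2"]) (auto intro!: tendsto_intros lim)
  then have "(\<delta> * norm x)\<^sup>2 \<le> (norm (B x))\<^sup>2"
    by (simp add: power_mult_distrib power2_norm_eq_inner power2_eq_square[of \<delta>] algebra_simps)
  then show ?thesis unfolding B_def by (rule power2_le_imp_le) simp
qed

text \<open>Eigenspaces are closed and mutually orthogonal, so only completeness is at stake. On the
  common kernel \<open>K\<close> of the projections \<open>A - \<nu>\<close> is bounded below for
  every real \<nu>, whereas a resolvent that is nonzero on \<open>K\<close> would produce some \<nu>
  where this fails.\<close>

theorem discrete_spectrum_decomposition:
  assumes spec: "op_spectrum D A = range \<mu>" and \<delta>: "\<delta> > 0"
    and sep: "\<And>j k. j \<noteq> k \<Longrightarrow> \<delta> \<le> \<bar>\<mu> j - \<mu> k\<bar>"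
  obtains P where "orthogonal_decomposition P" "\<And>k x. P k x \<in> eigenspace (\<mu> k)"
    "\<And>k x. x \<in> eigenspace (\<mu> k) \<Longrightarrow> P k x = x"
proof -
  have res: "\<nu> \<in> op_resolvent_set D A \<longleftrightarrow> (\<forall>k. \<nu> \<noteq> \<mu> k)" for \<nu>
    using spec by (auto simp: op_spectrum_def)
  have "\<forall>k. \<exists>p. bounded_linear p \<and> (\<forall>x. p x \<in> eigenspace (\<mu> k)) \<and>
      (\<forall>x. x \<in> eigenspace (\<mu> k) \<longrightarrow> p x = x) \<and>
      (\<forall>x s. s \<in> eigenspace (\<mu> k) \<longrightarrow> inner (p x) s = inner x s) \<and>
      (\<forall>x y. inner (p x) y = inner x (p y))"
  proof
    fix k
    obtain p where "bounded_linear p" "\<And>x. p x \<in> eigenspace (\<mu> k)"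
      "\<And>x. x \<in> eigenspace (\<mu> k) \<Longrightarrow> p x = x"
      "\<And>x s. s \<in> eigenspace (\<mu> k) \<Longrightarrow> inner (p x) s = inner x s"
      "\<And>x y. inner (p x) y = inner x (p y)"
      using orthogonal_projection_operator[OF eigenspace_subspace eigenspace_closed, of "\<mu> k"] by metis
    then show "\<exists>p. bounded_linear p \<and> (\<forall>x. p x \<in> eigenspace (\<mu> k)) \<and>
      (\<forall>x. x \<in> eigenspace (\<mu> k) \<longrightarrow> p x = x) \<and>
      (\<forall>x s. s \<in> eigenspace (\<mu> k) \<longrightarrow> inner (p x) s = inner x s) \<and>
      (\<forall>x y. inner (p x) y = inner x (p y))" by blast
  qed
  then obtain P where P: "\<And>k. bounded_linear (P k)" "\<And>k x. P k x \<in> eigenspace (\<mu> k)"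
      "\<And>k x. x \<in> eigenspace (\<mu> k) \<Longrightarrow> P k x = x"
      "\<And>k x s. s \<in> eigenspace (\<mu> k) \<Longrightarrow> inner (P k x) s = inner x s"
      "\<And>k x y. inner (P k x) y = inner x (P k y)"
    by metis
  have inj: "j \<noteq> k \<Longrightarrow> \<mu> j \<noteq> \<mu> k" for j k using sep[of j k] \<delta> by auto
  have orth: "inner (P j x) (P k y) = 0" if "j \<noteq> k" for j k x y
    using eigenspace_orthogonal[OF P(2,2) inj[OF that]] .
  have zero: "P j (P k x) = 0" if "j \<noteq> k" for j k x
    using orth[OF that, of "P k x" x] P(5)[of j "P k x" "P j (P k x)"] P(2,3)
    by (metis P(5) inner_eq_zero_iff orth that)
  define K where "K = {x. \<forall>k. P k x = 0}"
  have KK: "subspace K"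
    unfolding K_def subspace_def using P(1) by (auto simp: linear_simps)
  have orthK: "inner y x = 0" if "x \<in> K" "y \<in> eigenspace (\<mu> k)" for x y k
    using P(4)[OF that(2), of x] that(1) by (simp add: K_def inner_commute)
  \<comment> \<open>Off the spectrum this is the resolvent bound; at \<open>\<mu> k\<close> it is
    \<open>isolated_point_bound\<close>, whose orthogonality condition holds on
    \<open>K\<close>.\<close>
  have below: "\<exists>\<beta>>0. \<forall>x\<in>D. x \<in> K \<longrightarrow> \<beta> * norm x \<le> norm (A x - \<nu> *\<^sub>R x)" for \<nu>
  proof (cases "\<nu> \<in> op_resolvent_set D A")
    case True
    then show ?thesis by (rule resolvent_bounded_below) blast
  next
    case False
    then obtain k where k: "\<nu> = \<mu> k" using res by auto
    have "\<nu>' \<in> op_resolvent_set D A" if "\<nu>' \<noteq> \<nu>" "\<bar>\<nu>' - \<nu>\<bar> < \<delta>" for \<nu>'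
      using that sep k unfolding res by (metis linorder_not_le)
    from isolated_point_bound[OF \<delta> this] show ?thesis
      using \<delta> orthK k by blast
  qed
  have K0: "x = 0" if x: "x \<in> K" for x
  proof -
    \<comment> \<open>A resolvent point: its distance is \<open>\<delta> / 2\<close> from
      \<open>\<mu> 0\<close> and at least that from every other \<open>\<mu> k\<close>.\<close>
    define c where "c = \<mu> 0 + \<delta> / 2"
    have "c \<noteq> \<mu> k" for k using sep[of 0 k] \<delta> by (cases "k = 0") (auto simp: c_def)
    then have "c \<in> op_resolvent_set D A" using res by blast
    then obtain R where R: "bounded_linear R" "\<And>y. R y \<in> D" "\<And>y. A (R y) - c *\<^sub>R R y = y"
      "\<And>x. x \<in> D \<Longrightarrow> R (A x - c *\<^sub>R x) = x" "\<And>x y. inner (R x) y = inner x (R y)"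
      using resolventE by blast
    interpret R: bounded_linear R by fact
    \<comment> \<open>The resolvent acts on each eigenspace as multiplication by
      \<open>1 / (\<mu> k - c)\<close>; by symmetry it therefore preserves \<open>K\<close>.\<close>
    have RK: "R y \<in> K" if y: "y \<in> K" for y
    proof -
      have "P k (R y) = 0" for k
      proof -
        let ?v = "P k (R y)"
        have "A ?v - c *\<^sub>R ?v = (\<mu> k - c) *\<^sub>R ?v"
          using P(2)[of k "R y"] by (simp add: eigenspace_def algebra_simps)
        then have "R ((\<mu> k - c) *\<^sub>R ?v) = ?v"
          using R(4)[of ?v] P(2)[of k "R y"] by (simp add: eigenspace_def)
        then have "(\<mu> k - c) * inner (R y) (R ?v) = inner (R y) ?v"
          by (metis R.scaleR inner_scaleR_right)
        moreover have "inner (R y) ?v = inner ?v ?v" using P(4)[OF P(2)] by simp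
        moreover have "R ?v \<in> eigenspace (\<mu> k)"
        proof -
          have "?v = (\<mu> k - c) *\<^sub>R R ?v"
            using \<open>R ((\<mu> k - c) *\<^sub>R ?v) = ?v\<close> by (simp add: R.scaleR)
          moreover have "\<mu> k - c \<noteq> 0" using \<open>c \<noteq> \<mu> k\<close> by auto
          ultimately have "R ?v = (1 / (\<mu> k - c)) *\<^sub>R ?v"
            by (metis divideR_right inverse_eq_divide)
          then show ?thesis using P(2) eigenspace_subspace by (simp add: subspace_scale)
        qed
        from orthK[OF y this] have "inner ?v (R y) = 0" by (simp add: R(5))
        then have "inner (R y) ?v = 0" by (simp add: inner_commute)
        ultimately have "inner ?v ?v = 0" by simp
        then show ?thesis by simp
      qed
      then show ?thesis by (simp add: K_def)
    qed
    have "\<not> (\<exists>x\<in>K. R x \<noteq> 0)"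
    proof
      assume "\<exists>x\<in>K. R x \<noteq> 0"
      then obtain s where s: "s > 0" "\<And>e. e > 0 \<Longrightarrow> \<exists>x\<in>K. norm x = 1 \<and> norm (R (R x) - s\<^sup>2 *\<^sub>R x) < e"
        using approximate_norm_attainment[OF R(1,5) KK RK] by metis
      then show False
        using not_both_shifts_bounded_below[OF R(1-3) RK KK s] below[of "c + 1 / s"] below[of "c - 1 / s"]
        by blast
    qed
    then show ?thesis using x R(3)[of x] subspace_0[OF D_subspace] A_scaleR[of 0 0] by simp
  qed
  have sums: "(\<lambda>k. P k x) sums x" for x
  proof -
    have "(\<Sum>k<n. (norm (P k x))\<^sup>2) \<le> (norm x)\<^sup>2" for n
    proof -
      have "(norm (\<Sum>k<n. P k x))\<^sup>2 = (\<Sum>k<n. (norm (P k x))\<^sup>2)"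
        using orth by (intro norm_sum_Pythagoras) auto
      moreover have "inner x (\<Sum>k<n. P k x) = (\<Sum>k<n. (norm (P k x))\<^sup>2)"
        using P(4)[OF P(2)] by (simp add: inner_sum_right power2_norm_eq_inner)
      moreover have "0 \<le> (norm (x - (\<Sum>k<n. P k x)))\<^sup>2" by simp
      ultimately show ?thesis by (simp add: norm_diff_sq)
    qed
    then have "summable (\<lambda>k. (norm (P k x))\<^sup>2)"
      by (rule summableI_nonneg_bounded[rotated]) simp
    from orthogonal_series_sums[OF orth this] obtain z where z: "(\<lambda>k. P k x) sums z" .
    have "P j (x - z) = 0" for j
    proof -
      have "(\<lambda>k. P j (P k x)) sums P j z" by (rule bounded_linear.sums[OF P(1) z])
      moreover have "(\<lambda>k. P j (P k x)) = (\<lambda>k. if k = j then P j x else 0)"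
        using zero P(2,3) by auto
      moreover have "(\<lambda>k. if k = j then P j x else 0) sums P j x" by (rule sums_single)
      ultimately have "P j z = P j x" by (simp add: sums_unique2)
      then show ?thesis using P(1) by (simp add: linear_simps)
    qed
    then have "x - z = 0" by (intro K0) (simp add: K_def)
    then show ?thesis using z by simp
  qed
  have "orthogonal_decomposition P"
    unfolding orthogonal_decomposition_def using P(1,5) zero sums P(3)[OF P(2)] by blast
  then show thesis using that P by blast
qed

text \<open>By symmetry the components of \<open>A x\<close> are \<open>\<mu> k\<close> times those
  of \<open>x\<close>, so \<open>D\<close> lies in \<open>mdom \<mu>\<close>. The converse inclusion
  uses the maximality of a self-adjoint operator, in the form \<open>A_adjointI\<close>.\<close>

lemma domain_eq_mdom:
  assumes P: "orthogonal_decomposition P" "\<And>k x. P k x \<in> eigenspace (\<mu> k)"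
  shows "D = orthogonal_decomposition.mdom P \<mu>"
    and "x \<in> D \<Longrightarrow> A x = orthogonal_decomposition.mop P \<mu> x"
proof -
  interpret orthogonal_decomposition P by fact
  have PA: "P k (A x) = \<mu> k *\<^sub>R P k x" if x: "x \<in> D" for k x
  proof -
    have "inner (P k (A x) - \<mu> k *\<^sub>R P k x) y = 0" for y
    proof -
      have "inner (P k (A x)) y = inner (A x) (P k y)" by (rule P_sym)
      also have "\<dots> = inner x (\<mu> k *\<^sub>R P k y)"
        using A_sym[OF x, of "P k y"] P(2)[of k y] by (simp add: eigenspace_def)
      finally show ?thesis by (simp add: inner_diff_left P_sym)
    qed
    from this[of "P k (A x) - \<mu> k *\<^sub>R P k x"] show ?thesis by simp
  qed
  have 1: "x \<in> mdom \<mu> \<and> mop \<mu> x = A x" if x: "x \<in> D" for x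
    using mop_eqI[of "A x" \<mu> x] PA[OF x] by blast
  have 2: "x \<in> D" if x: "x \<in> mdom \<mu>" for x
  proof (rule A_adjointI)
    fix y assume y: "y \<in> D"
    have "(\<lambda>k. \<mu> k * inner (P k x) (P k y)) sums inner (mop \<mu> x) y" by (rule inner_mop[OF x])
    moreover have "(\<lambda>k. \<mu> k * inner (P k x) (P k y)) sums inner x (A y)"
      using inner_sums[of x "A y"] by (simp add: PA[OF y])
    ultimately show "inner (A y) x = inner y (mop \<mu> x)"
      by (metis inner_commute sums_unique2)
  qed
  show "D = mdom \<mu>" using 1 2 by blast
  show "x \<in> D \<Longrightarrow> A x = mop \<mu> x" using 1 by simp
qed

end

section \<open>Spectral measures of operators with discrete spectrum\<close>

context orthogonal_decomposition
begin

context
  fixes E :: "real set \<Rightarrow> 'a \<Rightarrow> 'a" and \<mu> :: "nat \<Rightarrow> real"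
  assumes E: "\<And>B. B \<in> sets borel \<Longrightarrow> E B = mop (\<lambda>k. indicator B (\<mu> k))"
begin

text \<open>The measure consists of atoms of mass \<open>|P k x|^2\<close> at
  \<open>\<mu> k\<close>. Writing it as a push-forward of a weighted counting measure turns
  integrals into series.\<close>

lemma scalar_measure_discrete:
  "scalar_measure E x = distr (density (count_space UNIV) (\<lambda>k. ennreal ((norm (P k x))\<^sup>2))) borel \<mu>"
  (is "_ = ?M")
proof -
  have eq: "ennreal (inner (E B x) x) = emeasure ?M B" if B: "B \<in> sets borel" for B
  proof -
    have dom: "x \<in> mdom (\<lambda>k. indicator B (\<mu> k))"
      by (rule bounded_mop[of _ 1]) (auto simp: indicator_def)
    have s: "(\<lambda>k. indicator B (\<mu> k) * (norm (P k x))\<^sup>2) sums inner (E B x) x"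
      using inner_mop[OF dom, of x] by (simp add: E[OF B] power2_norm_eq_inner)
    have "emeasure ?M B = (\<integral>\<^sup>+ k. ennreal ((norm (P k x))\<^sup>2) * indicator (\<mu> -` B) k \<partial>count_space UNIV)"
      using B by (simp add: emeasure_distr emeasure_density)
    also have "\<dots> = (\<Sum>k. ennreal (indicator B (\<mu> k) * (norm (P k x))\<^sup>2))"
      by (simp add: nn_integral_count_space_nat indicator_def if_distrib cong: if_cong)
         (intro suminf_cong, auto)
    also have "\<dots> = ennreal (inner (E B x) x)"
      using s by (subst suminf_ennreal2) (auto simp: sums_iff)
    finally show ?thesis by simp
  qed
  have "scalar_measure E x = measure_of UNIV (sets borel) (emeasure ?M)"
    unfolding scalar_measure_def
    by (rule measure_of_eq) (use eq sets.sigma_sets_eq[of "borel :: real measure"] in auto)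
  also have "\<dots> = ?M" using measure_of_of_measure[of ?M] by simp
  finally show ?thesis .
qed

lemma integrable_scalar_measure_discrete:
  assumes f: "f \<in> borel_measurable borel"
  shows "integrable (scalar_measure E x) f \<longleftrightarrow> summable (\<lambda>k. \<bar>f (\<mu> k)\<bar> * (norm (P k x))\<^sup>2)"
  unfolding scalar_measure_discrete using f
  by (simp add: integrable_distr_eq integrable_density integrable_count_space_nat_iff abs_mult mult.commute)

lemma integral_scalar_measure_discrete:
  fixes f :: "real \<Rightarrow> real"
  assumes f: "f \<in> borel_measurable borel" and i: "integrable (scalar_measure E x) f"
  shows "(\<lambda>k. f (\<mu> k) * (norm (P k x))\<^sup>2) sums (LINT s|scalar_measure E x. f s)"
proof -
  have "integrable (count_space UNIV) (\<lambda>k. (norm (P k x))\<^sup>2 *\<^sub>R f (\<mu> k))"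
    using i f unfolding scalar_measure_discrete by (simp add: integrable_distr_eq integrable_density)
  from sums_integral_count_space_nat[OF this]
  show ?thesis
    unfolding scalar_measure_discrete using f by (simp add: integral_distr integral_density mult.commute)
qed

lemma spectral_dom_discrete:
  assumes f: "f \<in> borel_measurable borel"
  shows "spectral_dom E f = mdom (\<lambda>k. f (\<mu> k))"
  using f by (simp add: spectral_dom_def mdom_def integrable_scalar_measure_discrete)

lemma spectral_integral_discrete:
  assumes f: "f \<in> borel_measurable borel" and x: "x \<in> mdom (\<lambda>k. f (\<mu> k))"
  shows "spectral_integral E f x = mop (\<lambda>k. f (\<mu> k)) x"
proof -
  let ?h = "\<lambda>k. f (\<mu> k)"
  let ?Q = "\<lambda>w. \<forall>y\<in>spectral_dom E f.
     inner w y = ((LINT s|scalar_measure E (x + y). f s) - (LINT s|scalar_measure E (x - y). f s)) / 4"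
  \<comment> \<open>Polarization needs integrability of \<open>f\<close>, while the domain gives
    that of its square; the total mass is finite and \<open>|f| \<le> 1 + f^2\<close>.\<close>
  have int: "integrable (scalar_measure E z) f" if z: "z \<in> mdom ?h" for z
  proof -
    have "summable (\<lambda>k. (norm (P k z))\<^sup>2 + (?h k)\<^sup>2 * (norm (P k z))\<^sup>2)"
      using z sums_summable[OF norm_sums[of z]] by (intro summable_add) (auto simp: mdom_def)
    moreover have "norm (\<bar>?h k\<bar> * (norm (P k z))\<^sup>2) \<le> (norm (P k z))\<^sup>2 + (?h k)\<^sup>2 * (norm (P k z))\<^sup>2" for k
    proof -
      have "\<bar>?h k\<bar> \<le> 1 + (?h k)\<^sup>2"
        using zero_le_power2[of "\<bar>?h k\<bar> - 1"] zero_le_power2[of "?h k"] by (simp add: power2_diff)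
      from mult_right_mono[OF this, of "(norm (P k z))\<^sup>2"] show ?thesis by (simp add: abs_mult algebra_simps)
    qed
    ultimately show ?thesis
      unfolding integrable_scalar_measure_discrete[OF f] by (rule summable_comparison_test'[where N=0])
  qed
  have Q: "?Q (mop ?h x)"
  proof
    fix y assume "y \<in> spectral_dom E f"
    then have y: "y \<in> mdom ?h" by (simp add: spectral_dom_discrete[OF f])
    have "(\<lambda>k. (?h k * (norm (P k (x + y)))\<^sup>2 - ?h k * (norm (P k (x - y)))\<^sup>2) / 4) sums
       (((LINT s|scalar_measure E (x + y). f s) - (LINT s|scalar_measure E (x - y). f s)) / 4)"
      by (intro sums_divide sums_diff integral_scalar_measure_discrete[OF f] int mop_add mop_diff x y)
    also have "(\<lambda>k. (?h k * (norm (P k (x + y)))\<^sup>2 - ?h k * (norm (P k (x - y)))\<^sup>2) / 4) =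
        (\<lambda>k. ?h k * inner (P k x) (P k y))"
      by (simp add: P_add P_diff norm_add_sq norm_diff_sq algebra_simps)
    finally show "inner (mop ?h x) y = ((LINT s|scalar_measure E (x + y). f s) - (LINT s|scalar_measure E (x - y). f s)) / 4"
      using inner_mop[OF x, of y] sums_unique2 by blast
  qed
  show ?thesis
    unfolding spectral_integral_def
  proof (rule the_equality[where P="?Q", OF Q])
    \<comment> \<open>Uniqueness is tested on the vectors \<open>P k z\<close>, which belong to
      every domain and determine all components.\<close>
    fix w assume w: "?Q w"
    have "inner w (P k z) = inner (mop ?h x) (P k z)" for k z
    proof -
      have "P k z \<in> spectral_dom E f" by (simp add: spectral_dom_discrete[OF f] P_in_mdom)
      with w Q show ?thesis by metis
    qed
    then have "inner (P k (w - mop ?h x)) z = 0" for k z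
      by (simp add: P_diff inner_diff_left P_sym)
    then have "P k (w - mop ?h x) = 0" for k by (metis inner_eq_zero_iff)
    then have "P k w = P k (mop ?h x)" for k unfolding P_diff by (simp only: right_minus_eq)
    then show "w = mop ?h x" by (rule decomposition_eqI)
  qed
qed

end

text \<open>Countable additivity is the point: partial unions act on each component by an indicator,
  and their convergence is dominated convergence for the series of components.\<close>

lemma projection_valued_measure_discrete:
  "projection_valued_measure (\<lambda>B. mop (\<lambda>k. indicator B (\<mu> k)))"
  unfolding projection_valued_measure_def
proof (intro conjI ballI allI impI)
  let ?E = "\<lambda>B. mop (\<lambda>k. indicator B (\<mu> k :: real))"
  have dom: "x \<in> mdom (\<lambda>k. indicator B (\<mu> k))" for B x
    by (rule bounded_mop[of _ 1]) (auto simp: indicator_def)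
  show "bounded_linear (?E B)" for B by (rule bounded_mop[of _ 1]) (auto simp: indicator_def)
  show "?E B (?E B x) = ?E B x" for B x
    by (rule decomposition_eqI) (simp add: P_mop[OF dom], simp add: indicator_def)
  show "inner (?E B x) y = inner x (?E B y)" for B x y
    using sums_unique2[OF inner_mop[OF dom, of B x y]] inner_mop[OF dom, of B y x]
    by (simp add: inner_commute)
  show "?E UNIV = (\<lambda>x. x)"
    by (rule ext, rule mop_eqI) simp
  fix B :: "nat \<Rightarrow> real set" and x
  assume disj: "disjoint_family B"
  let ?U = "\<Union>n. B n"
  have part: "(\<Sum>n<m. ?E (B n) x) = ?E (\<Union>n<m. B n) x" for m
  proof (rule decomposition_eqI)
    fix k
    have "P k (\<Sum>n<m. ?E (B n) x) = (\<Sum>n<m. P k (?E (B n) x))"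
      using bounded_linear.linear[OF P_bl] by (rule linear_sum)
    also have "\<dots> = (\<Sum>n<m. indicator (B n) (\<mu> k) :: real) *\<^sub>R P k x"
      by (simp add: P_mop[OF dom] scaleR_sum_left)
    also have "(\<Sum>n<m. indicator (B n) (\<mu> k) :: real) = indicator (\<Union>n<m. B n) (\<mu> k)"
      using disj by (subst indicator_UN_disjoint) (auto simp: disjoint_family_on_def)
    finally show "P k (\<Sum>n<m. ?E (B n) x) = P k (?E (\<Union>n<m. B n) x)" by (simp add: P_mop[OF dom])
  qed
  have "(\<lambda>m. ?E (\<Union>n<m. B n) x) \<longlonglongrightarrow> ?E ?U x"
  proof (rule LIMSEQ_I)
    fix r :: real assume r: "r > 0"
    obtain K where K: "\<And>n. norm (\<Sum>k=K..<n. (norm (P k x))\<^sup>2) < r\<^sup>2 / 2"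
      using sums_summable[OF norm_sums[of x]] r unfolding summable_Cauchy
      by (meson half_gt_zero order_refl zero_less_power)
    \<comment> \<open>Membership of each of the first \<open>K\<close> eigenvalues is decided after
      finitely many sets. From the sum \<open>M\<close> of these indices on, the first
      \<open>K\<close> components agree exactly and only the small tail differs.\<close>
    have "\<exists>m. \<mu> k \<in> ?U \<longrightarrow> \<mu> k \<in> (\<Union>n<m. B n)" for k by (auto intro: lessI)
    then obtain g where g: "\<And>k. \<mu> k \<in> ?U \<Longrightarrow> \<mu> k \<in> (\<Union>n<g k. B n)" by metis
    define M where "M = (\<Sum>k<K. g k)"
    have "norm (?E (\<Union>n<m. B n) x - ?E ?U x) < r" if m: "m \<ge> M" for m
    proof -
      let ?d = "?E (\<Union>n<m. B n) x - ?E ?U x"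
      have small: "P k ?d = 0" if "k < K" for k
      proof -
        have "g k \<le> m" using m that by (auto simp: M_def intro: order_trans[OF member_le_sum[of k "{..<K}" g]])
        then have "(\<Union>n<g k. B n) \<subseteq> (\<Union>n<m. B n)" by (intro UN_mono) auto
        then have "\<mu> k \<in> (\<Union>n<m. B n) \<longleftrightarrow> \<mu> k \<in> ?U" using g[of k] by blast
        then have "indicator (\<Union>n<m. B n) (\<mu> k) = (indicator ?U (\<mu> k) :: real)"
          by (simp only: indicator_def)
        then show ?thesis by (simp add: P_diff P_mop[OF dom])
      qed
      have all: "norm (P k ?d) \<le> norm (P k x)" for k
        unfolding P_diff P_mop[OF dom] by (auto simp: indicator_def)
      have "(\<Sum>k<n. (norm (P k ?d))\<^sup>2) \<le> r\<^sup>2 / 2" for n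
      proof -
        have "(\<Sum>k<n. (norm (P k ?d))\<^sup>2) = (\<Sum>k\<in>{..<n} \<inter> {K..}. (norm (P k ?d))\<^sup>2)"
          using small by (intro sum.mono_neutral_right) (auto simp: not_le)
        also have "\<dots> \<le> (\<Sum>k\<in>{..<n} \<inter> {K..}. (norm (P k x))\<^sup>2)"
          by (intro sum_mono power_mono all) auto
        also have "{..<n} \<inter> {K..} = {K..<n}" by auto
        also have "(\<Sum>k=K..<n. (norm (P k x))\<^sup>2) \<le> r\<^sup>2 / 2" using K[of n] by simp
        finally show ?thesis .
      qed
      then have "(norm ?d)\<^sup>2 \<le> r\<^sup>2 / 2"
        using norm_sums[of ?d] by (intro LIMSEQ_le_const2[where X="\<lambda>n. \<Sum>k<n. (norm (P k ?d))\<^sup>2"]) (auto simp: sums_def)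
      also have "\<dots> < r\<^sup>2" using r by simp
      finally show ?thesis by (rule power_less_imp_less_base) (use r in simp)
    qed
    then show "\<exists>no. \<forall>n\<ge>no. norm (?E (\<Union>i<n. B i) x - ?E ?U x) < r" by blast
  qed
  then show "(\<lambda>n. ?E (B n) x) sums ?E ?U x" by (simp add: sums_def part)
qed

end

section \<open>Projection-valued measures in general\<close>

locale pvm =
  fixes E :: "real set \<Rightarrow> 'a::{real_inner,complete_space} \<Rightarrow> 'a"
  assumes pvm: "projection_valued_measure E"
begin

lemma E_bl: "B \<in> sets borel \<Longrightarrow> bounded_linear (E B)"
  and E_idem: "B \<in> sets borel \<Longrightarrow> E B (E B x) = E B x"
  and E_sym: "B \<in> sets borel \<Longrightarrow> inner (E B x) y = inner x (E B y)"
  and E_UNIV: "E UNIV x = x"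
  and E_sums: "range F \<subseteq> sets borel \<Longrightarrow> disjoint_family F \<Longrightarrow> (\<lambda>n. E (F n) x) sums E (\<Union>n. F n) x"
  using pvm by (auto simp: projection_valued_measure_def)

lemma E_empty: "E {} x = 0"
proof -
  have "(\<lambda>n::nat. E {} x) sums E {} x"
    using E_sums[of "\<lambda>_. {}" x] by (simp add: disjoint_family_on_def)
  then have "(\<lambda>n::nat. E {} x) \<longlonglongrightarrow> 0" using summable_LIMSEQ_zero sums_summable by blast
  then show ?thesis by (simp add: LIMSEQ_const_iff)
qed

lemma E_Un:
  assumes "B \<in> sets borel" "C \<in> sets borel" "B \<inter> C = {}"
  shows "E (B \<union> C) x = E B x + E C x"
proof -
  have "(\<lambda>n. E (binaryset B C n) x) sums E (\<Union>n. binaryset B C n) x"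
    using assms by (intro E_sums) (auto simp: range_binaryset_eq disjoint_family_on_def binaryset_def)
  moreover have "(\<lambda>n. E (binaryset B C n) x) sums (\<Sum>n\<in>{0,1}. E (binaryset B C n) x)"
    by (rule sums_finite) (auto simp: binaryset_def E_empty)
  moreover have "(\<Sum>n\<in>{0,1}. E (binaryset B C n) x) = E B x + E C x" by (simp add: binaryset_def)
  ultimately show ?thesis using sums_unique2 by (metis (no_types, lifting) UN_binaryset_eq)
qed

lemma E_Un3:
  assumes "B \<in> sets borel" "C \<in> sets borel" "F \<in> sets borel" "B \<inter> C = {}" "B \<inter> F = {}" "C \<inter> F = {}"
  shows "E (B \<union> (C \<union> F)) x = E B x + (E C x + E F x)"
  using assms E_Un[of B "C \<union> F" x] E_Un[of C F x] by (simp add: Int_Un_distrib)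

text \<open>Expanding the idempotence of \<open>E (B \<union> C)\<close> on \<open>z = E C x\<close>
  gives \<open>E C (E B z) + E B z = 0\<close>; paired with \<open>z\<close>, both terms equal
  \<open>|E B z|^2\<close>.\<close>

lemma E_disjoint:
  assumes B: "B \<in> sets borel" and C: "C \<in> sets borel" and disj: "B \<inter> C = {}"
  shows "E B (E C x) = 0"
proof -
  interpret EB: bounded_linear "E B" by (rule E_bl[OF B])
  interpret EC: bounded_linear "E C" by (rule E_bl[OF C])
  define z where "z = E C x"
  have z: "E C z = z" by (simp add: z_def E_idem C)
  have "E (B \<union> C) (E (B \<union> C) z) = E (B \<union> C) z" using B C by (simp add: E_idem)
  then have "E C (E B z) + E B z = 0"
    by (simp add: E_Un[OF B C disj] EB.add EC.add E_idem[OF B] E_idem[OF C] z add.commute)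
  then have "inner (E C (E B z)) z + inner (E B z) z = 0"
    by (metis inner_add_left inner_zero_left)
  then have "inner (E B z) z = 0" by (simp add: E_sym[OF C] z)
  then have "inner (E B z) (E B z) = 0" by (metis E_idem E_sym B)
  then show ?thesis by (simp add: z_def)
qed

lemma E_Int:
  assumes B: "B \<in> sets borel" and C: "C \<in> sets borel"
  shows "E B (E C x) = E (B \<inter> C) x"
proof -
  interpret EB: bounded_linear "E B" by (rule E_bl[OF B])
  have "C = (B \<inter> C) \<union> (C - B)" by auto
  then have "E C x = E (B \<inter> C) x + E (C - B) x" using E_Un[of "B \<inter> C" "C - B" x] B C by auto
  then have "E B (E C x) = E B (E (B \<inter> C) x)"
    using B C by (simp add: EB.add E_disjoint)
  moreover have "E ((B \<inter> C) \<union> (B - C)) y = E (B \<inter> C) y + E (B - C) y" for y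
    using B C by (intro E_Un) auto
  then have "E B y = E (B \<inter> C) y + E (B - C) y" for y by (metis Int_Diff_Un)
  moreover have "(B - C) \<inter> (B \<inter> C) = {}" by blast
  then have "E (B - C) (E (B \<inter> C) x) = 0" using B C by (intro E_disjoint) auto
  ultimately show ?thesis using B C by (simp add: E_idem)
qed

lemma inner_E: "B \<in> sets borel \<Longrightarrow> inner (E B x) x = (norm (E B x))\<^sup>2"
  by (metis E_idem E_sym power2_norm_eq_inner)

abbreviation "\<nu> \<equiv> scalar_measure E"

lemma sets_nu [measurable_cong, simp]: "sets (\<nu> x) = sets borel"
  and space_nu [simp]: "space (\<nu> x) = UNIV"
  using sets.sigma_sets_eq[of "borel :: real measure"] by (auto simp: scalar_measure_def sets_measure_of)

lemma emeasure_nu: "B \<in> sets borel \<Longrightarrow> emeasure (\<nu> x) B = ennreal ((norm (E B x))\<^sup>2)"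
proof -
  assume B: "B \<in> sets borel"
  have "emeasure (\<nu> x) B = ennreal (inner (E B x) x)"
  proof (rule emeasure_measure_of[of "\<nu> x" UNIV "sets borel" "\<lambda>B. ennreal (inner (E B x) x)"])
    show "countably_additive (sets (\<nu> x)) (\<lambda>B. ennreal (inner (E B x) x))"
    proof (rule countably_additiveI)
      fix F :: "nat \<Rightarrow> real set"
      assume F: "range F \<subseteq> sets (\<nu> x)" "disjoint_family F"
      have "(\<lambda>n. inner (E (F n) x) x) sums inner (E (\<Union>n. F n) x) x"
        using F by (intro bounded_linear.sums[OF bounded_linear_inner_left] E_sums) auto
      moreover have "0 \<le> inner (E (F n) x) x" for n using F by (auto simp: inner_E)
      ultimately show "(\<Sum>n. ennreal (inner (E (F n) x) x)) = ennreal (inner (E (\<Union>n. F n) x) x)"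
        by (subst suminf_ennreal2) (auto simp: sums_iff)
    qed
    show "positive (sets (\<nu> x)) (\<lambda>B. ennreal (inner (E B x) x))" by (simp add: positive_def E_empty)
  qed (use B in \<open>auto simp: scalar_measure_def\<close>)
  then show ?thesis using B by (simp add: inner_E)
qed

lemma finite_nu: "finite_measure (\<nu> x)"
  by (rule finite_measureI) (simp add: emeasure_nu)

text \<open>Polarization with \<open>E B x\<close> involves vectors of this form, and
  \<open>E\<close> splits them along \<open>B\<close>; all integrals are thereby reduced to the
  single measure of \<open>x\<close>.\<close>

lemma nu_density:
  assumes B: "B \<in> sets borel"
  shows "\<nu> (a *\<^sub>R x + b *\<^sub>R E B x) = density (\<nu> x) (\<lambda>s. ennreal ((a + b * indicator B s)\<^sup>2))" (is "\<nu> ?z = _")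
proof (rule measure_eqI)
  fix C assume "C \<in> sets (\<nu> ?z)"
  then have C: "C \<in> sets borel" by simp
  interpret EC: bounded_linear "E C" by (rule E_bl[OF C])
  have EC: "E C x = E (B \<inter> C) x + E (C - B) x"
    using E_Un[of "B \<inter> C" "C - B" x] B C by (metis Int_Diff_Un Int_Diff_disjoint Int_commute sets.Diff sets.Int)
  have orth: "inner (E (B \<inter> C) x) (E (C - B) x) = 0"
  proof -
    have "(B \<inter> C) \<inter> (C - B) = {}" by blast
    from E_disjoint[OF _ _ this] show ?thesis using E_sym[of "B \<inter> C" x "E (C - B) x"] B C by simp
  qed
  have Ez: "E C ?z = (a + b) *\<^sub>R E (B \<inter> C) x + a *\<^sub>R E (C - B) x"
    using B C by (simp add: EC.add EC.scaleR E_Int EC Int_commute algebra_simps)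
  have "emeasure (\<nu> ?z) C = ennreal ((a + b)\<^sup>2 * (norm (E (B \<inter> C) x))\<^sup>2 + a\<^sup>2 * (norm (E (C - B) x))\<^sup>2)"
    using C orth by (simp add: emeasure_nu Ez norm_add_sq power_mult_distrib)
  also have "\<dots> = ennreal ((a + b)\<^sup>2) * emeasure (\<nu> x) (B \<inter> C) + ennreal (a\<^sup>2) * emeasure (\<nu> x) (C - B)"
    using B C by (simp add: emeasure_nu ennreal_mult' ennreal_plus)
  also have "\<dots> = (\<integral>\<^sup>+ s. ennreal ((a + b)\<^sup>2) * indicator (B \<inter> C) s + ennreal (a\<^sup>2) * indicator (C - B) s \<partial>\<nu> x)"
    using B C by (subst nn_integral_add) (auto simp: nn_integral_cmult_indicator)
  also have "\<dots> = (\<integral>\<^sup>+ s. ennreal ((a + b * indicator B s)\<^sup>2) * indicator C s \<partial>\<nu> x)"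
    by (intro nn_integral_cong) (auto simp: indicator_def)
  also have "\<dots> = emeasure (density (\<nu> x) (\<lambda>s. ennreal ((a + b * indicator B s)\<^sup>2))) C"
    using B C by (subst emeasure_density) auto
  finally show "emeasure (\<nu> ?z) C = emeasure (density (\<nu> x) (\<lambda>s. ennreal ((a + b * indicator B s)\<^sup>2))) C" .
qed simp

lemma nu_scaleR: "\<nu> (c *\<^sub>R x) = density (\<nu> x) (\<lambda>_. ennreal (c\<^sup>2))"
  using nu_density[of "{}" c x 0] by simp

lemma null_of_emeasure: "B \<in> sets borel \<Longrightarrow> emeasure (\<nu> x) B = 0 \<Longrightarrow> E B x = 0"
  by (simp add: emeasure_nu)

lemma spectral_dom_scaleR: "x \<in> spectral_dom E f \<Longrightarrow> f \<in> borel_measurable borel \<Longrightarrow> c *\<^sub>R x \<in> spectral_dom E f"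
  by (simp add: spectral_dom_def nu_scaleR integrable_density)

text \<open>
  The value of \<open>spectral_integral\<close> is junk when no vector represents the functional. That
  junk value does not depend on \<open>x\<close>, hence homogeneity forces it to be zero.
\<close>

lemma spectral_integral_represents:
  assumes f: "f \<in> borel_measurable borel"
    and dense: "\<And>z. (\<And>y. y \<in> spectral_dom E f \<Longrightarrow> inner z y = 0) \<Longrightarrow> z = 0"
    and hom: "spectral_integral E f (2 *\<^sub>R x) = 2 *\<^sub>R spectral_integral E f x"
    and nz: "spectral_integral E f x \<noteq> 0" and y: "y \<in> spectral_dom E f"
  shows "inner (spectral_integral E f x) y =
    ((LINT s|\<nu> (x + y). f s) - (LINT s|\<nu> (x - y). f s)) / 4"
proof -
  define Q where "Q = (\<lambda>x w. \<forall>y\<in>spectral_dom E f.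
     inner w y = ((LINT s|\<nu> (x + y). f s) - (LINT s|\<nu> (x - y). f s)) / 4)"
  have si: "spectral_integral E f x = (THE w. Q x w)" for x
    by (simp add: spectral_integral_def Q_def)
  have uniq: "w = w'" if "Q x w" "Q x w'" for x w w'
  proof -
    have "inner (w - w') y = 0" if "y \<in> spectral_dom E f" for y
      using bspec[OF \<open>Q x w\<close>[unfolded Q_def] that] bspec[OF \<open>Q x w'\<close>[unfolded Q_def] that]
      by (simp add: inner_diff_left)
    then show ?thesis using dense[of "w - w'"] by simp
  qed
  have half: "Q x ((1/2) *\<^sub>R w)" if "Q (2 *\<^sub>R x) w" for w
    unfolding Q_def
  proof
    fix y assume y: "y \<in> spectral_dom E f"
    have four: "(LINT s|\<nu> (2 *\<^sub>R z). f s) = 4 * (LINT s|\<nu> z. f s)" for z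
      unfolding nu_scaleR using f by (subst integral_density) auto
    have "inner w (2 *\<^sub>R y) = ((LINT s|\<nu> (2 *\<^sub>R x + 2 *\<^sub>R y). f s) - (LINT s|\<nu> (2 *\<^sub>R x - 2 *\<^sub>R y). f s)) / 4"
      using bspec[OF that[unfolded Q_def] spectral_dom_scaleR[OF y f, of 2]] .
    then show "inner ((1/2) *\<^sub>R w) y = ((LINT s|\<nu> (x + y). f s) - (LINT s|\<nu> (x - y). f s)) / 4"
      by (simp add: scaleR_add_right[symmetric] scaleR_diff_right[symmetric] four)
  qed
  have "\<exists>w. Q x w"
  proof (rule ccontr)
    assume no: "\<nexists>w. Q x w"
    then have "Q (2 *\<^sub>R x) = Q x" using half by blast
    then have "spectral_integral E f (2 *\<^sub>R x) = spectral_integral E f x" by (simp add: si)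
    then show False using hom nz by (simp add: scaleR_2)
  qed
  then have "Q x (spectral_integral E f x)" unfolding si using uniq by (metis the_equality)
  then show ?thesis using y by (simp add: Q_def)
qed

end

section \<open>Recovering the spectral measure from the operator\<close>

locale spectral_resolution = self_adjoint D A + pvm E
  for D :: "'a::{real_inner,complete_space} set" and A :: "'a \<Rightarrow> 'a" and E :: "real set \<Rightarrow> 'a \<Rightarrow> 'a" +
  assumes res: "is_spectral_measure_of D A E"
begin

lemma D_eq: "D = spectral_dom E (\<lambda>s. s)"
  and A_eq: "x \<in> D \<Longrightarrow> A x = spectral_integral E (\<lambda>s. s) x"
  using res by (auto simp: is_spectral_measure_of_def)

lemma integrable_nu: "x \<in> D \<Longrightarrow> integrable (\<nu> x) (\<lambda>s. s)"
proof -
  assume "x \<in> D"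
  then have i: "integrable (\<nu> x) (\<lambda>s. s\<^sup>2)" by (simp add: D_eq spectral_dom_def)
  interpret finite_measure "\<nu> x" by (rule finite_nu)
  have "integrable (\<nu> x) (\<lambda>s. 1 + s\<^sup>2)" using i by simp
  then show ?thesis
  proof (rule Bochner_Integration.integrable_bound)
    have "\<bar>s\<bar> \<le> 1 + s\<^sup>2" for s :: real
      using zero_le_power2[of "\<bar>s\<bar> - 1"] zero_le_power2[of s] by (simp add: power2_diff)
    then show "AE s in \<nu> x. norm s \<le> norm (1 + s\<^sup>2)" by (auto intro: order_trans)
  qed simp
qed

text \<open>Polarization with \<open>y = E B x\<close>, where the densities give
  \<open>(1 + 1_B)^2 - (1 - 1_B)^2 = 4 1_B\<close>. The condition \<open>A x \<noteq> 0\<close>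
  excludes that \<open>A x\<close> is merely the default value of
  \<open>spectral_integral\<close>.\<close>

lemma inner_A_E:
  assumes x: "x \<in> D" "A x \<noteq> 0" and B: "B \<in> sets borel"
  shows "inner (A x) (E B x) = (LINT s|\<nu> x. indicator B s * s)"
    and "integrable (\<nu> x) (\<lambda>s. indicator B s * s)"
proof -
  have i2: "integrable (\<nu> x) (\<lambda>s. s\<^sup>2)" using x by (simp add: D_eq spectral_dom_def)
  have "integrable (\<nu> x) (\<lambda>s. indicator B s *\<^sub>R s\<^sup>2)"
    using B by (intro integrable_mult_indicator i2) simp
  moreover have "(\<lambda>s. (indicator B s)\<^sup>2 * s\<^sup>2) = (\<lambda>s. indicator B s *\<^sub>R (s::real)\<^sup>2)"
    by (auto simp: indicator_def)
  ultimately have "integrable (\<nu> (0 *\<^sub>R x + 1 *\<^sub>R E B x)) (\<lambda>s. s\<^sup>2)"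
    unfolding nu_density[OF B] using B by (subst integrable_density) auto
  then have EB: "E B x \<in> spectral_dom E (\<lambda>s. s)" by (simp add: spectral_dom_def)
  note i1 = integrable_nu[OF x(1)]
  show ii: "integrable (\<nu> x) (\<lambda>s. indicator B s * s)"
    using integrable_mult_indicator[of B "\<nu> x" "\<lambda>s. s"] i1 B by simp
  have Ip: "(LINT s|\<nu> (x + E B x). s) = (LINT s|\<nu> x. s + 3 * (indicator B s * s))"
  proof -
    have "(LINT s|\<nu> (1 *\<^sub>R x + 1 *\<^sub>R E B x). s) = (LINT s|\<nu> x. (1 + 1 * indicator B s)\<^sup>2 *\<^sub>R s)"
      unfolding nu_density[OF B] using B by (subst integral_density) auto
    also have "(\<lambda>s. (1 + 1 * indicator B s)\<^sup>2 *\<^sub>R s) = (\<lambda>s::real. s + 3 * (indicator B s * s))"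
      by (auto simp: indicator_def)
    finally show ?thesis by simp
  qed
  have Im: "(LINT s|\<nu> (x - E B x). s) = (LINT s|\<nu> x. s - indicator B s * s)"
  proof -
    have "(LINT s|\<nu> (1 *\<^sub>R x + (-1) *\<^sub>R E B x). s) = (LINT s|\<nu> x. (1 + (-1) * indicator B s)\<^sup>2 *\<^sub>R s)"
      unfolding nu_density[OF B] using B by (subst integral_density) auto
    also have "(\<lambda>s. (1 + (-1) * indicator B s)\<^sup>2 *\<^sub>R s) = (\<lambda>s::real. s - indicator B s * s)"
      by (auto simp: indicator_def)
    finally show ?thesis by simp
  qed
  have "2 *\<^sub>R x \<in> D" using x(1) D_subspace by (simp add: subspace_scale)
  then have "inner (A x) (E B x) = ((LINT s|\<nu> (x + E B x). s) - (LINT s|\<nu> (x - E B x). s)) / 4"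
    using spectral_integral_represents[of "\<lambda>s. s" x "E B x"] x EB A_scaleR[OF x(1), of 2] D_orthogonal
    by (simp add: A_eq D_eq[symmetric])
  also have "\<dots> = (LINT s|\<nu> x. indicator B s * s)"
    using i1 ii by (simp add: Ip Im)
  finally show "inner (A x) (E B x) = (LINT s|\<nu> x. indicator B s * s)" .
qed

text \<open>The equation says that \<open>s - \<mu>\<close> has integral 0 over \<open>B\<close>. It
  has one sign there and no zero, so \<open>B\<close> is a null set for the measure of
  \<open>x\<close>.\<close>

lemma E_zeroI:
  assumes x: "x \<in> D" "A x \<noteq> 0" and B: "B \<in> sets borel"
    and eq: "inner (A x) (E B x) = \<mu> * (norm (E B x))\<^sup>2"
    and side: "B \<subseteq> {\<mu><..} \<or> B \<subseteq> {..<\<mu>}"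
  shows "E B x = 0"
proof -
  interpret finite_measure "\<nu> x" by (rule finite_nu)
  define \<sigma> :: real where "\<sigma> = (if B \<subseteq> {\<mu><..} then 1 else - 1)"
  note I = inner_A_E[OF x B]
  have iB: "integrable (\<nu> x) (indicator B :: real \<Rightarrow> real)"
    using B by (intro integrable_real_indicator) (auto simp: emeasure_nu)
  have mB: "(LINT s|\<nu> x. indicator B s) = (norm (E B x))\<^sup>2"
    using B by (simp add: measure_def emeasure_nu)
  let ?f = "\<lambda>s. \<sigma> * (indicator B s * s - \<mu> * indicator B s)"
  have "(LINT s|\<nu> x. ?f s) = \<sigma> * ((LINT s|\<nu> x. indicator B s * s) - (LINT s|\<nu> x. \<mu> * indicator B s))"
    using I(2) iB by (subst Bochner_Integration.integral_mult_right_zero, subst Bochner_Integration.integral_diff) auto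
  also have "\<dots> = 0" using I(1) eq mB by (subst Bochner_Integration.integral_mult_right_zero) simp
  finally have "(LINT s|\<nu> x. ?f s) = 0" .
  moreover have "integrable (\<nu> x) ?f" using I(2) iB by (intro Bochner_Integration.integrable_mult_right Bochner_Integration.integrable_diff) auto
  moreover have "AE s in \<nu> x. 0 \<le> ?f s"
    using side by (auto simp: \<sigma>_def indicator_def subset_iff less_imp_le intro!: AE_I2)
  ultimately have "AE s in \<nu> x. ?f s = 0" using integral_nonneg_eq_0_iff_AE by blast
  then have "AE s in \<nu> x. s \<notin> B"
    by (rule AE_mp) (use side in \<open>auto simp: \<sigma>_def indicator_def subset_iff intro!: AE_I2\<close>)
  then have "emeasure (\<nu> x) {s \<in> space (\<nu> x). \<not> s \<notin> B} = 0"
    using B by (subst AE_iff_measurable[symmetric, OF _ refl]) auto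
  then show ?thesis using B by (intro null_of_emeasure) auto
qed

text \<open>For nonzero \<open>y\<close> also \<open>A y\<close> is nonzero, so
  \<open>E_zeroI\<close> makes both open half-lines beside \<mu> null and only the atom
  remains.\<close>

lemma E_singleton_nonzero:
  assumes y: "y \<in> eigenspace \<mu>" and \<mu>: "\<mu> \<noteq> 0"
  shows "E {\<mu>} y = y"
proof (cases "y = 0")
  case True
  then show ?thesis using bounded_linear.linear[OF E_bl, of "{\<mu>}"] by (simp add: linear_0)
next
  case False
  have yD: "y \<in> D" "A y = \<mu> *\<^sub>R y" using y by (auto simp: eigenspace_def)
  have z: "E B y = 0" if "B \<in> sets borel" "B \<subseteq> {\<mu><..} \<or> B \<subseteq> {..<\<mu>}" for B
    using that yD False \<mu> inner_E[of B y] by (intro E_zeroI[where \<mu> = \<mu>]) (auto simp: inner_commute)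
  have "y = E ({..<\<mu>} \<union> ({\<mu>} \<union> {\<mu><..})) y"
    by (subst E_UNIV[of y, symmetric], rule arg_cong[where f="\<lambda>B. E B y"]) auto
  also have "\<dots> = E {..<\<mu>} y + (E {\<mu>} y + E {\<mu><..} y)"
    by (rule E_Un3) auto
  finally show ?thesis using z[of "{..<\<mu>}"] z[of "{\<mu><..}"] by simp
qed

text \<open>For a kernel vector, \<open>A y = 0\<close> may be a default value and says nothing
  about \<open>E\<close>. Adding an eigenvector \<open>e\<close> makes \<open>A (y + e)\<close>
  nonzero and shows that \<open>y\<close> lives on \<open>{0, \<kappa>}\<close>; a second eigenvalue
  reduces this to \<open>{0}\<close>.\<close>

lemma E_singleton_zero:
  assumes y: "y \<in> eigenspace 0"
    and e: "e \<in> eigenspace \<kappa>" "e \<noteq> 0" "\<kappa> \<noteq> 0" and e': "e' \<in> eigenspace \<kappa>'" "e' \<noteq> 0" "\<kappa>' \<noteq> 0" "\<kappa> \<noteq> \<kappa>'"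
  shows "E {0} y = y"
proof -
  have two: "E {0, \<kappa>} y = y" if e: "e \<in> eigenspace \<kappa>" "e \<noteq> 0" "\<kappa> \<noteq> 0" for e \<kappa>
  proof -
    have z: "E B y = 0" if B: "B \<in> sets borel" "\<kappa> \<notin> B" "B \<subseteq> {0<..} \<or> B \<subseteq> {..<0}" for B
    proof -
      interpret EB: bounded_linear "E B" by (rule E_bl[OF B(1)])
      have "E B e = E B (E {\<kappa>} e)" by (simp add: E_singleton_nonzero[OF e(1,3)])
      also have "\<dots> = 0" using B by (intro E_disjoint) auto
      finally have EBe: "E B e = 0" .
      have yD: "y \<in> D" "A y = 0" and eD: "e \<in> D" "A e = \<kappa> *\<^sub>R e"
        using y e by (auto simp: eigenspace_def)
      have AY: "A (y + e) = \<kappa> *\<^sub>R e" using yD eD by (simp add: A_add)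
      have "E B (y + e) = 0"
      proof (rule E_zeroI[OF _ _ B(1) _ B(3)])
        show "y + e \<in> D" using yD eD D_subspace by (simp add: subspace_add)
        show "A (y + e) \<noteq> 0" using AY e by simp
        have "inner (A (y + e)) (E B (y + e)) = \<kappa> * inner (E B e) y"
          using E_sym[OF B(1), of e y] by (simp add: AY EB.add EBe)
        then show "inner (A (y + e)) (E B (y + e)) = 0 * (norm (E B (y + e)))\<^sup>2" by (simp add: EBe)
      qed
      then show ?thesis by (simp add: EB.add EBe)
    qed
    have "y = E (({..<0} - {\<kappa>}) \<union> ({0, \<kappa>} \<union> ({0<..} - {\<kappa>}))) y"
      by (subst E_UNIV[of y, symmetric], rule arg_cong[where f="\<lambda>B. E B y"]) auto
    also have "\<dots> = E ({..<0} - {\<kappa>}) y + (E {0, \<kappa>} y + E ({0<..} - {\<kappa>}) y)"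
      by (rule E_Un3) auto
    finally show ?thesis using z[of "{..<0} - {\<kappa>}"] z[of "{0<..} - {\<kappa>}"] by auto
  qed
  have "y = E {0, \<kappa>} (E {0, \<kappa>'} y)" using two[OF e] two[OF e'(1-3)] by simp
  also have "\<dots> = E ({0, \<kappa>} \<inter> {0, \<kappa>'}) y" by (rule E_Int) auto
  also have "{0, \<kappa>} \<inter> {0, \<kappa>'} = {0}" using e'(4) e'(3) e(3) by auto
  finally show ?thesis by simp
qed

end

context self_adjoint
begin

text \<open>The discrete measure is one admissible choice, so \<open>SOME\<close> does return a
  spectral measure. Any such measure fixes \<open>P k x\<close> at the atom \<open>\<mu> k\<close>,
  which determines it on Borel sets.\<close>

theorem spectral_measure_of_discrete:
  assumes P: "orthogonal_decomposition P" "\<And>k x. P k x \<in> eigenspace (\<mu> k)"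
    and e: "e \<in> eigenspace \<kappa>" "e \<noteq> 0" "\<kappa> \<noteq> 0" and e': "e' \<in> eigenspace \<kappa>'" "e' \<noteq> 0" "\<kappa>' \<noteq> 0" "\<kappa> \<noteq> \<kappa>'"
    and B: "B \<in> sets borel"
  shows "spectral_measure_of D A B = orthogonal_decomposition.mop P (\<lambda>k. indicator B (\<mu> k))"
proof -
  interpret orthogonal_decomposition P by fact
  let ?F = "\<lambda>B. mop (\<lambda>k. indicator B (\<mu> k))"
  have "is_spectral_measure_of D A ?F"
    unfolding is_spectral_measure_of_def
  proof (intro conjI ballI)
    show "projection_valued_measure ?F" by (rule projection_valued_measure_discrete)
    show "D = spectral_dom ?F (\<lambda>s. s)"
      using domain_eq_mdom(1)[OF P] by (subst spectral_dom_discrete) auto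
    show "A x = spectral_integral ?F (\<lambda>s. s) x" if "x \<in> D" for x
      using domain_eq_mdom[OF P] that by (subst spectral_integral_discrete) auto
  qed
  then have sm: "is_spectral_measure_of D A (spectral_measure_of D A)"
    unfolding spectral_measure_of_def by (rule someI[where P="is_spectral_measure_of D A"])
  interpret spectral_resolution D A "spectral_measure_of D A"
    by unfold_locales (use sm in \<open>auto simp: is_spectral_measure_of_def\<close>)
  let ?E = "spectral_measure_of D A"
  have sing: "?E {\<mu> k} (P k x) = P k x" for k x
    using P(2)[of k x] E_singleton_nonzero E_singleton_zero[OF _ e e'] by (cases "\<mu> k = 0") auto
  interpret EB: bounded_linear "?E B" by (rule E_bl[OF B])
  have "?E B x = ?F B x" for x
  proof -
    have "?E B (P k x) = indicator B (\<mu> k) *\<^sub>R P k x" for k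
    proof -
      have "?E B (P k x) = ?E (B \<inter> {\<mu> k}) (P k x)" using E_Int[OF B, of "{\<mu> k}" "P k x"] by (simp add: sing)
      then show ?thesis using sing[of k x] by (cases "\<mu> k \<in> B") (auto simp: E_empty)
    qed
    moreover have "(\<lambda>k. ?E B (P k x)) sums ?E B x" by (rule EB.sums[OF P_sums])
    ultimately show ?thesis by (simp add: mop_def sums_iff)
  qed
  then show ?thesis by (intro ext)
qed

end

section \<open>Right Dini derivatives and Gronwall's inequality\<close>

definition dini_le :: "(real \<Rightarrow> real) \<Rightarrow> (real \<Rightarrow> real) \<Rightarrow> real \<Rightarrow> real \<Rightarrow> bool" where
  "dini_le f g a b \<longleftrightarrow>
     (\<forall>t\<in>{a..<b}. \<forall>e>0. \<forall>\<^sub>F s in at_right t. f s - f t \<le> (g t + e) * (s - t))"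

lemma dini_le_add:
  assumes "dini_le f g a b" "dini_le f' g' a b"
  shows "dini_le (\<lambda>t. f t + f' t) (\<lambda>t. g t + g' t) a b"
  unfolding dini_le_def
proof (intro ballI allI impI)
  fix t e :: real assume t: "t \<in> {a..<b}" and e: "e > 0"
  have "\<forall>\<^sub>F s in at_right t. f s - f t \<le> (g t + e/2) * (s - t)"
    "\<forall>\<^sub>F s in at_right t. f' s - f' t \<le> (g' t + e/2) * (s - t)"
    using assms t e unfolding dini_le_def by (meson half_gt_zero)+
  then show "\<forall>\<^sub>F s in at_right t. f s + f' s - (f t + f' t) \<le> (g t + g' t + e) * (s - t)"
    by eventually_elim (simp add: field_simps)
qed

lemma dini_le_cmult:
  assumes "dini_le f g a b" "c \<ge> 0"
  shows "dini_le (\<lambda>t. c * f t) (\<lambda>t. c * g t) a b"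
  unfolding dini_le_def
proof (intro ballI allI impI)
  fix t e :: real assume t: "t \<in> {a..<b}" and e: "e > 0"
  have "e / (c + 1) > 0" using e assms(2) by simp
  then have "\<forall>\<^sub>F s in at_right t. f s - f t \<le> (g t + e / (c + 1)) * (s - t)"
    using assms t unfolding dini_le_def by blast
  moreover have "\<forall>\<^sub>F s in at_right t. s > t" by (simp add: eventually_at_right_less)
  ultimately show "\<forall>\<^sub>F s in at_right t. c * f s - c * f t \<le> (c * g t + e) * (s - t)"
  proof eventually_elim
    case (elim s)
    have "c * (f s - f t) \<le> c * ((g t + e / (c + 1)) * (s - t))" using elim assms(2) by (intro mult_left_mono) auto
    also have "\<dots> = (c * g t + c * (e / (c + 1))) * (s - t)" by (simp add: algebra_simps)
    also have "\<dots> \<le> (c * g t + e) * (s - t)"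
      using elim assms(2) e by (intro mult_right_mono add_left_mono) (auto simp: field_simps)
    finally show ?case by (simp add: algebra_simps)
  qed
qed

lemma dini_le_sum:
  assumes "finite S" "\<And>k. k \<in> S \<Longrightarrow> dini_le (f k) (g k) a b" "\<And>k. k \<in> S \<Longrightarrow> w k \<ge> 0"
  shows "dini_le (\<lambda>t. \<Sum>k\<in>S. w k * f k t) (\<lambda>t. \<Sum>k\<in>S. w k * g k t) a b"
  using assms
proof (induction S rule: finite_induct)
  case empty
  show ?case unfolding dini_le_def
  proof (intro ballI allI impI)
    fix t e :: real assume "e > 0"
    moreover have "\<forall>\<^sub>F s in at_right t. s > t" by (simp add: eventually_at_right_less)
    ultimately show "\<forall>\<^sub>F s in at_right t. (\<Sum>k\<in>{}. w k * f k s) - (\<Sum>k\<in>{}. w k * f k t) \<le> ((\<Sum>k\<in>{}. w k * g k t) + e) * (s - t)"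
      by (auto elim: eventually_mono)
  qed
next
  case (insert x S)
  then show ?case using dini_le_add[OF dini_le_cmult[of "f x" "g x" a b "w x"]] by simp
qed

text \<open>At the last time with \<open>f \<le> \<phi>\<close> the graphs meet, and right after it
  \<phi> grows faster than \<open>f\<close>. This is why slopes are compared at meeting points
  only.\<close>

lemma dini_comparison:
  assumes f: "continuous_on {a..b} f" and ab: "a \<le> b" and d: "dini_le f g a b"
    and \<phi>: "\<And>t. (\<phi> has_real_derivative \<phi>' t) (at t)"
    and init: "f a \<le> \<phi> a" and cross: "\<And>t. a \<le> t \<Longrightarrow> t < b \<Longrightarrow> f t = \<phi> t \<Longrightarrow> g t < \<phi>' t"
  shows "f b \<le> \<phi> b"
proof (rule ccontr)
  assume neg: "\<not> f b \<le> \<phi> b"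
  define h where "h = (\<lambda>t. f t - \<phi> t)"
  have c\<phi>: "continuous_on {a..b} \<phi>"
    by (intro continuous_at_imp_continuous_on ballI DERIV_isCont[OF \<phi>])
  have ch: "continuous_on {a..b} h" unfolding h_def by (intro continuous_intros f c\<phi>)
  define Z where "Z = {t \<in> {a..b}. h t \<le> 0}"
  have "compact Z"
  proof -
    have "Z = {a..b} \<inter> h -` {..0}" by (auto simp: Z_def)
    then have "closed Z" using continuous_closed_preimage[OF ch] by auto
    moreover have "bounded Z" by (rule bounded_subset[of "{a..b}"]) (auto simp: Z_def)
    ultimately show ?thesis by (simp add: compact_eq_bounded_closed)
  qed
  moreover have "a \<in> Z" using init ab by (simp add: Z_def h_def)
  ultimately obtain z where z: "z \<in> Z" "\<And>t. t \<in> Z \<Longrightarrow> t \<le> z" using compact_attains_sup[of Z] by blast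
  have zb: "a \<le> z" "z < b" "h z \<le> 0"
    using z(1) neg by (auto simp: Z_def h_def less_le)
  have pos: "h s > 0" if "z < s" "s \<le> b" for s
    using z(2)[of s] that zb by (auto simp: Z_def not_le intro: ccontr)
  have hz: "h z = 0"
  proof (rule antisym[OF zb(3)])
    have "(h \<longlongrightarrow> h z) (at z within {a..b})" using ch zb by (auto simp: continuous_on_def)
    then have "(h \<longlongrightarrow> h z) (at z within {z..b})" by (rule tendsto_within_subset) (use zb in auto)
    then have "(h \<longlongrightarrow> h z) (at_right z)" using at_within_Icc_at_right[OF zb(2)] by simp
    moreover have "\<forall>\<^sub>F s in at_right z. 0 \<le> h s"
      using eventually_at_right_real[OF zb(2)] by eventually_elim (use pos in \<open>auto intro: less_imp_le\<close>)
    ultimately show "0 \<le> h z" by (rule tendsto_lowerbound) simp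
  qed
  have lt: "g z < \<phi>' z" using cross[of z] zb hz by (simp add: h_def)
  \<comment> \<open>Half the difference of the slopes, so that the upper bound for \<open>f\<close>
    and the lower bound for \<phi> get the same slope.\<close>
  define e where "e = (\<phi>' z - g z) / 2"
  have e: "e > 0" using lt by (simp add: e_def)
  have "\<forall>\<^sub>F s in at_right z. f s - f z \<le> (g z + e) * (s - z)"
    using d zb e unfolding dini_le_def by auto
  moreover have "\<forall>\<^sub>F s in at_right z. (\<phi>' z - e) * (s - z) \<le> \<phi> s - \<phi> z"
  proof -
    have "((\<lambda>s. (\<phi> s - \<phi> z) / (s - z)) \<longlongrightarrow> \<phi>' z) (at z)"
      using \<phi>[of z] by (simp add: has_field_derivative_iff)
    then have "((\<lambda>s. (\<phi> s - \<phi> z) / (s - z)) \<longlongrightarrow> \<phi>' z) (at_right z)"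
      by (rule tendsto_within_subset) auto
    then have "\<forall>\<^sub>F s in at_right z. (\<phi> s - \<phi> z) / (s - z) > \<phi>' z - e"
      using e by (intro order_tendstoD) auto
    moreover have "\<forall>\<^sub>F s in at_right z. s > z" by (simp add: eventually_at_right_less)
    ultimately show ?thesis by eventually_elim (auto simp: field_simps)
  qed
  moreover have "\<forall>\<^sub>F s in at_right z. s \<in> {z<..<b}" by (rule eventually_at_right_real[OF zb(2)])
  ultimately have "\<forall>\<^sub>F s in at_right z. False"
  proof eventually_elim
    case (elim s)
    have "g z + e = \<phi>' z - e" by (simp add: e_def field_simps)
    then have "f s - f z \<le> \<phi> s - \<phi> z" using elim(1,2) by (metis order_trans)
    then have "h s \<le> 0" using hz by (simp add: h_def)
    then show ?case using pos[of s] elim by simp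
  qed
  then show False by simp
qed

text \<open>The barrier solves \<open>\<phi>' = K \<phi> + \<rho> exp (\<kappa> (t - a))\<close> up
  to a small multiple of \<open>exp ((K + 1) (t - a))\<close>, which makes the slope inequality
  strict. The factor \<open>1 / (\<kappa> - K)\<close> later lets a forcing term be absorbed by
  taking \<kappa> large.\<close>

lemma dini_Gronwall:
  assumes f: "continuous_on {a..b} f" and ab: "a \<le> b" and d: "dini_le f g a b"
    and g: "\<And>t. a \<le> t \<Longrightarrow> t < b \<Longrightarrow> g t \<le> K * f t + \<rho> * exp (\<kappa> * (t - a))"
    and \<kappa>: "K < \<kappa>" and \<rho>: "0 \<le> \<rho>"
  shows "f b \<le> exp (K * (b - a)) * f a + \<rho> / (\<kappa> - K) * exp (\<kappa> * (b - a))"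
proof (rule field_le_epsilon)
  fix e :: real assume e: "e > 0"
  define \<eta> where "\<eta> = e / exp ((K + 1) * (b - a))"
  have \<eta>: "\<eta> > 0" using e by (simp add: \<eta>_def)
  define c where "c = \<rho> / (\<kappa> - K)"
  have c: "c * \<kappa> = K * c + \<rho>" "c \<ge> 0" using \<kappa> \<rho> by (simp_all add: c_def field_simps)
  let ?\<phi> = "\<lambda>t. exp (K * (t - a)) * f a + c * exp (\<kappa> * (t - a)) + \<eta> * exp ((K + 1) * (t - a))"
  let ?\<phi>' = "\<lambda>t. K * exp (K * (t - a)) * f a + c * (\<kappa> * exp (\<kappa> * (t - a))) + \<eta> * ((K + 1) * exp ((K + 1) * (t - a)))"
  have "f b \<le> ?\<phi> b"
  proof (rule dini_comparison[OF f ab d])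
    show "(?\<phi> has_real_derivative ?\<phi>' t) (at t)" for t
      by (auto intro!: derivative_eq_intros simp: algebra_simps)
    show "f a \<le> ?\<phi> a" using \<eta> c(2) by simp
    fix t assume t: "a \<le> t" "t < b" "f t = ?\<phi> t"
    have "c * (\<kappa> * exp (\<kappa> * (t - a))) = (K * c + \<rho>) * exp (\<kappa> * (t - a))"
      by (simp add: c(1)[symmetric])
    then have "K * ?\<phi> t + \<rho> * exp (\<kappa> * (t - a)) + \<eta> * exp ((K + 1) * (t - a)) = ?\<phi>' t"
      by (simp only: distrib_left distrib_right mult.left_commute mult.assoc mult_1_left)
    moreover have "\<eta> * exp ((K + 1) * (t - a)) > 0" using \<eta> by simp
    ultimately show "g t < ?\<phi>' t" using g[OF t(1,2), unfolded t(3)] by linarith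
  qed
  also have "?\<phi> b = exp (K * (b - a)) * f a + c * exp (\<kappa> * (b - a)) + e" by (simp add: \<eta>_def)
  finally show "f b \<le> exp (K * (b - a)) * f a + \<rho> / (\<kappa> - K) * exp (\<kappa> * (b - a)) + e"
    by (simp add: c_def)
qed

section \<open>Energy estimates\<close>

lemma continuous_on_vector_derivative_within:
  fixes f :: "real \<Rightarrow> 'a::real_normed_vector"
  assumes "\<And>t. 0 \<le> t \<Longrightarrow> (f has_vector_derivative f' t) (at t within {0..})"
  shows "continuous_on {0..} f"
  using assms by (intro continuous_on_vector_derivative[of _ f f']) auto

text \<open>With the coefficient frozen at time \<open>t\<close> the energy is differentiable and
  the terms with \<open>c t * q\<close> cancel. Unfreezing costs \<open>L (s - t) q |y s|^2\<close>,
  to first order at most \<open>L / \<nu>\<close> times the energy times \<open>s - t\<close>. The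
  rate does not involve \<open>q\<close>, hence is common to all modes; the summand 1 in the energy
  adds 1 to it.\<close>

lemma energy_dini:
  fixes y :: "real \<Rightarrow> 'a::real_inner"
  assumes ab: "0 \<le> a"
    and y: "\<And>t. 0 \<le> t \<Longrightarrow> (y has_vector_derivative y' t) (at t within {0..})"
    and y': "\<And>t. 0 \<le> t \<Longrightarrow> (y' has_vector_derivative f t - (c t * q) *\<^sub>R y t) (at t within {0..})"
    and c: "\<And>s t. s \<in> {a..b} \<Longrightarrow> t \<in> {a..b} \<Longrightarrow> \<bar>c s - c t\<bar> \<le> L * \<bar>s - t\<bar>" "\<And>t. t \<in> {a..b} \<Longrightarrow> \<nu> \<le> c t"
    and pos: "\<nu> > 0" "q \<ge> 0" "L \<ge> 0"
  shows "dini_le (\<lambda>t. (norm (y' t))\<^sup>2 + (c t * q + 1) * (norm (y t))\<^sup>2)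
    (\<lambda>t. (L / \<nu> + 1) * ((norm (y' t))\<^sup>2 + (c t * q + 1) * (norm (y t))\<^sup>2) + 2 * norm (y' t) * norm (f t)) a b"
  unfolding dini_le_def
proof (intro ballI allI impI)
  fix t e :: real assume t: "t \<in> {a..<b}" and e: "e > 0"
  then have t0: "0 \<le> t" "t < b" using ab by auto
  have le: "at_right t \<le> at t within {0..}" using t0 by (intro at_le) auto
  let ?e = "\<lambda>t. (norm (y' t))\<^sup>2 + (c t * q + 1) * (norm (y t))\<^sup>2"
  define G where "G = (\<lambda>s. inner (y' s) (y' s) + (c t * q + 1) * inner (y s) (y s))"
  have dG: "(G has_real_derivative (2 * inner (y' t) (f t) + 2 * inner (y t) (y' t))) (at t within {0..})"
  proof -
    have "((\<lambda>s. inner (y' s) (y' s)) has_vector_derivative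
        (inner (y' t) (f t - (c t * q) *\<^sub>R y t) + inner (f t - (c t * q) *\<^sub>R y t) (y' t))) (at t within {0..})"
      by (rule bounded_bilinear.has_vector_derivative[OF bounded_bilinear_inner y'[OF t0(1)] y'[OF t0(1)]])
    moreover have "((\<lambda>s. inner (y s) (y s)) has_vector_derivative
        (inner (y t) (y' t) + inner (y' t) (y t))) (at t within {0..})"
      by (rule bounded_bilinear.has_vector_derivative[OF bounded_bilinear_inner y[OF t0(1)] y[OF t0(1)]])
    ultimately have "(G has_vector_derivative
        ((inner (y' t) (f t - (c t * q) *\<^sub>R y t) + inner (f t - (c t * q) *\<^sub>R y t) (y' t)) +
         (c t * q + 1) * (inner (y t) (y' t) + inner (y' t) (y t)))) (at t within {0..})"
      unfolding G_def by (intro has_vector_derivative_add has_vector_derivative_mult_right)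
    then show ?thesis
      unfolding has_real_derivative_iff_has_vector_derivative
      by (rule has_vector_derivative_eq_rhs) (simp add: inner_simps inner_commute algebra_simps)
  qed
  have G1: "\<forall>\<^sub>F s in at_right t. G s - G t \<le> (2 * norm (y' t) * norm (f t) + (norm (y t))\<^sup>2 + (norm (y' t))\<^sup>2 + e/2) * (s - t)"
  proof -
    have "((\<lambda>s. (G s - G t) / (s - t)) \<longlongrightarrow> 2 * inner (y' t) (f t) + 2 * inner (y t) (y' t)) (at_right t)"
      using dG le by (auto simp: has_field_derivative_iff intro: tendsto_mono)
    moreover have "2 * inner (y' t) (f t) \<le> 2 * (norm (y' t) * norm (f t))"
      by (simp add: norm_cauchy_schwarz)
    moreover have "2 * inner (y t) (y' t) \<le> (norm (y t))\<^sup>2 + (norm (y' t))\<^sup>2"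
      using zero_le_power2[of "norm (y t - y' t)"] by (simp add: norm_diff_sq)
    ultimately have "\<forall>\<^sub>F s in at_right t. (G s - G t) / (s - t) < 2 * norm (y' t) * norm (f t) + (norm (y t))\<^sup>2 + (norm (y' t))\<^sup>2 + e/2"
      using e by (intro order_tendstoD(2)) auto
    moreover have "\<forall>\<^sub>F s in at_right t. s > t" by (simp add: eventually_at_right_less)
    ultimately show ?thesis by eventually_elim (auto simp: field_simps)
  qed
  have y2: "\<forall>\<^sub>F s in at_right t. L * q * (norm (y s))\<^sup>2 < L * q * (norm (y t))\<^sup>2 + e/2"
  proof -
    have "(y \<longlongrightarrow> y t) (at t within {0..})"
      using has_vector_derivative_continuous[OF y[OF t0(1)]] by (simp add: continuous_within)
    then have "(y \<longlongrightarrow> y t) (at_right t)" using le by (rule tendsto_mono[rotated])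
    then have "((\<lambda>s. L * q * (norm (y s))\<^sup>2) \<longlongrightarrow> L * q * (norm (y t))\<^sup>2) (at_right t)"
      by (intro tendsto_intros)
    then show ?thesis using e by (intro order_tendstoD(2)) auto
  qed
  have "\<forall>\<^sub>F s in at_right t. s \<in> {t<..<b}" by (rule eventually_at_right_real[OF t0(2)])
  with G1 y2 show "\<forall>\<^sub>F s in at_right t. ?e s - ?e t \<le> ((L / \<nu> + 1) * ?e t + 2 * norm (y' t) * norm (f t) + e) * (s - t)"
  proof eventually_elim
    case (elim s)
    have st: "s \<in> {a..b}" "t \<in> {a..b}" "s - t > 0" using elim t by auto
    have "?e s - ?e t = (G s - G t) + (c s - c t) * (q * (norm (y s))\<^sup>2)"
      by (simp add: G_def power2_norm_eq_inner algebra_simps)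
    also have "(c s - c t) * (q * (norm (y s))\<^sup>2) \<le> (L * (s - t)) * (q * (norm (y s))\<^sup>2)"
      using c(1)[OF st(1,2)] st(3) pos by (intro mult_right_mono) auto
    also have "\<dots> = (L * q * (norm (y s))\<^sup>2) * (s - t)" by simp
    also have "\<dots> \<le> (L * q * (norm (y t))\<^sup>2 + e/2) * (s - t)"
      using elim st by (intro mult_right_mono) auto
    also have "\<dots> \<le> (L / \<nu> * (c t * q * (norm (y t))\<^sup>2) + e/2) * (s - t)"
    proof -
      have "L * (q * (norm (y t))\<^sup>2) * 1 \<le> L * (q * (norm (y t))\<^sup>2) * (c t / \<nu>)"
        using pos c(2)[OF st(2)] by (intro mult_left_mono) (auto simp: field_simps)
      then show ?thesis using st by (intro mult_right_mono add_right_mono) (auto simp: field_simps)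
    qed
    finally have "?e s - ?e t \<le> (2 * norm (y' t) * norm (f t) + (norm (y t))\<^sup>2 + (norm (y' t))\<^sup>2 + e/2) * (s - t)
       + (L / \<nu> * (c t * q * (norm (y t))\<^sup>2) + e/2) * (s - t)" using elim by linarith
    also have "\<dots> = (2 * norm (y' t) * norm (f t) + (norm (y t))\<^sup>2 + (norm (y' t))\<^sup>2 + e
       + L / \<nu> * (c t * q * (norm (y t))\<^sup>2)) * (s - t)" by (simp add: algebra_simps)
    also have "\<dots> \<le> ((L / \<nu> + 1) * ?e t + 2 * norm (y' t) * norm (f t) + e) * (s - t)"
    proof (intro mult_right_mono)
      have cq: "0 \<le> c t * q * (norm (y t))\<^sup>2" using c(2)[OF st(2)] pos by simp
      have "L / \<nu> * (c t * q * (norm (y t))\<^sup>2) \<le> L / \<nu> * ?e t"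
        using pos by (intro mult_left_mono) (auto simp: algebra_simps)
      moreover have "(norm (y t))\<^sup>2 + (norm (y' t))\<^sup>2 \<le> ?e t" using cq by (simp add: algebra_simps)
      moreover have "(L / \<nu> + 1) * ?e t = L / \<nu> * ?e t + ?e t" by (simp only: distrib_right mult_1_left)
      ultimately show "2 * norm (y' t) * norm (f t) + (norm (y t))\<^sup>2 + (norm (y' t))\<^sup>2 + e + L / \<nu> * (c t * q * (norm (y t))\<^sup>2)
        \<le> (L / \<nu> + 1) * ?e t + 2 * norm (y' t) * norm (f t) + e" by linarith
    qed (use st in auto)
    finally show ?case .
  qed
qed

lemma sum_mult_le_sqrt:
  assumes "(\<Sum>k\<in>S. (x k)\<^sup>2) \<le> X" "(\<Sum>k\<in>S. (y k)\<^sup>2) \<le> Y"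
  shows "(\<Sum>k\<in>S. \<bar>x k\<bar> * \<bar>y k\<bar>) \<le> sqrt X * sqrt (Y::real)"
proof -
  have "(\<Sum>k\<in>S. \<bar>x k\<bar> * \<bar>y k\<bar>) \<le> L2_set x S * L2_set y S" by (rule L2_set_mult_ineq)
  also have "\<dots> \<le> sqrt X * sqrt Y"
    unfolding L2_set_def using assms
    by (intro mult_mono) (auto intro!: real_sqrt_le_mono sum_nonneg order_trans[OF sum_nonneg assms(1)])
  finally show ?thesis .
qed

locale wave_frame = orthogonal_decomposition P
  for P :: "nat \<Rightarrow> 'a::{real_inner,complete_space} \<Rightarrow> 'a" +
  fixes lam :: "nat \<Rightarrow> real"
  assumes lam_nonneg: "0 \<le> lam k"
begin

text \<open>
  With \<open>A\<close> the multiplier by \<open>(lam k)\<^sup>2\<close>, \<open>sg x\<close> is \<open>\<bar>A\<^bsup>1/2\<^esup> x\<bar>\<^sup>2\<close> and \<open>en k u u'\<close> is the energy of the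
  \<open>k\<close>-th component of \<open>u'' + (1 + A) u = 0\<close>; the summand 1 keeps control of a kernel of \<open>A\<close>.
\<close>

definition en :: "nat \<Rightarrow> 'a \<Rightarrow> 'a \<Rightarrow> real" where
  "en k x y = (norm (P k y))\<^sup>2 + (1 + (lam k)\<^sup>2) * (norm (P k x))\<^sup>2"

definition sg :: "'a \<Rightarrow> real" where
  "sg x = (\<Sum>k. (lam k)\<^sup>2 * (norm (P k x))\<^sup>2)"

text \<open>The coefficient is a separate function of time, so the modes decouple. Differentiability
  is asked only of components, which both Galerkin and weak solutions provide.\<close>

definition component_solution :: "(real \<Rightarrow> real) \<Rightarrow> (real \<Rightarrow> 'a) \<Rightarrow> (real \<Rightarrow> 'a) \<Rightarrow> bool" where
  "component_solution c u u' \<longleftrightarrow> (\<forall>k. \<forall>t\<ge>0.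
     ((\<lambda>s. P k (u s)) has_vector_derivative P k (u' t)) (at t within {0..}) \<and>
     ((\<lambda>s. P k (u' s)) has_vector_derivative (- (c t * (lam k)\<^sup>2)) *\<^sub>R P k (u t)) (at t within {0..}))"

lemma en_nonneg: "0 \<le> en k x y"
  by (simp add: en_def)

lemma en_diff_le: "en k (x - x') (y - y') \<le> 2 * en k x y + 2 * en k x' y'"
proof -
  have "(norm (P k (y - y')))\<^sup>2 \<le> 2 * (norm (P k y))\<^sup>2 + 2 * (norm (P k y'))\<^sup>2"
    by (simp add: P_diff norm_diff_sq_le)
  moreover have "(1 + (lam k)\<^sup>2) * (norm (P k (x - x')))\<^sup>2 \<le> (1 + (lam k)\<^sup>2) * (2 * (norm (P k x))\<^sup>2 + 2 * (norm (P k x'))\<^sup>2)"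
    by (intro mult_left_mono) (simp_all add: P_diff norm_diff_sq_le)
  ultimately show ?thesis by (simp add: en_def algebra_simps)
qed

lemma lam_sq_le_en: "(lam k)\<^sup>2 * (norm (P k x))\<^sup>2 \<le> en k x y"
  by (simp add: en_def algebra_simps)

lemma norm_P_snd_le_en: "(norm (P k y))\<^sup>2 \<le> en k x y"
  by (simp add: en_def)

lemma norm_P_fst_le_en: "(norm (P k x))\<^sup>2 \<le> en k x y"
  by (simp add: en_def algebra_simps)

lemma component_solutionD:
  assumes "component_solution c u u'" "0 \<le> t"
  shows "((\<lambda>s. P k (u s)) has_vector_derivative P k (u' t)) (at t within {0..})"
    and "((\<lambda>s. P k (u' s)) has_vector_derivative (- (c t * (lam k)\<^sup>2)) *\<^sub>R P k (u t)) (at t within {0..})"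
  using assms by (auto simp: component_solution_def)

lemma component_solution_continuous:
  assumes "component_solution c u u'"
  shows "continuous_on {0..} (\<lambda>t. P k (u t))" "continuous_on {0..} (\<lambda>t. P k (u' t))"
  by (rule continuous_on_vector_derivative_within, erule component_solutionD[OF assms])+

lemma en_continuous:
  assumes "component_solution c u u'"
  shows "continuous_on {0..} (\<lambda>t. en k (u t) (u' t))"
  unfolding en_def by (intro continuous_intros component_solution_continuous[OF assms])

lemma energy_equivalence:
  assumes "\<nu> \<le> c" "c \<le> M" "0 < \<nu>"
  shows "min 1 \<nu> * en k x y \<le> (norm (P k y))\<^sup>2 + (c * (lam k)\<^sup>2 + 1) * (norm (P k x))\<^sup>2"
    and "(norm (P k y))\<^sup>2 + (c * (lam k)\<^sup>2 + 1) * (norm (P k x))\<^sup>2 \<le> max 1 M * en k x y"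
proof -
  have "min 1 \<nu> * (1 + (lam k)\<^sup>2) = min 1 \<nu> * 1 + min 1 \<nu> * (lam k)\<^sup>2" by (simp add: algebra_simps)
  also have "\<dots> \<le> 1 * 1 + c * (lam k)\<^sup>2" using assms by (intro add_mono mult_right_mono) auto
  finally have "min 1 \<nu> * (1 + (lam k)\<^sup>2) * (norm (P k x))\<^sup>2 \<le> (c * (lam k)\<^sup>2 + 1) * (norm (P k x))\<^sup>2"
    by (intro mult_right_mono) auto
  moreover have "min 1 \<nu> * (norm (P k y))\<^sup>2 \<le> 1 * (norm (P k y))\<^sup>2" by (intro mult_right_mono) auto
  moreover have "min 1 \<nu> * en k x y = min 1 \<nu> * (norm (P k y))\<^sup>2 + min 1 \<nu> * (1 + (lam k)\<^sup>2) * (norm (P k x))\<^sup>2"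
    unfolding en_def by (subst distrib_left) (simp only: mult.assoc)
  ultimately show "min 1 \<nu> * en k x y \<le> (norm (P k y))\<^sup>2 + (c * (lam k)\<^sup>2 + 1) * (norm (P k x))\<^sup>2"
    by linarith
  have "1 * 1 + c * (lam k)\<^sup>2 \<le> max 1 M * 1 + max 1 M * (lam k)\<^sup>2"
    using assms by (intro add_mono mult_right_mono) auto
  also have "\<dots> = max 1 M * (1 + (lam k)\<^sup>2)" by (simp add: algebra_simps)
  finally have "(c * (lam k)\<^sup>2 + 1) * (norm (P k x))\<^sup>2 \<le> max 1 M * (1 + (lam k)\<^sup>2) * (norm (P k x))\<^sup>2"
    by (intro mult_right_mono) auto
  moreover have "1 * (norm (P k y))\<^sup>2 \<le> max 1 M * (norm (P k y))\<^sup>2" by (intro mult_right_mono) auto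
  moreover have "max 1 M * en k x y = max 1 M * (norm (P k y))\<^sup>2 + max 1 M * (1 + (lam k)\<^sup>2) * (norm (P k x))\<^sup>2"
    unfolding en_def by (subst distrib_left) (simp only: mult.assoc)
  ultimately show "(norm (P k y))\<^sup>2 + (c * (lam k)\<^sup>2 + 1) * (norm (P k x))\<^sup>2 \<le> max 1 M * en k x y"
    by linarith
qed

lemma continuous_on_Lipschitz_bound:
  fixes c :: "real \<Rightarrow> real"
  assumes "\<And>s t. s \<in> {a..b} \<Longrightarrow> t \<in> {a..b} \<Longrightarrow> \<bar>c s - c t\<bar> \<le> L * \<bar>s - t\<bar>"
  shows "continuous_on {a..b} c"
proof -
  have "\<bar>L\<bar>-lipschitz_on {a..b} c"
  proof (rule lipschitz_onI)
    fix x y assume "x \<in> {a..b}" "y \<in> {a..b}"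
    then have "\<bar>c x - c y\<bar> \<le> L * \<bar>x - y\<bar>" by (rule assms)
    also have "\<dots> \<le> \<bar>L\<bar> * \<bar>x - y\<bar>" by (intro mult_right_mono) auto
    finally show "dist (c x) (c y) \<le> \<bar>L\<bar> * dist x y" by (simp add: dist_real_def)
  qed simp
  then show ?thesis by (rule lipschitz_on_continuous_on)
qed

text \<open>The factor is the same for all \<open>k\<close>: the Lipschitz constant enters through
  \<open>L / \<nu>\<close>, and the bounds of \<open>c\<close> enter when \<open>en\<close> is
  exchanged with the energy containing \<open>c\<close>.\<close>

lemma en_growth:
  assumes sol: "component_solution c u u'" and ab: "0 \<le> a" "a \<le> t" "t \<le> b"
    and c: "\<And>s t. s \<in> {a..b} \<Longrightarrow> t \<in> {a..b} \<Longrightarrow> \<bar>c s - c t\<bar> \<le> L * \<bar>s - t\<bar>"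
      "\<And>t. t \<in> {a..b} \<Longrightarrow> \<nu> \<le> c t" "\<And>t. t \<in> {a..b} \<Longrightarrow> c t \<le> M"
    and pos: "0 < \<nu>" "0 \<le> L"
  shows "en k (u t) (u' t) \<le> max 1 M / min 1 \<nu> * exp ((L / \<nu> + 1) * (b - a)) * en k (u a) (u' a)"
proof -
  let ?e = "\<lambda>t. (norm (P k (u' t)))\<^sup>2 + (c t * (lam k)\<^sup>2 + 1) * (norm (P k (u t)))\<^sup>2"
  let ?K = "L / \<nu> + 1"
  have sub: "{a..t} \<subseteq> {0..}" "{a..t} \<subseteq> {a..b}" using ab by auto
  have "dini_le ?e (\<lambda>t. ?K * ?e t + 2 * norm (P k (u' t)) * norm (0::'a)) a t"
    using component_solutionD[OF sol, of _ k] pos ab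
    by (intro energy_dini c) auto
  then have d: "dini_le ?e (\<lambda>t. ?K * ?e t) a t" by simp
  have cont: "continuous_on {a..t} ?e"
    by (intro continuous_intros continuous_on_subset[OF component_solution_continuous(1)[OF sol] sub(1)]
        continuous_on_subset[OF component_solution_continuous(2)[OF sol] sub(1)]
        continuous_on_subset[OF continuous_on_Lipschitz_bound[OF c(1)] sub(2)])
  have "?e t \<le> exp (?K * (t - a)) * ?e a + 0 / (?K + 1 - ?K) * exp ((?K + 1) * (t - a))"
    by (rule dini_Gronwall[OF cont ab(2) d]) auto
  then have 1: "?e t \<le> exp (?K * (t - a)) * ?e a" by simp
  have ta: "t \<in> {a..b}" "a \<in> {a..b}" using ab by auto
  have "min 1 \<nu> * en k (u t) (u' t) \<le> ?e t"
    by (rule energy_equivalence(1)[OF c(2)[OF ta(1)] c(3)[OF ta(1)] pos(1)])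
  also note 1
  also have "exp (?K * (t - a)) * ?e a \<le> exp (?K * (b - a)) * (max 1 M * en k (u a) (u' a))"
    using energy_equivalence(2)[OF c(2)[OF ta(2)] c(3)[OF ta(2)] pos(1)] ab pos c(2)[OF ta(2)]
    by (intro mult_mono) (auto intro!: mult_left_mono add_nonneg_nonneg)
  finally show ?thesis using pos by (simp add: field_simps)
qed

text \<open>The k-th term has derivative \<open>2 lam^2 <u, u'>\<close>. Splitting off one factor
  \<open>lam\<close> and using \<open>2 x y \<le> x^2 + y^2\<close> with \<open>x = lam |u|\<close>
  bounds it by the energy with weight \<open>lam\<close>; hence that energy governs the Lipschitz
  constant of the coefficient.\<close>

lemma sg_Lipschitz:
  assumes sol: "component_solution c u u'" and a: "0 \<le> a"
    and Q: "\<And>n t. t \<in> {a..b} \<Longrightarrow>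
      (\<Sum>k<n. lam k * ((norm (P k (u' t)))\<^sup>2 + (lam k)\<^sup>2 * (norm (P k (u t)))\<^sup>2)) \<le> Q"
    and summ: "\<And>t. t \<in> {a..b} \<Longrightarrow> summable (\<lambda>k. (lam k)\<^sup>2 * (norm (P k (u t)))\<^sup>2)"
    and st: "s \<in> {a..b}" "t \<in> {a..b}"
  shows "\<bar>sg (u s) - sg (u t)\<bar> \<le> Q * \<bar>s - t\<bar>"
proof -
  let ?S = "\<lambda>n t. \<Sum>k<n. (lam k)\<^sup>2 * (norm (P k (u t)))\<^sup>2"
  have fin: "\<bar>?S n s - ?S n t\<bar> \<le> Q * \<bar>s - t\<bar>" for n
  proof -
    let ?S' = "\<lambda>t. \<Sum>k<n. (lam k)\<^sup>2 * (2 * inner (P k (u t)) (P k (u' t)))"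
    have "norm (?S n s - ?S n t) \<le> Q * norm (s - t)"
    proof (rule field_differentiable_bound[where S="{a..b}" and f'="?S'"])
      fix r assume r: "r \<in> {a..b}"
      then have r0: "0 \<le> r" using a by simp
      have "((\<lambda>t. (norm (P k (u t)))\<^sup>2) has_real_derivative 2 * inner (P k (u r)) (P k (u' r))) (at r within {0..})" for k
      proof -
        have "((\<lambda>s. inner (P k (u s)) (P k (u s))) has_vector_derivative
          (inner (P k (u r)) (P k (u' r)) + inner (P k (u' r)) (P k (u r)))) (at r within {0..})"
          by (rule bounded_bilinear.has_vector_derivative[OF bounded_bilinear_inner component_solutionD(1)[OF sol r0] component_solutionD(1)[OF sol r0]])
        then show ?thesis
          unfolding has_real_derivative_iff_has_vector_derivative power2_norm_eq_inner
          by (rule has_vector_derivative_eq_rhs) (simp add: inner_commute[of "P k (u' r)"])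
      qed
      then have "(?S n has_real_derivative ?S' r) (at r within {0..})"
        by (intro DERIV_sum DERIV_cmult)
      then show "(?S n has_field_derivative ?S' r) (at r within {a..b})"
        by (rule has_field_derivative_subset) (use a in auto)
      have "\<bar>?S' r\<bar> \<le> (\<Sum>k<n. \<bar>(lam k)\<^sup>2 * (2 * inner (P k (u r)) (P k (u' r)))\<bar>)" by (rule sum_abs)
      also have "\<dots> \<le> (\<Sum>k<n. lam k * ((norm (P k (u' r)))\<^sup>2 + (lam k)\<^sup>2 * (norm (P k (u r)))\<^sup>2))"
      proof (rule sum_mono)
        fix k
        let ?x = "lam k * norm (P k (u r))" and ?y = "norm (P k (u' r))"
        have "\<bar>(lam k)\<^sup>2 * (2 * inner (P k (u r)) (P k (u' r)))\<bar> \<le> (lam k)\<^sup>2 * (2 * (norm (P k (u r)) * ?y))"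
          unfolding abs_mult using Cauchy_Schwarz_ineq2[of "P k (u r)" "P k (u' r)"]
          by (intro mult_mono) auto
        also have "\<dots> = lam k * (2 * ?x * ?y)" by (simp add: power2_eq_square)
        also have "\<dots> \<le> lam k * (?y\<^sup>2 + ?x\<^sup>2)"
          using lam_nonneg[of k] sum_squares_bound[of ?x ?y] by (intro mult_left_mono) auto
        finally show "\<bar>(lam k)\<^sup>2 * (2 * inner (P k (u r)) (P k (u' r)))\<bar> \<le> lam k * (?y\<^sup>2 + (lam k)\<^sup>2 * (norm (P k (u r)))\<^sup>2)"
          by (simp add: power_mult_distrib)
      qed
      also have "\<dots> \<le> Q" by (rule Q[OF r])
      finally show "norm (?S' r) \<le> Q" by simp
    qed (use st in auto)
    then show ?thesis by simp
  qed
  have "(\<lambda>n. \<bar>?S n s - ?S n t\<bar>) \<longlonglongrightarrow> \<bar>sg (u s) - sg (u t)\<bar>"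
    unfolding sg_def by (intro tendsto_intros summable_LIMSEQ summ st)
  then show ?thesis by (rule LIMSEQ_le_const2) (use fin in auto)
qed

lemma summable_sg:
  assumes "\<And>n. (\<Sum>k<n. (1 + lam k) * en k x y) \<le> B"
  shows "summable (\<lambda>k. (lam k)\<^sup>2 * (norm (P k x))\<^sup>2)" "sg x \<in> {0..B}"
proof -
  have le: "(lam k)\<^sup>2 * (norm (P k x))\<^sup>2 \<le> (1 + lam k) * en k x y" for k
    using lam_sq_le_en[of k x y] lam_nonneg[of k] en_nonneg[of k x y]
    by (smt (verit) mult_le_cancel_right1)
  have part: "(\<Sum>k<n. (lam k)\<^sup>2 * (norm (P k x))\<^sup>2) \<le> B" for n
    by (rule order_trans[OF sum_mono assms]) (rule le)
  show s: "summable (\<lambda>k. (lam k)\<^sup>2 * (norm (P k x))\<^sup>2)"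
    by (rule summableI_nonneg_bounded[OF _ part]) simp
  show "sg x \<in> {0..B}"
    unfolding sg_def using suminf_le_const[OF s part] suminf_nonneg[OF s] by simp
qed

lemma coefficient_Lipschitz:
  assumes sol: "component_solution c u u'" and T: "T \<ge> 0"
    and B: "\<And>n t. t \<in> {0..T} \<Longrightarrow> (\<Sum>k<n. (1 + lam k) * en k (u t) (u' t)) \<le> B"
    and m: "\<And>x y. x \<in> {0..B} \<Longrightarrow> y \<in> {0..B} \<Longrightarrow> \<bar>m x - m y\<bar> \<le> \<Lambda> * \<bar>x - y\<bar>" and \<Lambda>: "\<Lambda> \<ge> 0"
    and c: "\<And>t. t \<in> {0..T} \<Longrightarrow> c t = m (sg (u t))"
    and st: "s \<in> {0..T}" "t \<in> {0..T}"
  shows "\<bar>c s - c t\<bar> \<le> (\<Lambda> * B) * \<bar>s - t\<bar>"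
proof -
  have le: "lam k * ((norm (P k (u' t)))\<^sup>2 + (lam k)\<^sup>2 * (norm (P k (u t)))\<^sup>2) \<le> (1 + lam k) * en k (u t) (u' t)" for k t
    using lam_nonneg[of k] by (intro mult_mono) (auto simp: en_def algebra_simps)
  have "\<bar>sg (u s) - sg (u t)\<bar> \<le> B * \<bar>s - t\<bar>"
  proof (rule sg_Lipschitz[OF sol order_refl _ _ st])
    show "(\<Sum>k<n. lam k * ((norm (P k (u' t)))\<^sup>2 + (lam k)\<^sup>2 * (norm (P k (u t)))\<^sup>2)) \<le> B" if "t \<in> {0..T}" for n t
      by (rule order_trans[OF sum_mono B[OF that]]) (rule le)
  qed (rule summable_sg[OF B])
  then have "\<Lambda> * \<bar>sg (u s) - sg (u t)\<bar> \<le> \<Lambda> * (B * \<bar>s - t\<bar>)" using \<Lambda> by (rule mult_left_mono)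
  then show ?thesis
    using m[OF summable_sg(2)[OF B[OF st(1)]] summable_sg(2)[OF B[OF st(2)]]] c st by (simp add: mult_ac)
qed

section \<open>Continuous dependence on the data\<close>

lemma component_solution_diff:
  assumes "component_solution c u u'" "component_solution c2 v v'" "0 \<le> t"
  shows "((\<lambda>s. P k (u s - v s)) has_vector_derivative P k (u' t - v' t)) (at t within {0..})"
    and "((\<lambda>s. P k (u' s - v' s)) has_vector_derivative
      ((c2 t - c t) * (lam k)\<^sup>2) *\<^sub>R P k (v t) - (c t * (lam k)\<^sup>2) *\<^sub>R P k (u t - v t)) (at t within {0..})"
proof -
  show "((\<lambda>s. P k (u s - v s)) has_vector_derivative P k (u' t - v' t)) (at t within {0..})"
    unfolding P_diff by (intro has_vector_derivative_diff component_solutionD(1)[OF assms(1,3)] component_solutionD(1)[OF assms(2,3)])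
  have "((\<lambda>s. P k (u' s - v' s)) has_vector_derivative
     (- (c t * (lam k)\<^sup>2)) *\<^sub>R P k (u t) - (- (c2 t * (lam k)\<^sup>2)) *\<^sub>R P k (v t)) (at t within {0..})"
    unfolding P_diff by (intro has_vector_derivative_diff component_solutionD(2)[OF assms(1,3)] component_solutionD(2)[OF assms(2,3)])
  then show "((\<lambda>s. P k (u' s - v' s)) has_vector_derivative
      ((c2 t - c t) * (lam k)\<^sup>2) *\<^sub>R P k (v t) - (c t * (lam k)\<^sup>2) *\<^sub>R P k (u t - v t)) (at t within {0..})"
    by (rule has_vector_derivative_eq_rhs) (simp add: P_diff algebra_simps)
qed

text \<open>
  The difference of two solutions is estimated half a derivative below the energy space,
  since the term \<open>(c2 - c) A v\<close> loses one derivative. The supremum \<open>X\<close> of the weighted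
  energy absorbs the nonlocal dependence of \<open>c2 - c\<close> on all components.
\<close>

lemma continuous_dependence:
  assumes u: "component_solution c u u'" and v: "component_solution c2 v v'" and T: "T \<ge> 0"
    and Bu: "\<And>n t. t \<in> {0..T} \<Longrightarrow> (\<Sum>k<n. (1 + lam k) * en k (u t) (u' t)) \<le> B"
    and Bv: "\<And>n t. t \<in> {0..T} \<Longrightarrow> (\<Sum>k<n. (1 + lam k) * en k (v t) (v' t)) \<le> B"
    and m: "\<And>x y. x \<in> {0..B} \<Longrightarrow> y \<in> {0..B} \<Longrightarrow> \<bar>m x - m y\<bar> \<le> \<Lambda> * \<bar>x - y\<bar>"
      "\<And>x. x \<in> {0..B} \<Longrightarrow> \<nu> \<le> m x" "\<And>x. x \<in> {0..B} \<Longrightarrow> m x \<le> M"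
    and c: "\<And>t. t \<in> {0..T} \<Longrightarrow> c t = m (sg (u t))" "\<And>t. t \<in> {0..T} \<Longrightarrow> c2 t = m (sg (v t))"
    and pos: "0 < \<nu>" "\<Lambda> \<ge> 0"
    and W0: "\<And>n. (\<Sum>k<n. en k (u 0 - v 0) (u' 0 - v' 0) / (1 + lam k)) \<le> W0"
    and t: "t \<in> {0..T}"
  shows "(\<Sum>k<n. en k (u t - v t) (u' t - v' t) / (1 + lam k))
    \<le> 2 * (max 1 M / min 1 \<nu>) * exp ((\<Lambda> * B / \<nu> + 1 + 8 * \<Lambda> * B / min 1 \<nu> + 1) * T) * W0"
proof -
  define m1 where "m1 = min 1 \<nu>"
  define M1 where "M1 = max 1 M"
  define K where "K = \<Lambda> * B / \<nu> + 1"
  \<comment> \<open>Chosen so that \<open>m1 (\<kappa> - K) = 8 \<Lambda> B + m1\<close>, which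
    keeps the feedback coefficient \<open>4 \<Lambda> B / (m1 (\<kappa> - K))\<close> below
    \<open>1/2\<close>.\<close>
  define \<kappa> where "\<kappa> = K + 8 * \<Lambda> * B / m1 + 1"
  define ew where "ew = (\<lambda>k t. en k (u t - v t) (u' t - v' t))"
  define w where "w = (\<lambda>k. 1 / (1 + lam k))"
  have m1: "0 < m1" and M1: "0 < M1" using pos by (auto simp: m1_def M1_def)
  have B0: "0 \<le> B" using Bu[of 0 0] T by simp
  have K: "0 \<le> K" using B0 pos by (simp add: K_def)
  have \<kappa>K: "K < \<kappa>" "4 * \<Lambda> * B / (m1 * (\<kappa> - K)) \<le> 1/2"
  proof -
    have p: "0 \<le> 8 * \<Lambda> * B / m1" using B0 pos m1 by simp
    then show "K < \<kappa>" by (simp add: \<kappa>_def)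
    have "m1 * (\<kappa> - K) = 8 * \<Lambda> * B + m1" using m1 by (simp add: \<kappa>_def field_simps)
    moreover have "0 < 8 * \<Lambda> * B + m1" using B0 pos m1 by (intro add_nonneg_pos) auto
    ultimately show "4 * \<Lambda> * B / (m1 * (\<kappa> - K)) \<le> 1/2" using m1 by (simp add: field_simps)
  qed
  have \<kappa>0: "0 \<le> \<kappa>" using \<kappa>K K by simp
  have w: "0 < w k" "w k \<le> 1" "w k \<le> 1 + lam k" for k
    using lam_nonneg[of k] by (auto simp: w_def field_simps)
  then have w0: "0 \<le> w k" for k by (simp add: less_imp_le)
  have ew0: "0 \<le> ew k t" for k t by (simp add: ew_def en_nonneg)
  \<comment> \<open>Ensures that the supremum \<open>X\<close> is finite; otherwise an estimate of
    \<open>X\<close> by data plus \<open>X / 2\<close> would be worthless.\<close>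
  have crude: "(\<Sum>k<n. w k * ew k t) \<le> 4 * B" if t: "t \<in> {0..T}" for n t
  proof -
    have "(\<Sum>k<n. w k * ew k t) \<le> (\<Sum>k<n. 2 * ((1 + lam k) * en k (u t) (u' t)) + 2 * ((1 + lam k) * en k (v t) (v' t)))"
    proof (rule sum_mono)
      fix k
      have "w k * ew k t \<le> (1 + lam k) * (2 * en k (u t) (u' t) + 2 * en k (v t) (v' t))"
        using w[of k] lam_nonneg[of k] en_diff_le ew0 by (intro mult_mono) (auto simp: ew_def)
      then show "w k * ew k t \<le> 2 * ((1 + lam k) * en k (u t) (u' t)) + 2 * ((1 + lam k) * en k (v t) (v' t))"
        by (simp add: algebra_simps)
    qed
    also have "\<dots> = 2 * (\<Sum>k<n. (1 + lam k) * en k (u t) (u' t)) + 2 * (\<Sum>k<n. (1 + lam k) * en k (v t) (v' t))"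
      by (simp add: sum.distrib sum_distrib_left)
    also have "\<dots> \<le> 4 * B" using Bu[OF t, of n] Bv[OF t, of n] by simp
    finally show ?thesis .
  qed
  define I where "I = ({0..T} \<times> (UNIV :: nat set))"
  define X where "X = (SUP (t, n)\<in>I. exp (- \<kappa> * t) * (\<Sum>k<n. w k * ew k t))"
  have bdd: "bdd_above ((\<lambda>(t, n). exp (- \<kappa> * t) * (\<Sum>k<n. w k * ew k t)) ` I)"
  proof (rule bdd_aboveI2, clarify)
    fix t n assume "(t, n) \<in> I"
    then have t: "t \<in> {0..T}" by (simp add: I_def)
    have "exp (- \<kappa> * t) \<le> 1" using t \<kappa>0 by simp
    then have "exp (- \<kappa> * t) * (\<Sum>k<n. w k * ew k t) \<le> 1 * (4 * B)"
      using crude[OF t] w0 ew0 by (intro mult_mono sum_nonneg mult_nonneg_nonneg) auto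
    then show "exp (- \<kappa> * t) * (\<Sum>k<n. w k * ew k t) \<le> 4 * B" by simp
  qed
  have X: "(\<Sum>k<n. w k * ew k t) \<le> X * exp (\<kappa> * t)" if t: "t \<in> {0..T}" for n t
  proof -
    have "exp (- \<kappa> * t) * (\<Sum>k<n. w k * ew k t) \<le> X"
      unfolding X_def using cSUP_upper[OF _ bdd, of "(t, n)"] t by (simp add: I_def)
    then show ?thesis by (simp add: exp_minus field_simps)
  qed
  have X0: "0 \<le> X" using X[of 0 0] T by simp
  have Y0: "0 \<le> X * exp (\<kappa> * t)" for t using X0 by simp
  \<comment> \<open>\<open>|u|^2 - |v|^2\<close> factors as \<open><u - v, u + v>\<close>.
    Cauchy-Schwarz with the weights \<open>w\<close> and \<open>1 / w\<close> leaves the weak norm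
    of the difference and the strong, bounded norm of the sum.\<close>
  have dc: "\<bar>c2 t - c t\<bar> \<le> \<Lambda> * (sqrt (X * exp (\<kappa> * t)) * sqrt (4 * B))" if t: "t \<in> {0..T}" for t
  proof -
    let ?S = "\<lambda>n. (\<Sum>k<n. (lam k)\<^sup>2 * (norm (P k (u t)))\<^sup>2) - (\<Sum>k<n. (lam k)\<^sup>2 * (norm (P k (v t)))\<^sup>2)"
    have fin: "\<bar>?S n\<bar> \<le> sqrt (X * exp (\<kappa> * t)) * sqrt (4 * B)" for n
    proof -
      let ?x = "\<lambda>k. sqrt (w k) * (lam k * norm (P k (u t - v t)))"
      let ?y = "\<lambda>k. sqrt (1 + lam k) * (lam k * norm (P k (u t + v t)))"
      have "?S n = (\<Sum>k<n. (lam k)\<^sup>2 * inner (P k (u t - v t)) (P k (u t + v t)))"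
        by (simp add: sum_subtractf[symmetric] P_diff P_add power2_norm_eq_inner inner_simps inner_commute algebra_simps)
      also have "\<bar>\<dots>\<bar> \<le> (\<Sum>k<n. \<bar>?x k\<bar> * \<bar>?y k\<bar>)"
      proof (rule order_trans[OF sum_abs sum_mono])
        fix k
        have "sqrt (w k) * sqrt (1 + lam k) = 1"
          using lam_nonneg[of k] by (simp add: w_def real_sqrt_divide)
        moreover have "\<bar>?x k\<bar> * \<bar>?y k\<bar> = ?x k * ?y k"
          using lam_nonneg[of k] w0[of k] by simp
        moreover have "?x k * ?y k = (sqrt (w k) * sqrt (1 + lam k)) * ((lam k)\<^sup>2 * (norm (P k (u t - v t)) * norm (P k (u t + v t))))"
          by (simp only: power2_eq_square mult_ac)
        ultimately have "\<bar>?x k\<bar> * \<bar>?y k\<bar> = (lam k)\<^sup>2 * (norm (P k (u t - v t)) * norm (P k (u t + v t)))"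
          by simp
        then show "\<bar>(lam k)\<^sup>2 * inner (P k (u t - v t)) (P k (u t + v t))\<bar> \<le> \<bar>?x k\<bar> * \<bar>?y k\<bar>"
          by (simp only: abs_mult abs_power2 power2_abs) (intro mult_left_mono Cauchy_Schwarz_ineq2 zero_le_power2)
      qed
      also have "\<dots> \<le> sqrt (X * exp (\<kappa> * t)) * sqrt (4 * B)"
      proof (rule sum_mult_le_sqrt)
        have "(?x k)\<^sup>2 \<le> w k * ew k t" for k
          using w(1)[of k] lam_sq_le_en[of k "u t - v t" "u' t - v' t"]
          by (simp add: power_mult_distrib ew_def)
        then show "(\<Sum>k<n. (?x k)\<^sup>2) \<le> X * exp (\<kappa> * t)" by (intro order_trans[OF sum_mono X[OF t]])
        have "(?y k)\<^sup>2 \<le> 2 * ((1 + lam k) * en k (u t) (u' t)) + 2 * ((1 + lam k) * en k (v t) (v' t))" for k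
        proof -
          have "(lam k)\<^sup>2 * (norm (P k (u t + v t)))\<^sup>2 \<le> (lam k)\<^sup>2 * (2 * (norm (P k (u t)))\<^sup>2 + 2 * (norm (P k (v t)))\<^sup>2)"
            by (intro mult_left_mono) (simp_all add: P_add norm_add_sq_le)
          also have "\<dots> \<le> 2 * en k (u t) (u' t) + 2 * en k (v t) (v' t)"
            using lam_sq_le_en[of k "u t" "u' t"] lam_sq_le_en[of k "v t" "v' t"] by (simp add: algebra_simps)
          finally have "(1 + lam k) * ((lam k)\<^sup>2 * (norm (P k (u t + v t)))\<^sup>2) \<le> (1 + lam k) * (2 * en k (u t) (u' t) + 2 * en k (v t) (v' t))"
            using lam_nonneg[of k] by (intro mult_left_mono) auto
          then show ?thesis using lam_nonneg[of k] by (simp add: power_mult_distrib algebra_simps)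
        qed
        then have "(\<Sum>k<n. (?y k)\<^sup>2) \<le> (\<Sum>k<n. 2 * ((1 + lam k) * en k (u t) (u' t)) + 2 * ((1 + lam k) * en k (v t) (v' t)))"
          by (intro sum_mono)
        also have "\<dots> = 2 * (\<Sum>k<n. (1 + lam k) * en k (u t) (u' t)) + 2 * (\<Sum>k<n. (1 + lam k) * en k (v t) (v' t))"
          by (simp add: sum.distrib sum_distrib_left)
        also have "\<dots> \<le> 4 * B" using Bu[OF t, of n] Bv[OF t, of n] by simp
        finally show "(\<Sum>k<n. (?y k)\<^sup>2) \<le> 4 * B" .
      qed
      finally show ?thesis .
    qed
    have "(\<lambda>n. \<bar>?S n\<bar>) \<longlonglongrightarrow> \<bar>sg (u t) - sg (v t)\<bar>"
      unfolding sg_def by (intro tendsto_intros summable_LIMSEQ summable_sg(1)[OF Bu[OF t]] summable_sg(1)[OF Bv[OF t]])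
    then have "\<bar>sg (u t) - sg (v t)\<bar> \<le> sqrt (X * exp (\<kappa> * t)) * sqrt (4 * B)"
      by (rule LIMSEQ_le_const2) (use fin in auto)
    then have "\<Lambda> * \<bar>sg (u t) - sg (v t)\<bar> \<le> \<Lambda> * (sqrt (X * exp (\<kappa> * t)) * sqrt (4 * B))"
      using pos by (intro mult_left_mono)
    then show ?thesis
      using m(1)[OF summable_sg(2)[OF Bu[OF t]] summable_sg(2)[OF Bv[OF t]]] c t by (simp add: abs_minus_commute)
  qed
  have main: "(\<Sum>k<n. w k * ew k t) \<le> (M1 / m1 * W0 + X / 2) * exp (\<kappa> * t)" if t: "t \<in> {0..T}" for n t
  proof -
    define d where "d = (\<lambda>k t. (norm (P k (u' t - v' t)))\<^sup>2 + (c t * (lam k)\<^sup>2 + 1) * (norm (P k (u t - v t)))\<^sup>2)"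
    define f where "f = (\<lambda>k t. ((c2 t - c t) * (lam k)\<^sup>2) *\<^sub>R P k (v t))"
    define g where "g = (\<lambda>k t. K * d k t + 2 * norm (P k (u' t - v' t)) * norm (f k t))"
    have cb: "\<nu> \<le> c s" "c s \<le> M" if "s \<in> {0..T}" for s
      using m(2,3)[OF summable_sg(2)[OF Bu[OF that]]] c(1)[OF that] by auto
    note cL = coefficient_Lipschitz[OF u T Bu m(1) pos(2) c(1)]
    have sub: "{0..t} \<subseteq> {0..T}" using t by auto
    have dk: "dini_le (d k) (g k) 0 t" for k
      unfolding d_def g_def f_def K_def
      using component_solution_diff[OF u v, of _ k] cL cb t pos B0
      by (intro energy_dini) auto
    have cd: "continuous_on {0..t} (d k)" for k
      unfolding d_def P_diff
      by (intro continuous_intros continuous_on_subset[OF component_solution_continuous(1)[OF u]]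
        continuous_on_subset[OF component_solution_continuous(2)[OF u]]
        continuous_on_subset[OF component_solution_continuous(1)[OF v]]
        continuous_on_subset[OF component_solution_continuous(2)[OF v]]
        continuous_on_subset[OF continuous_on_Lipschitz_bound[OF cL] sub]) auto
    have eq: "m1 * ew k s \<le> d k s" "d k s \<le> M1 * ew k s" if "s \<in> {0..T}" for k s
      using energy_equivalence[OF cb[OF that] pos(1)] by (auto simp: m1_def M1_def ew_def d_def)
    have "(\<Sum>k<n. w k * d k t) \<le> exp (K * (t - 0)) * (\<Sum>k<n. w k * d k 0) + (4 * \<Lambda> * B * X) / (\<kappa> - K) * exp (\<kappa> * (t - 0))"
    proof (rule dini_Gronwall)
      show "dini_le (\<lambda>t. \<Sum>k<n. w k * d k t) (\<lambda>t. \<Sum>k<n. w k * g k t) 0 t"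
        using dk w0 by (intro dini_le_sum) auto
      show "continuous_on {0..t} (\<lambda>t. \<Sum>k<n. w k * d k t)" by (intro continuous_intros cd)
      show "0 \<le> t" using t by simp
      show "K < \<kappa>" by (rule \<kappa>K(1))
      show "0 \<le> 4 * \<Lambda> * B * X" using pos B0 X0 by simp
      fix s assume "0 \<le> s" "s < t"
      then have s: "s \<in> {0..T}" using t by auto
      let ?Y = "X * exp (\<kappa> * s)"
      \<comment> \<open>Because \<open>w lam^2 \<le> 1 + lam\<close>, the derivative lost in the
        forcing term falls on \<open>v\<close>, whose stronger norm is bounded by
        \<open>B\<close>.\<close>
      have forc: "(\<Sum>k<n. w k * (norm (P k (u' s - v' s)) * ((lam k)\<^sup>2 * norm (P k (v s))))) \<le> sqrt ?Y * sqrt B"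
      proof -
        let ?x = "\<lambda>k. sqrt (w k) * norm (P k (u' s - v' s))"
        let ?y = "\<lambda>k. sqrt (w k) * ((lam k)\<^sup>2 * norm (P k (v s)))"
        have "(\<Sum>k<n. w k * (norm (P k (u' s - v' s)) * ((lam k)\<^sup>2 * norm (P k (v s))))) = (\<Sum>k<n. \<bar>?x k\<bar> * \<bar>?y k\<bar>)"
        proof (rule sum.cong[OF refl])
          fix k
          have "sqrt (w k) * sqrt (w k) = w k" using w(1)[of k] by simp
          moreover have "\<bar>?x k\<bar> * \<bar>?y k\<bar> = ?x k * ?y k" using w0[of k] by simp
          moreover have "?x k * ?y k = (sqrt (w k) * sqrt (w k)) * (norm (P k (u' s - v' s)) * ((lam k)\<^sup>2 * norm (P k (v s))))"
            by (simp only: mult_ac)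
          ultimately show "w k * (norm (P k (u' s - v' s)) * ((lam k)\<^sup>2 * norm (P k (v s)))) = \<bar>?x k\<bar> * \<bar>?y k\<bar>"
            by simp
        qed
        also have "\<dots> \<le> sqrt ?Y * sqrt B"
        proof (rule sum_mult_le_sqrt)
          have "(?x k)\<^sup>2 \<le> w k * ew k s" for k
            using w(1)[of k] norm_P_snd_le_en[of k "u' s - v' s" "u s - v s"]
            by (simp add: power_mult_distrib ew_def)
          then show "(\<Sum>k<n. (?x k)\<^sup>2) \<le> ?Y" by (intro order_trans[OF sum_mono X[OF s]])
          have "(?y k)\<^sup>2 \<le> (1 + lam k) * en k (v s) (v' s)" for k
          proof -
            have l: "(lam k)\<^sup>2 \<le> (1 + lam k) * (1 + lam k)"
              using lam_nonneg[of k] by (simp add: power2_eq_square algebra_simps)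
            have "w k * (lam k)\<^sup>2 \<le> w k * ((1 + lam k) * (1 + lam k))" using w(1)[of k] l by (intro mult_left_mono) auto
            also have "\<dots> = 1 + lam k" using lam_nonneg[of k] by (simp add: w_def)
            finally have "w k * (lam k)\<^sup>2 * ((lam k)\<^sup>2 * (norm (P k (v s)))\<^sup>2) \<le> (1 + lam k) * en k (v s) (v' s)"
              using lam_sq_le_en[of k "v s" "v' s"] lam_nonneg[of k] by (intro mult_mono) auto
            moreover have "(?y k)\<^sup>2 = w k * (lam k)\<^sup>2 * ((lam k)\<^sup>2 * (norm (P k (v s)))\<^sup>2)"
              using w(1)[of k] by (simp add: power_mult_distrib power2_eq_square)
            ultimately show ?thesis by simp
          qed
          then show "(\<Sum>k<n. (?y k)\<^sup>2) \<le> B" by (intro order_trans[OF sum_mono Bv[OF s]])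
        qed
        finally show ?thesis .
      qed
      have "(\<Sum>k<n. w k * g k s) = K * (\<Sum>k<n. w k * d k s) + 2 * \<bar>c2 s - c s\<bar> *
          (\<Sum>k<n. w k * (norm (P k (u' s - v' s)) * ((lam k)\<^sup>2 * norm (P k (v s)))))"
        by (simp add: g_def f_def distrib_left sum.distrib sum_distrib_left abs_mult mult_ac)
      also have "\<dots> \<le> K * (\<Sum>k<n. w k * d k s) + 2 * (\<Lambda> * (sqrt ?Y * sqrt (4 * B))) * (sqrt ?Y * sqrt B)"
        using dc[OF s] forc pos w0 Y0 B0 X0
        by (intro add_left_mono mult_mono mult_left_mono) (auto intro!: sum_nonneg mult_nonneg_nonneg)
      also have "2 * (\<Lambda> * (sqrt ?Y * sqrt (4 * B))) * (sqrt ?Y * sqrt B) = 4 * \<Lambda> * B * X * exp (\<kappa> * s)"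
      proof -
        have "sqrt ?Y * sqrt ?Y = ?Y" "sqrt B * sqrt B = B" using Y0[of s] B0 by simp_all
        moreover have "sqrt (4 * B) = 2 * sqrt B" by (simp add: real_sqrt_mult)
        moreover have "2 * (\<Lambda> * (y * (2 * b))) * (y * b) = 4 * \<Lambda> * (b * b) * (y * y)" for y b :: real
          by (simp add: algebra_simps)
        ultimately show ?thesis by (metis mult.assoc)
      qed
      finally show "(\<Sum>k<n. w k * g k s) \<le> K * (\<Sum>k<n. w k * d k s) + 4 * \<Lambda> * B * X * exp (\<kappa> * (s - 0))" by simp
    qed
    also have "\<dots> \<le> exp (\<kappa> * t) * (M1 * W0) + (4 * \<Lambda> * B * X) / (\<kappa> - K) * exp (\<kappa> * t)"
    proof -
      have "(\<Sum>k<n. w k * d k 0) \<le> (\<Sum>k<n. M1 * (w k * ew k 0))"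
        unfolding mult.left_commute[of M1] using eq(2)[of 0] w0 T by (intro sum_mono mult_left_mono) auto
      also have "\<dots> = M1 * (\<Sum>k<n. w k * ew k 0)" by (simp add: sum_distrib_left)
      also have "\<dots> \<le> M1 * W0"
        using W0[of n] M1 by (intro mult_left_mono) (auto simp: w_def ew_def)
      finally have 1: "(\<Sum>k<n. w k * d k 0) \<le> M1 * W0" .
      have "0 \<le> (\<Sum>k<n. w k * d k 0)"
      proof (intro sum_nonneg mult_nonneg_nonneg w0)
        show "0 \<le> d k 0" for k using eq(1)[of 0 k] T m1 ew0[of k 0]
          by (auto intro: order_trans[of 0 "m1 * ew k 0"])
      qed
      moreover have "exp (K * t) \<le> exp (\<kappa> * t)" using \<kappa>K t by (auto intro: mult_right_mono)
      ultimately show ?thesis using 1 unfolding diff_0_right by (intro add_right_mono mult_mono) simp_all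
    qed
    finally have "(\<Sum>k<n. w k * d k t) \<le> exp (\<kappa> * t) * (M1 * W0) + (4 * \<Lambda> * B * X) / (\<kappa> - K) * exp (\<kappa> * t)" .
    moreover have "m1 * (\<Sum>k<n. w k * ew k t) \<le> (\<Sum>k<n. w k * d k t)"
      unfolding sum_distrib_left mult.left_commute[of m1] using eq(1)[OF t] w0
      by (intro sum_mono mult_left_mono) auto
    ultimately have "m1 * (\<Sum>k<n. w k * ew k t) \<le> exp (\<kappa> * t) * (M1 * W0) + (4 * \<Lambda> * B * X) / (\<kappa> - K) * exp (\<kappa> * t)"
      by linarith
    then have "(\<Sum>k<n. w k * ew k t) \<le> (exp (\<kappa> * t) * (M1 * W0) + (4 * \<Lambda> * B * X) / (\<kappa> - K) * exp (\<kappa> * t)) / m1"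
      using m1 by (simp add: pos_le_divide_eq mult.commute)
    also have "\<dots> = (M1 / m1 * W0 + (4 * \<Lambda> * B / (m1 * (\<kappa> - K))) * X) * exp (\<kappa> * t)"
    proof -
      define r where "r = \<kappa> - K"
      have "r \<noteq> 0" using \<kappa>K(1) by (simp add: r_def)
      then show ?thesis unfolding r_def[symmetric] using m1 by (simp add: field_simps)
    qed
    also have "\<dots> \<le> (M1 / m1 * W0 + (1/2) * X) * exp (\<kappa> * t)"
      using \<kappa>K(2) X0 by (intro mult_right_mono add_left_mono) auto
    finally show ?thesis by simp
  qed
  have "X \<le> M1 / m1 * W0 + X / 2"
    unfolding X_def
  proof (rule cSUP_least)
    show "I \<noteq> {}" using T by (auto simp: I_def)
    fix p assume "p \<in> I"
    then obtain t n where p: "p = (t, n)" "t \<in> {0..T}" by (auto simp: I_def)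
    show "(case p of (t, n) \<Rightarrow> exp (- \<kappa> * t) * (\<Sum>k<n. w k * ew k t)) \<le>
        M1 / m1 * W0 + (SUP (t, n)\<in>I. exp (- \<kappa> * t) * (\<Sum>k<n. w k * ew k t)) / 2"
      using main[OF p(2), of n] unfolding X_def[symmetric] p(1) by (simp add: exp_minus field_simps)
  qed
  then have X2: "X \<le> 2 * (M1 / m1) * W0" by simp
  have W00: "0 \<le> W0" using W0[of 0] by simp
  have "(\<Sum>k<n. en k (u t - v t) (u' t - v' t) / (1 + lam k)) \<le> X * exp (\<kappa> * t)"
    using X[OF t, of n] by (simp add: w_def ew_def)
  also have "\<dots> \<le> (2 * (M1 / m1) * W0) * exp (\<kappa> * T)"
    using X2 t \<kappa>0 W00 m1 M1 by (intro mult_mono) (auto intro: mult_left_mono)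
  finally show ?thesis by (simp add: M1_def m1_def \<kappa>_def K_def mult_ac)
qed

end

section \<open>Truncated equations\<close>

lemma norm_increment_le:
  fixes F :: "real \<Rightarrow> 'a::real_normed_vector"
  assumes F: "\<And>t. 0 \<le> t \<Longrightarrow> (F has_vector_derivative f t) (at t within {0..})"
    and \<phi>: "\<And>t. (\<phi> has_vector_derivative \<phi>' t) (at t)"
    and le: "\<And>t. 0 \<le> t \<Longrightarrow> norm (f t) \<le> \<phi>' t" and t: "0 \<le> t"
  shows "norm (F t - F 0) \<le> \<phi> t - \<phi> 0"
proof (cases "t = 0")
  case False
  show ?thesis
  proof (rule differentiable_bound_general)
    show "0 < t" using t False by simp
    show "continuous_on {0..t} F"
      by (rule continuous_on_subset[OF continuous_on_vector_derivative_within[OF F]]) auto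
    show "continuous_on {0..t} \<phi>"
      by (intro continuous_at_imp_continuous_on ballI has_vector_derivative_continuous[OF \<phi>])
    fix x assume "0 < x" "x < t"
    then show "(F has_vector_derivative f x) (at x)"
      using F[of x] at_within_interior[of x "{0..}"] by (simp add: interior_real_atLeast)
    show "norm (f x) \<le> \<phi>' x" using le \<open>0 < x\<close> by simp
  qed (rule \<phi>)
qed simp

text \<open>The integral equation is solved for \<open>exp (- k t) x t\<close> among bounded
  continuous functions. The exponential weight makes the Picard map a contraction on the whole
  half-line at once, which replaces continuation of local solutions.\<close>

lemma global_Picard:
  fixes F :: "'b::{real_inner,complete_space} \<Rightarrow> 'b"
  assumes lip: "\<And>x y. norm (F x - F y) \<le> K * norm (x - y)"
  obtains x where "x 0 = x0" "\<And>t. 0 \<le> t \<Longrightarrow> (x has_vector_derivative F (x t)) (at t within {0..})"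
proof -
  \<comment> \<open>Gives the contraction factor \<open>|K| / k \<le> 1/2\<close>; the summand 1
    keeps \<open>k\<close> positive when \<open>K = 0\<close>.\<close>
  define k where "k = 2 * \<bar>K\<bar> + 1"
  have k: "k > 0" "\<bar>K\<bar> / k \<le> 1/2" by (auto simp: k_def field_simps)
  have lip': "norm (F x - F y) \<le> \<bar>K\<bar> * norm (x - y)" for x y
    by (rule order_trans[OF lip]) (intro mult_right_mono, auto)
  have contF: "continuous_on UNIV F"
    by (rule lipschitz_on_continuous_on[of "\<bar>K\<bar>"]) (auto intro!: lipschitz_onI simp: dist_norm lip')
  define rhs where "rhs = (\<lambda>(y :: real \<Rightarrow>\<^sub>C 'b) s. F (exp (k * s) *\<^sub>R y s))"
  have contr: "continuous_on {0..} (rhs y)" for y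
    unfolding rhs_def
    by (rule continuous_on_compose2[OF contF]) (auto intro!: continuous_intros)
  have "\<exists>I. I 0 = 0 \<and> (\<forall>t\<ge>0. (I has_vector_derivative rhs y t) (at t within {0..}))" for y
    using antiderivative_exists[OF contr[of y]] by metis
  then obtain I where I: "\<And>y. I y 0 = 0"
    "\<And>y t. 0 \<le> t \<Longrightarrow> (I y has_vector_derivative rhs y t) (at t within {0..})" by metis
  \<comment> \<open>\<open>max 0 t\<close> extends functions constantly to negative times, since
    \<open>bcontfun\<close> lives on the whole line.\<close>
  define \<Phi> where "\<Phi> = (\<lambda>y t. exp (- k * max 0 t) *\<^sub>R (x0 + I y (max 0 t)))"
  have d\<phi>: "((\<lambda>t. C / k * exp (k * t) + D * t) has_vector_derivative C * exp (k * t) + D) (at t)" for C D t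
    unfolding has_real_derivative_iff_has_vector_derivative[symmetric]
    using k(1) by (auto intro!: derivative_eq_intros)
  have \<Phi>: "\<Phi> y \<in> bcontfun" for y
  proof (rule bcontfun_normI)
    have "continuous_on UNIV (\<lambda>t. I y (max 0 t))"
      by (rule continuous_on_compose2[OF continuous_on_vector_derivative_within[OF I(2)]])
         (auto intro!: continuous_intros)
    then show "continuous_on UNIV (\<Phi> y)" unfolding \<Phi>_def by (intro continuous_intros)
    fix t :: real
    define s where "s = max 0 t"
    have s: "0 \<le> s" by (simp add: s_def)
    define N where "N = norm y"
    have "norm (rhs y r) \<le> (\<bar>K\<bar> * N + norm (F 0)) * exp (k * r) + 0" if "0 \<le> r" for r
    proof -
      have "norm (rhs y r) \<le> norm (F 0) + norm (F (exp (k * r) *\<^sub>R y r) - F 0)"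
        unfolding rhs_def by (rule norm_triangle_sub)
      also have "norm (F (exp (k * r) *\<^sub>R y r) - F 0) \<le> \<bar>K\<bar> * (exp (k * r) * N)"
        using norm_bounded[of y r] by (intro order_trans[OF lip'] mult_left_mono) (auto simp: N_def)
      also have "norm (F 0) \<le> norm (F 0) * exp (k * r)"
        using that k by (simp add: mult_le_cancel_left1)
      finally show ?thesis by (simp add: algebra_simps)
    qed
    from norm_increment_le[OF I(2) d\<phi> this s]
    have "norm (I y s) \<le> (\<bar>K\<bar> * N + norm (F 0)) / k * exp (k * s) - (\<bar>K\<bar> * N + norm (F 0)) / k"
      by (simp add: I(1))
    moreover have "0 \<le> (\<bar>K\<bar> * N + norm (F 0)) / k" using k by (simp add: N_def)
    ultimately have "norm (I y s) \<le> (\<bar>K\<bar> * N + norm (F 0)) / k * exp (k * s)" by linarith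
    then have "norm (x0 + I y s) \<le> norm x0 * 1 + (\<bar>K\<bar> * N + norm (F 0)) / k * exp (k * s)"
      using norm_triangle_ineq[of x0 "I y s"] by linarith
    also have "\<dots> \<le> norm x0 * exp (k * s) + (\<bar>K\<bar> * N + norm (F 0)) / k * exp (k * s)"
      using s k by (intro add_right_mono mult_left_mono) auto
    finally have "exp (- k * s) * norm (x0 + I y s) \<le> exp (- k * s) * ((norm x0 + (\<bar>K\<bar> * N + norm (F 0)) / k) * exp (k * s))"
      by (intro mult_left_mono) (auto simp: algebra_simps)
    also have "\<dots> = norm x0 + (\<bar>K\<bar> * N + norm (F 0)) / k"
      by (simp add: exp_minus field_simps)
    finally show "norm (\<Phi> y t) \<le> norm x0 + (\<bar>K\<bar> * N + norm (F 0)) / k"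
      by (simp add: \<Phi>_def s_def)
  qed
  have "\<exists>!y. Bcontfun (\<Phi> y) = y"
  proof (rule banach_fix_type[of "1/2"]; (intro allI)?)
    fix y z :: "real \<Rightarrow>\<^sub>C 'b"
    show "dist (Bcontfun (\<Phi> y)) (Bcontfun (\<Phi> z)) \<le> 1/2 * dist y z"
    proof (rule dist_bound)
      fix t :: real
      define s where "s = max 0 t"
      have s: "0 \<le> s" by (simp add: s_def)
      have der: "((\<lambda>t. I y t - I z t) has_vector_derivative rhs y t - rhs z t) (at t within {0..})" if "0 \<le> t" for t
        by (intro has_vector_derivative_diff I(2) that)
      have le: "norm (rhs y r - rhs z r) \<le> (\<bar>K\<bar> * dist y z) * exp (k * r) + 0" for r
      proof -
        have "norm (rhs y r - rhs z r) \<le> \<bar>K\<bar> * norm (exp (k * r) *\<^sub>R (y r - z r))"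
          unfolding rhs_def scaleR_diff_right by (rule lip')
        also have "\<dots> \<le> \<bar>K\<bar> * (exp (k * r) * dist y z)"
          using dist_bounded[of y r z] by (intro mult_left_mono) (auto simp: dist_norm)
        finally show ?thesis by (simp add: mult_ac)
      qed
      from norm_increment_le[OF der d\<phi> le s]
      have "norm (I y s - I z s) \<le> (\<bar>K\<bar> * dist y z) / k * exp (k * s) - (\<bar>K\<bar> * dist y z) / k"
        by (simp add: I(1))
      also have "\<dots> \<le> (\<bar>K\<bar> / k) * dist y z * exp (k * s)"
        using k by simp
      also have "\<dots> \<le> 1/2 * dist y z * exp (k * s)" using k(2) by (intro mult_right_mono) auto
      finally have "exp (- k * s) * norm (I y s - I z s) \<le> exp (- k * s) * (1/2 * dist y z * exp (k * s))"
        by (intro mult_left_mono) auto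
      also have "\<dots> = 1/2 * dist y z" by (simp add: exp_minus field_simps)
      finally have "exp (- k * s) * norm (I y s - I z s) \<le> 1/2 * dist y z" .
      moreover have "\<Phi> y t - \<Phi> z t = exp (- k * s) *\<^sub>R (I y s - I z s)"
        by (simp add: \<Phi>_def s_def scaleR_diff_right[symmetric])
      ultimately show "dist (Bcontfun (\<Phi> y) t) (Bcontfun (\<Phi> z) t) \<le> 1/2 * dist y z"
        by (simp add: Bcontfun_inverse \<Phi> dist_norm)
    qed
  qed auto
  then obtain y where "Bcontfun (\<Phi> y) = y" by auto
  then have y: "apply_bcontfun y = \<Phi> y" using Bcontfun_inverse[OF \<Phi>[of y]] by simp
  define x where "x = (\<lambda>t. x0 + I y t)"
  have xy: "exp (k * t) *\<^sub>R y t = x t" if "0 \<le> t" for t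
    using that by (simp add: y \<Phi>_def x_def exp_minus)
  have "(x has_vector_derivative F (x t)) (at t within {0..})" if "0 \<le> t" for t
  proof -
    have "rhs y t = F (x t)" using xy[OF that] by (simp add: rhs_def)
    then show ?thesis
      unfolding x_def[abs_def] using has_vector_derivative_add[OF has_vector_derivative_const I(2)[OF that], of x0 y]
      by (simp add: x_def)
  qed
  then show thesis using that[of x] by (simp add: x_def I(1))
qed

section \<open>Systems with finitely many modes and their Hamiltonian\<close>

context wave_frame
begin

definition truncated :: "nat \<Rightarrow> 'a \<Rightarrow> bool" where
  "truncated N x \<longleftrightarrow> (\<forall>k\<ge>N. P k x = 0)"

lemma norm_mop_truncated:
  assumes "truncated N x"
  shows "(norm x)\<^sup>2 = (\<Sum>k<N. (norm (P k x))\<^sup>2)" "sg x = (\<Sum>k<N. (lam k)\<^sup>2 * (norm (P k x))\<^sup>2)"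
proof -
  have "(\<lambda>k. (norm (P k x))\<^sup>2) sums (\<Sum>k<N. (norm (P k x))\<^sup>2)"
    using assms by (intro sums_finite) (auto simp: truncated_def)
  then show "(norm x)\<^sup>2 = (\<Sum>k<N. (norm (P k x))\<^sup>2)" using norm_sums sums_unique2 by blast
  show "sg x = (\<Sum>k<N. (lam k)\<^sup>2 * (norm (P k x))\<^sup>2)"
    unfolding sg_def using assms by (intro suminf_finite) (auto simp: truncated_def)
qed

text \<open>The square root of A cut off after \<open>N\<close> modes. It is bounded on all of
  \<open>H\<close>, so the truncated system is an ordinary differential equation there, even when
  eigenspaces have infinite dimension.\<close>

definition trunc_sqrt :: "nat \<Rightarrow> 'a \<Rightarrow> 'a" where
  "trunc_sqrt N = mop (\<lambda>k. if k < N then lam k else 0)"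

lemma trunc_sqrt:
  shows "bounded_linear (trunc_sqrt N)" "norm (trunc_sqrt N x) \<le> (\<Sum>k<N. lam k) * norm x"
    "P k (trunc_sqrt N x) = (if k < N then lam k else 0) *\<^sub>R P k x"
    "inner (trunc_sqrt N x) y = inner x (trunc_sqrt N y)"
proof -
  have b: "\<bar>if k < N then lam k else 0\<bar> \<le> (\<Sum>k<N. lam k)" for k
    using lam_nonneg by (auto intro!: member_le_sum sum_nonneg)
  note dom = bounded_mop(1)[of "\<lambda>k. if k < N then lam k else 0", OF b]
  show "bounded_linear (trunc_sqrt N)" unfolding trunc_sqrt_def by (rule bounded_mop(3)[OF b])
  show "norm (trunc_sqrt N x) \<le> (\<Sum>k<N. lam k) * norm x" unfolding trunc_sqrt_def by (rule bounded_mop(2)[OF b])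
  show "P k (trunc_sqrt N x) = (if k < N then lam k else 0) *\<^sub>R P k x" unfolding trunc_sqrt_def by (rule P_mop[OF dom])
  show "inner (trunc_sqrt N x) y = inner x (trunc_sqrt N y)"
    unfolding trunc_sqrt_def
    using sums_unique2[OF inner_mop[OF dom, of x y]] inner_mop[OF dom, of y x] by (simp add: inner_commute)
qed

lemma truncated_sqrt_sq:
  assumes "truncated N x"
  shows "(norm (trunc_sqrt N x))\<^sup>2 = sg x" "trunc_sqrt N (trunc_sqrt N x) = mop (\<lambda>k. (lam k)\<^sup>2) x"
proof -
  have "truncated N (trunc_sqrt N x)" by (simp add: truncated_def trunc_sqrt)
  then show "(norm (trunc_sqrt N x))\<^sup>2 = sg x"
    using norm_mop_truncated(1) norm_mop_truncated(2)[OF assms]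
    by (simp add: trunc_sqrt power_mult_distrib)
  show "trunc_sqrt N (trunc_sqrt N x) = mop (\<lambda>k. (lam k)\<^sup>2) x"
    by (rule mop_eqI(2)[symmetric]) (use assms in \<open>auto simp: trunc_sqrt truncated_def power2_eq_square\<close>)
qed

text \<open>Since \<open>m\<close> is constant beyond \<open>R\<close>, the change of
  \<open>m\<close> matters only while the smaller of \<open>|B x|\<close> and \<open>|B y|\<close>
  is below \<open>sqrt R\<close>. If that is \<open>|B y|\<close>, then \<open>B B y\<close> is
  bounded, so the Lipschitz constant does not grow with the vectors.\<close>

lemma truncated_rhs_Lipschitz:
  assumes m: "\<And>s t. \<bar>m s - m t\<bar> \<le> \<Lambda> * \<bar>s - t\<bar>" "\<And>s. 0 \<le> m s" "\<And>s. m s \<le> M" "\<And>s. R \<le> s \<Longrightarrow> m s = m R"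
    and pos: "0 \<le> \<Lambda>" "0 \<le> R"
  obtains K where "\<And>x y. norm (m ((norm (trunc_sqrt N x))\<^sup>2) *\<^sub>R trunc_sqrt N (trunc_sqrt N x)
      - m ((norm (trunc_sqrt N y))\<^sup>2) *\<^sub>R trunc_sqrt N (trunc_sqrt N y)) \<le> K * norm (x - y)"
proof -
  define q where "q = (\<Sum>k<N. lam k)"
  let ?B = "trunc_sqrt N"
  let ?f = "\<lambda>x. m ((norm (?B x))\<^sup>2)"
  interpret B: bounded_linear ?B by (rule trunc_sqrt(1))
  have q: "0 \<le> q" using lam_nonneg by (simp add: q_def sum_nonneg)
  have Bq: "norm (?B x) \<le> q * norm x" for x using trunc_sqrt(2) by (simp add: q_def)
  have M0: "0 \<le> M" using m(2,3) order_trans by blast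
  have one: "norm (?f x *\<^sub>R ?B (?B x) - ?f y *\<^sub>R ?B (?B y)) \<le> (M * q * q + 2 * \<Lambda> * R * q * q) * norm (x - y)"
    if le: "norm (?B y) \<le> norm (?B x)" for x y
  proof -
    have "norm (?B (?B (x - y))) \<le> q * (q * norm (x - y))"
      using Bq[of "?B (x - y)"] Bq[of "x - y"] q by (meson mult_left_mono order_trans)
    then have 1: "norm (?f x *\<^sub>R ?B (?B (x - y))) \<le> M * (q * (q * norm (x - y)))"
      unfolding norm_scaleR using m(2,3) M0 by (intro mult_mono) auto
    have 2: "norm ((?f x - ?f y) *\<^sub>R ?B (?B y)) \<le> 2 * \<Lambda> * R * q * q * norm (x - y)"
    proof (cases "R \<le> (norm (?B y))\<^sup>2")
      case True
      moreover have "(norm (?B y))\<^sup>2 \<le> (norm (?B x))\<^sup>2" using le by (intro power_mono) auto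
      ultimately have "?f x = ?f y" using m(4) by (metis order_trans)
      then show ?thesis using pos q by simp
    next
      case False
      \<comment> \<open>Truncating \<open>|B x|\<close> at \<open>sqrt R\<close> does not change the
        value of \<open>m\<close>, and it bounds the factor \<open>a + b\<close> by
        \<open>2 sqrt R\<close>.\<close>
      define a where "a = min (norm (?B x)) (sqrt R)"
      define b where "b = norm (?B y)"
      have b: "0 \<le> b" "b \<le> sqrt R" "b \<le> a"
        using False le by (auto simp: a_def b_def real_le_rsqrt)
      have ax: "?f x = m (a\<^sup>2)"
      proof (cases "norm (?B x) \<le> sqrt R")
        case True
        then show ?thesis by (simp add: a_def min_absorb1)
      next
        case False
        then have "R \<le> (norm (?B x))\<^sup>2" using sqrt_le_D by fastforce
        then have "?f x = m R" by (rule m(4))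
        moreover have "a\<^sup>2 = R" using False pos by (simp add: a_def min_absorb2)
        ultimately show ?thesis by simp
      qed
      have "\<bar>?f x - ?f y\<bar> \<le> \<Lambda> * \<bar>a\<^sup>2 - b\<^sup>2\<bar>" using m(1)[of "a\<^sup>2" "b\<^sup>2"] ax by (simp add: b_def)
      also have "\<bar>a\<^sup>2 - b\<^sup>2\<bar> = (a - b) * (a + b)"
      proof -
        have "a\<^sup>2 - b\<^sup>2 = (a - b) * (a + b)" by (simp add: power2_eq_square algebra_simps)
        then show ?thesis using b by simp
      qed
      also have "\<dots> \<le> (q * norm (x - y)) * (2 * sqrt R)"
      proof (intro mult_mono)
        have "a - b \<le> norm (?B x) - norm (?B y)" by (simp add: a_def b_def)
        also have "\<dots> \<le> norm (?B (x - y))" by (simp add: B.diff norm_triangle_ineq2)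
        finally show "a - b \<le> q * norm (x - y)" using Bq by (rule order_trans)
        show "a + b \<le> 2 * sqrt R" using b by (auto simp: a_def)
      qed (use b q in auto)
      finally have f: "\<bar>?f x - ?f y\<bar> \<le> \<Lambda> * ((q * norm (x - y)) * (2 * sqrt R))"
        using pos by (simp add: mult_left_mono)
      have "norm (?B (?B y)) \<le> q * sqrt R"
        by (rule order_trans[OF Bq]) (use b q in \<open>auto simp: b_def intro!: mult_left_mono\<close>)
      with f have "\<bar>?f x - ?f y\<bar> * norm (?B (?B y)) \<le> (\<Lambda> * ((q * norm (x - y)) * (2 * sqrt R))) * (q * sqrt R)"
        using pos q by (intro mult_mono) auto
      also have "\<dots> = 2 * \<Lambda> * (sqrt R * sqrt R) * q * q * norm (x - y)" by (simp only: mult_ac)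
      also have "sqrt R * sqrt R = R" using pos by simp
      finally show ?thesis by simp
    qed
    have "?f x *\<^sub>R ?B (?B x) - ?f y *\<^sub>R ?B (?B y) = ?f x *\<^sub>R ?B (?B (x - y)) + (?f x - ?f y) *\<^sub>R ?B (?B y)"
      by (simp add: B.diff algebra_simps)
    then have "norm (?f x *\<^sub>R ?B (?B x) - ?f y *\<^sub>R ?B (?B y)) \<le> M * (q * (q * norm (x - y))) + 2 * \<Lambda> * R * q * q * norm (x - y)"
      using 1 2 norm_triangle_mono by metis
    then show ?thesis by (simp add: algebra_simps)
  qed
  have "norm (?f x *\<^sub>R ?B (?B x) - ?f y *\<^sub>R ?B (?B y)) \<le> (M * q * q + 2 * \<Lambda> * R * q * q) * norm (x - y)" for x y
    using one[of y x] one[of x y] by (cases "norm (?B y) \<le> norm (?B x)") (auto simp: norm_minus_commute)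
  then show thesis using that by blast
qed

lemma truncated_solution_exists:
  assumes m: "\<And>s t. \<bar>m s - m t\<bar> \<le> \<Lambda> * \<bar>s - t\<bar>" "\<And>s. 0 \<le> m s" "\<And>s. m s \<le> M" "\<And>s. R \<le> s \<Longrightarrow> m s = m R"
    and pos: "0 \<le> \<Lambda>" "0 \<le> R" and init: "truncated N u0" "truncated N u1"
  obtains u u' where "u 0 = u0" "u' 0 = u1"
    "\<And>t. 0 \<le> t \<Longrightarrow> truncated N (u t)" "\<And>t. 0 \<le> t \<Longrightarrow> truncated N (u' t)"
    "\<And>t. 0 \<le> t \<Longrightarrow> (u has_vector_derivative u' t) (at t within {0..})"
    "\<And>t. 0 \<le> t \<Longrightarrow> (u' has_vector_derivative - (m (sg (u t))) *\<^sub>R mop (\<lambda>k. (lam k)\<^sup>2) (u t)) (at t within {0..})"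
proof -
  let ?B = "trunc_sqrt N"
  define G where "G = (\<lambda>x. m ((norm (?B x))\<^sup>2) *\<^sub>R ?B (?B x))"
  obtain K where K: "\<And>x y. norm (G x - G y) \<le> K * norm (x - y)"
    using truncated_rhs_Lipschitz[OF m pos, of N] unfolding G_def by blast
  define F where "F = (\<lambda>p :: 'a \<times> 'a. (snd p, - G (fst p)))"
  have "norm (F p - F p') \<le> (1 + \<bar>K\<bar>) * norm (p - p')" for p p'
  proof -
    have "F p - F p' = (snd (p - p'), - (G (fst p) - G (fst p')))" by (simp add: F_def)
    then have "norm (F p - F p') \<le> norm (snd (p - p')) + norm (G (fst p) - G (fst p'))"
      using norm_Pair_le[of "snd (p - p')" "- (G (fst p) - G (fst p'))"] by (simp only: norm_minus_cancel)
    also have "norm (G (fst p) - G (fst p')) \<le> \<bar>K\<bar> * norm (fst (p - p'))"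
      unfolding fst_diff by (rule order_trans[OF K]) (intro mult_right_mono, auto)
    also have "norm (snd (p - p')) \<le> norm (p - p')" by (metis norm_snd_le prod.collapse)
    also have "\<bar>K\<bar> * norm (fst (p - p')) \<le> \<bar>K\<bar> * norm (p - p')" by (intro mult_left_mono) (metis norm_fst_le prod.collapse, simp)
    finally show ?thesis by (simp add: algebra_simps)
  qed
  then obtain p where p: "p 0 = (u0, u1)" "\<And>t. 0 \<le> t \<Longrightarrow> (p has_vector_derivative F (p t)) (at t within {0..})"
    using global_Picard by blast
  define u where "u = (\<lambda>t. fst (p t))"
  define u' where "u' = (\<lambda>t. snd (p t))"
  have du: "(u has_vector_derivative u' t) (at t within {0..})" if "0 \<le> t" for t
    using bounded_linear.has_vector_derivative[OF bounded_linear_fst p(2)[OF that]]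
    by (simp add: u_def u'_def F_def)
  have du': "(u' has_vector_derivative - G (u t)) (at t within {0..})" if "0 \<le> t" for t
    using bounded_linear.has_vector_derivative[OF bounded_linear_snd p(2)[OF that]]
    by (simp add: u_def u'_def F_def)
  \<comment> \<open>On the modes from \<open>N\<close> on the right-hand side vanishes, so their
    zero data persist.\<close>
  have tr': "truncated N (u' t)" if t: "0 \<le> t" for t
    unfolding truncated_def
  proof (intro allI impI)
    fix k assume k: "N \<le> k"
    have "((\<lambda>s. P k (u' s)) has_vector_derivative 0) (at s within {0..})" if "0 \<le> s" for s
      using bounded_linear.has_vector_derivative[OF P_bl du'[OF that], of k] k
      by (simp add: G_def P_minus P_scaleR trunc_sqrt)
    from zero_derivative_constant[OF this t] show "P k (u' t) = 0"
      using init k by (simp add: u'_def p truncated_def)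
  qed
  have tr: "truncated N (u t)" if t: "0 \<le> t" for t
    unfolding truncated_def
  proof (intro allI impI)
    fix k assume k: "N \<le> k"
    have "((\<lambda>s. P k (u s)) has_vector_derivative 0) (at s within {0..})" if "0 \<le> s" for s
      using bounded_linear.has_vector_derivative[OF P_bl du[OF that], of k] k tr'[OF that]
      by (simp add: truncated_def)
    from zero_derivative_constant[OF this t] show "P k (u t) = 0"
      using init k by (simp add: u_def p truncated_def)
  qed
  have "- G (u t) = - (m (sg (u t))) *\<^sub>R mop (\<lambda>k. (lam k)\<^sup>2) (u t)" if "0 \<le> t" for t
    unfolding G_def by (simp add: truncated_sqrt_sq[OF tr[OF that]])
  then show thesis
    using that[of u u'] du du' tr tr' p(1) by (simp add: u_def u'_def)
qed

text \<open>With \<open>Mm\<close> an antiderivative of \<open>m\<close>,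
  \<open>|u'|^2 + Mm (sg u)\<close> is conserved. By the mean value theorem
  \<open>Mm s = m r * s\<close> with \<open>r\<close> between 0 and \<open>s\<close>, so an upper
  bound of \<open>m\<close> is used only up to the initial value of \<open>sg\<close>; clamping
  \<open>m\<close> beyond it does not affect the estimate.\<close>

lemma Hamiltonian_bound:
  assumes tr: "\<And>t. 0 \<le> t \<Longrightarrow> truncated N (u t)"
    and du: "\<And>t. 0 \<le> t \<Longrightarrow> (u has_vector_derivative u' t) (at t within {0..})"
    and du': "\<And>t. 0 \<le> t \<Longrightarrow> (u' has_vector_derivative - (m (sg (u t))) *\<^sub>R mop (\<lambda>k. (lam k)\<^sup>2) (u t)) (at t within {0..})"
    and m: "continuous_on {0..} m" "\<And>s. 0 \<le> s \<Longrightarrow> \<nu> \<le> m s" "\<And>s. 0 \<le> s \<Longrightarrow> s \<le> sg (u 0) \<Longrightarrow> m s \<le> M"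
    and t: "0 \<le> t"
  shows "(norm (u' t))\<^sup>2 + \<nu> * sg (u t) \<le> (norm (u' 0))\<^sup>2 + M * sg (u 0)"
proof -
  let ?B = "trunc_sqrt N"
  obtain Mm where Mm: "Mm 0 = 0" "\<And>s. 0 \<le> s \<Longrightarrow> (Mm has_vector_derivative m s) (at s within {0..})"
    using antiderivative_exists[OF m(1)] by metis
  have mvt: "\<exists>r. 0 \<le> r \<and> r \<le> s \<and> Mm s = m r * s" if "0 \<le> s" for s
  proof (cases "s = 0")
    case False
    have "(Mm has_derivative (\<lambda>h. h *\<^sub>R m x)) (at x within {0..s})" if "0 \<le> x" "x \<le> s" for x
      using Mm(2)[OF that(1)] unfolding has_vector_derivative_def by (rule has_derivative_subset) auto
    then have "\<exists>x\<in>{0<..<s}. Mm s - Mm 0 = (s - 0) *\<^sub>R m x"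
      using False \<open>0 \<le> s\<close> by (intro mvt_simple) auto
    then obtain x where "x \<in> {0<..<s}" "Mm s = m x * s" using Mm(1) by (auto simp: mult.commute)
    then show ?thesis by (intro exI[of _ x]) auto
  qed (use Mm(1) in auto)
  have sg0: "0 \<le> sg (u t)" if "0 \<le> t" for t
    unfolding truncated_sqrt_sq(1)[OF tr[OF that], symmetric] by simp
  define h where "h = (\<lambda>t. inner (u' t) (u' t) + Mm (inner (?B (u t)) (?B (u t))))"
  have hz: "h t = h 0"
  proof (rule zero_derivative_constant[OF _ t])
    fix s :: real assume s: "0 \<le> s"
    let ?v = "- (m (sg (u s))) *\<^sub>R mop (\<lambda>k. (lam k)\<^sup>2) (u s)"
    have 1: "((\<lambda>t. inner (u' t) (u' t)) has_vector_derivative (inner (u' s) ?v + inner ?v (u' s))) (at s within {0..})"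
      by (rule bounded_bilinear.has_vector_derivative[OF bounded_bilinear_inner du'[OF s] du'[OF s]])
    have dB: "((\<lambda>t. ?B (u t)) has_vector_derivative ?B (u' s)) (at s within {0..})"
      by (rule bounded_linear.has_vector_derivative[OF trunc_sqrt(1) du[OF s]])
    have 2: "((\<lambda>t. inner (?B (u t)) (?B (u t))) has_vector_derivative
        (inner (?B (u s)) (?B (u' s)) + inner (?B (u' s)) (?B (u s)))) (at s within {0..})"
      by (rule bounded_bilinear.has_vector_derivative[OF bounded_bilinear_inner dB dB])
    have sgs: "inner (?B (u s)) (?B (u s)) = sg (u s)"
      using truncated_sqrt_sq(1)[OF tr[OF s]] by (simp add: power2_norm_eq_inner)
    have "(Mm has_vector_derivative m (sg (u s))) (at (inner (?B (u s)) (?B (u s))) within (\<lambda>t. inner (?B (u t)) (?B (u t))) ` {0..})"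
      unfolding sgs by (rule has_vector_derivative_within_subset[OF Mm(2)[OF sg0[OF s]]]) auto
    from vector_diff_chain_within[OF 2 this]
    have "((\<lambda>t. Mm (inner (?B (u t)) (?B (u t)))) has_vector_derivative
      (inner (?B (u s)) (?B (u' s)) + inner (?B (u' s)) (?B (u s))) *\<^sub>R m (sg (u s))) (at s within {0..})"
      by (simp add: o_def)
    from has_vector_derivative_add[OF 1 this]
    show "(h has_vector_derivative 0) (at s within {0..})"
      unfolding h_def
      by (rule has_vector_derivative_eq_rhs)
         (simp add: trunc_sqrt(4)[of N "u' s"] truncated_sqrt_sq(2)[OF tr[OF s]] inner_commute[of "?B (u s)"]
            inner_commute[of "mop (\<lambda>k. (lam k)\<^sup>2) (u s)"] algebra_simps)
  qed
  have heq: "h t = (norm (u' t))\<^sup>2 + Mm (sg (u t))" if "0 \<le> t" for t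
    using truncated_sqrt_sq(1)[OF tr[OF that]] by (simp add: h_def power2_norm_eq_inner)
  obtain r where r: "0 \<le> r" "Mm (sg (u t)) = m r * sg (u t)" using mvt[OF sg0[OF t]] by blast
  obtain r' where r': "0 \<le> r'" "r' \<le> sg (u 0)" "Mm (sg (u 0)) = m r' * sg (u 0)" using mvt[OF sg0[of 0]] by auto
  have "\<nu> * sg (u t) \<le> Mm (sg (u t))" unfolding r(2) using m(2)[OF r(1)] sg0[OF t] by (intro mult_right_mono)
  moreover have "Mm (sg (u 0)) \<le> M * sg (u 0)" unfolding r'(3) using m(3)[OF r'(1,2)] sg0[of 0] by (intro mult_right_mono) auto
  ultimately show ?thesis using hz heq[OF t] heq[of 0] by simp
qed

end

section \<open>A priori estimates under the spectral gap condition\<close>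

text \<open>Here \<open>m\<close> stands for the clamped coefficient; its bounds hold on the whole
  line, so \<Lambda>, \<nu> and \<open>M\<close> serve all Galerkin solutions at once.\<close>

locale kirchhoff_gap = wave_frame P lam
  for P :: "nat \<Rightarrow> 'a::{real_inner,complete_space} \<Rightarrow> 'a" and lam :: "nat \<Rightarrow> real" +
  fixes \<alpha> :: real and m :: "real \<Rightarrow> real" and \<Lambda> \<nu> M :: real
  assumes gap: "exp (lam k) \<le> lam (Suc k)"
    and \<alpha>: "1/4 < \<alpha>"
    and m_Lipschitz: "\<bar>m s - m t\<bar> \<le> \<Lambda> * \<bar>s - t\<bar>"
    and m_lower: "\<nu> \<le> m s" and m_upper: "m s \<le> M"
    and \<nu>: "0 < \<nu>"
begin

lemma \<Lambda>_nonneg: "0 \<le> \<Lambda>"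
  using m_Lipschitz[of 1 0] by simp

lemma lam_Suc: "lam k + 1 \<le> lam (Suc k)"
  using gap[of k] exp_ge_add_one_self[of "lam k"] by linarith

lemma lam_mono: "j \<le> k \<Longrightarrow> lam j \<le> lam k"
proof (rule lift_Suc_mono_le)
  show "lam n \<le> lam (Suc n)" for n using lam_Suc[of n] by simp
qed

lemma lam_ge: "real n \<le> lam n"
proof (induction n)
  case (Suc n)
  then show ?case using lam_Suc[of n] by simp
qed (simp add: lam_nonneg)

text \<open>
  \<open>aw\<close> is the multiplier of \<open>A\<^bsup>\<alpha>\<^esup>\<close>; the sums of \<open>wt k * en k u u'\<close> are equivalent to the squared
  graph norm of \<open>(u, u')\<close> in \<open>D(A\<^bsup>\<alpha> + 1/2\<^esup>) \<times> D(A\<^bsup>\<alpha>\<^esup>)\<close>.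
\<close>

definition aw :: "nat \<Rightarrow> real" where
  "aw k = ((lam k)\<^sup>2) powr \<alpha>"

definition wt :: "nat \<Rightarrow> real" where
  "wt k = 1 + (aw k)\<^sup>2"

text \<open>The square of \<open>aw\<close> is \<open>lam\<close> to the power 4 \<alpha>. One
  factor \<open>lam\<close> is set apart for the Lipschitz bound of the coefficient; the remaining
  exponent is positive because \<alpha> exceeds 1/4.\<close>

lemma aw_sq:
  assumes "1 \<le> lam k"
  shows "(aw k)\<^sup>2 = lam k * lam k powr (4 * \<alpha> - 1)"
proof -
  have l: "0 < lam k" using assms by simp
  have "(lam k)\<^sup>2 = lam k powr 2" using l by simp
  then have "aw k = lam k powr (2 * \<alpha>)" unfolding aw_def using l by (metis powr_powr)
  then have "(aw k)\<^sup>2 = lam k powr (2 * \<alpha> + 2 * \<alpha>)" by (simp only: power2_eq_square powr_add)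
  also have "\<dots> = lam k powr (1 + (4 * \<alpha> - 1))" by simp
  also have "\<dots> = lam k * lam k powr (4 * \<alpha> - 1)" using l by (subst powr_add) simp
  finally show ?thesis .
qed

lemma wt_ge: "1 \<le> wt k" "(aw k)\<^sup>2 \<le> wt k" "1 + lam k \<le> 2 * wt k"
proof -
  show "1 \<le> wt k" "(aw k)\<^sup>2 \<le> wt k" by (auto simp: wt_def)
  show "1 + lam k \<le> 2 * wt k"
  proof (cases "1 \<le> lam k")
    case True
    have "1 \<le> lam k powr (4 * \<alpha> - 1)" using True \<alpha> by (intro ge_one_powr_ge_zero) auto
    then have "lam k * 1 \<le> (aw k)\<^sup>2" unfolding aw_sq[OF True] using True by (intro mult_left_mono) auto
    then have "1 + lam k \<le> 2 * 1 + 2 * (aw k)\<^sup>2" using zero_le_power2[of "aw k"] by linarith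
    then show ?thesis by (simp add: wt_def)
  next
    case False
    then show ?thesis by (simp add: wt_def) (smt (verit) zero_le_power2)
  qed
qed

text \<open>This is where the spectral gap enters: weak norms of high modes are exponentially small.\<close>

lemma lam_le_aw_sq:
  assumes "n < k"
  shows "lam k \<le> exp (- (4 * \<alpha> - 1) * lam n) * (aw k)\<^sup>2"
proof -
  have "exp (lam n) \<le> lam k" using gap[of n] lam_mono[of "Suc n" k] assms by simp
  then have l: "1 \<le> lam k" "exp (lam n) \<le> lam k" using lam_nonneg[of n] one_le_exp_iff[of "lam n"] by linarith+
  have "exp ((4 * \<alpha> - 1) * lam n) = exp (lam n) powr (4 * \<alpha> - 1)" by (simp add: powr_def)
  also have "\<dots> \<le> lam k powr (4 * \<alpha> - 1)" using l \<alpha> by (intro powr_mono2) auto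
  finally have "lam k * exp ((4 * \<alpha> - 1) * lam n) \<le> (aw k)\<^sup>2"
    unfolding aw_sq[OF l(1)] using l by (intro mult_left_mono) auto
  then have "exp (- (4 * \<alpha> - 1) * lam n) * (lam k * exp ((4 * \<alpha> - 1) * lam n)) \<le> exp (- (4 * \<alpha> - 1) * lam n) * (aw k)\<^sup>2"
    by (rule mult_left_mono) simp
  moreover have "exp (- (4 * \<alpha> - 1) * lam n) * exp ((4 * \<alpha> - 1) * lam n) = 1"
    unfolding mult_exp_exp by (simp add: algebra_simps)
  moreover have "exp (- (4 * \<alpha> - 1) * lam n) * (lam k * exp ((4 * \<alpha> - 1) * lam n))
    = lam k * (exp (- (4 * \<alpha> - 1) * lam n) * exp ((4 * \<alpha> - 1) * lam n))"
    by (simp only: mult.left_commute)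
  ultimately show ?thesis by (simp only: mult_1_right)
qed

definition galerkin :: "nat \<Rightarrow> real \<Rightarrow> (real \<Rightarrow> 'a) \<Rightarrow> (real \<Rightarrow> 'a) \<Rightarrow> bool" where
  "galerkin N C0 u u' \<longleftrightarrow> component_solution (\<lambda>t. m (sg (u t))) u u' \<and>
     (\<forall>t\<ge>0. truncated N (u t) \<and> truncated N (u' t) \<and> (norm (u' t))\<^sup>2 + sg (u t) \<le> C0)"

text \<open>The factor of \<open>en_growth\<close> over a time \<open>h\<close> when the coefficient
  has Lipschitz constant \<open>\<Lambda> (lam n C0 + 1)\<close>: here \<open>lam n C0\<close> stems
  from the modes up to \<open>n\<close>, and 1 is the budget granted to the higher ones.\<close>

definition growth :: "real \<Rightarrow> real \<Rightarrow> nat \<Rightarrow> real" where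
  "growth C0 h n = max 1 M / min 1 \<nu> * exp ((\<Lambda> * (lam n * C0 + 1) / \<nu> + 1) * h)"

lemma galerkin_C0_nonneg:
  assumes "galerkin N C0 u u'"
  shows "0 \<le> C0"
proof -
  have g: "truncated N (u 0)" "(norm (u' 0))\<^sup>2 + sg (u 0) \<le> C0" using assms by (auto simp: galerkin_def)
  have "0 \<le> sg (u 0)" unfolding norm_mop_truncated(2)[OF g(1)] by (intro sum_nonneg) simp
  then show ?thesis using g(2) zero_le_power2[of "norm (u' 0)"] by linarith
qed

lemma growth_ge_1:
  assumes "0 \<le> C0" "0 \<le> h"
  shows "1 \<le> growth C0 h n"
proof -
  have "1 \<le> max 1 M / min 1 \<nu>" using \<nu> by (simp add: pos_le_divide_eq)
  moreover have "1 \<le> exp ((\<Lambda> * (lam n * C0 + 1) / \<nu> + 1) * h)"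
    using assms \<nu> \<Lambda>_nonneg lam_nonneg[of n] by (simp add: add_nonneg_nonneg)
  ultimately have "1 * 1 \<le> growth C0 h n" unfolding growth_def by (intro mult_mono) auto
  then show ?thesis by simp
qed

text \<open>While the modes above \<open>n\<close> keep to their budget 1, the energy with weight
  \<open>lam\<close> is at most \<open>lam n C0 + 1\<close>: on the other modes the weight is at
  most \<open>lam n\<close>, and their total energy at most \<open>C0\<close>. The resulting growth
  bound holds for every \<open>k\<close>.\<close>

lemma en_bound_of_high_energy:
  assumes g: "galerkin N C0 u u'" and ab: "0 \<le> a" "a \<le> b" "b \<le> a + h"
    and F: "\<And>t. t \<in> {a..b} \<Longrightarrow> (\<Sum>k\<in>{n<..<N}. lam k * en k (u t) (u' t)) \<le> 1"
    and t: "t \<in> {a..b}"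
  shows "en k (u t) (u' t) \<le> growth C0 h n * en k (u a) (u' a)"
proof -
  have sol: "component_solution (\<lambda>t. m (sg (u t))) u u'"
    and tr: "\<And>t. 0 \<le> t \<Longrightarrow> truncated N (u t)" "\<And>t. 0 \<le> t \<Longrightarrow> truncated N (u' t)"
    and C0: "\<And>t. 0 \<le> t \<Longrightarrow> (norm (u' t))\<^sup>2 + sg (u t) \<le> C0"
    using g by (auto simp: galerkin_def)
  let ?e = "\<lambda>t k. (norm (P k (u' t)))\<^sup>2 + (lam k)\<^sup>2 * (norm (P k (u t)))\<^sup>2"
  have Q: "(\<Sum>k<j. lam k * ?e t k) \<le> lam n * C0 + 1" if t: "t \<in> {a..b}" for j t
  proof -
    have t0: "0 \<le> t" using t ab by simp
    have z: "?e t k = 0" if "N \<le> k" for k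
      using tr[OF t0] that by (simp add: truncated_def)
    let ?S = "{..n} \<union> {n<..<N}"
    have "(\<Sum>k<j. lam k * ?e t k) = (\<Sum>k\<in>{..<j} \<inter> ?S. lam k * ?e t k)"
      using z by (intro sum.mono_neutral_right) auto
    also have "\<dots> \<le> (\<Sum>k\<in>?S. lam k * ?e t k)"
      using lam_nonneg by (intro sum_mono2) auto
    also have "\<dots> = (\<Sum>k\<le>n. lam k * ?e t k) + (\<Sum>k\<in>{n<..<N}. lam k * ?e t k)"
      by (intro sum.union_disjoint) auto
    also have "(\<Sum>k\<le>n. lam k * ?e t k) \<le> lam n * C0"
    proof -
      have "(\<Sum>k\<le>n. lam k * ?e t k) \<le> (\<Sum>k\<le>n. lam n * ?e t k)"
        using lam_mono by (intro sum_mono mult_right_mono) auto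
      also have "\<dots> = lam n * (\<Sum>k\<le>n. ?e t k)" by (simp add: sum_distrib_left)
      also have "(\<Sum>k\<le>n. ?e t k) \<le> C0"
      proof -
        have "(\<Sum>k\<le>n. ?e t k) = (\<Sum>k\<in>{..n} \<inter> {..<N}. ?e t k)"
          using z by (intro sum.mono_neutral_right) (auto simp: not_less)
        also have "\<dots> \<le> (\<Sum>k<N. ?e t k)" by (intro sum_mono2) auto
        also have "\<dots> \<le> C0"
          using C0[OF t0] norm_mop_truncated(1)[OF tr(2)[OF t0]] norm_mop_truncated(2)[OF tr(1)[OF t0]]
          by (simp add: sum.distrib)
        finally show ?thesis .
      qed
      finally show ?thesis using lam_nonneg[of n] by (simp add: mult_left_mono)
    qed
    also have "(\<Sum>k\<in>{n<..<N}. lam k * ?e t k) \<le> 1"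
    proof (rule order_trans[OF sum_mono F[OF t]])
      have "?e t k \<le> en k (u t) (u' t)" for k by (simp add: en_def algebra_simps)
      then show "lam k * ?e t k \<le> lam k * en k (u t) (u' t)" for k by (intro mult_left_mono lam_nonneg)
    qed
    finally show ?thesis by simp
  qed
  have summ: "summable (\<lambda>k. (lam k)\<^sup>2 * (norm (P k (u t)))\<^sup>2)" if "t \<in> {a..b}" for t
    using tr(1)[of t] that ab by (intro summable_finite[of "{..<N}"]) (auto simp: truncated_def)
  let ?L = "\<Lambda> * (lam n * C0 + 1)"
  have C00: "0 \<le> C0" by (rule galerkin_C0_nonneg[OF g])
  have L0: "0 \<le> ?L" using \<Lambda>_nonneg lam_nonneg[of n] C00 by (simp add: add_nonneg_nonneg)
  have cL: "\<bar>m (sg (u s)) - m (sg (u t))\<bar> \<le> ?L * \<bar>s - t\<bar>" if "s \<in> {a..b}" "t \<in> {a..b}" for s t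
  proof -
    have "\<Lambda> * \<bar>sg (u s) - sg (u t)\<bar> \<le> \<Lambda> * ((lam n * C0 + 1) * \<bar>s - t\<bar>)"
      using sg_Lipschitz[OF sol ab(1) Q summ that] \<Lambda>_nonneg by (rule mult_left_mono)
    then show ?thesis using m_Lipschitz[of "sg (u s)" "sg (u t)"] by (simp add: mult_ac)
  qed
  have "en k (u t) (u' t) \<le> max 1 M / min 1 \<nu> * exp ((?L / \<nu> + 1) * (b - a)) * en k (u a) (u' a)"
    by (rule en_growth[OF sol ab(1)]) (use t cL m_lower m_upper \<nu> L0 in auto)
  also have "\<dots> \<le> growth C0 h n * en k (u a) (u' a)"
    unfolding growth_def using ab \<nu> L0
    by (intro mult_right_mono en_nonneg mult_left_mono) (auto intro!: mult_left_mono add_nonneg_nonneg)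
  finally show ?thesis .
qed

text \<open>A continuity argument: the high-mode sum starts below 1, and as long as it is at most 1
  it is in fact at most some \<open>r < 1\<close>; so it never reaches 1.\<close>

lemma energy_step:
  assumes g: "galerkin N C0 u u'" and a: "0 \<le> a" and h: "0 \<le> h"
    and small: "growth C0 h n * (\<Sum>k\<in>{n<..<N}. lam k * en k (u a) (u' a)) < 1"
    and t: "t \<in> {a..a + h}"
  shows "en k (u t) (u' t) \<le> growth C0 h n * en k (u a) (u' a)"
proof -
  define F where "F = (\<lambda>t. \<Sum>k\<in>{n<..<N}. lam k * en k (u t) (u' t))"
  have C00: "0 \<le> C0" by (rule galerkin_C0_nonneg[OF g])
  have G1: "1 \<le> growth C0 h n" by (rule growth_ge_1[OF C00 h])
  define r where "r = growth C0 h n * F a"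
  have F0: "0 \<le> F t" for t unfolding F_def by (intro sum_nonneg mult_nonneg_nonneg lam_nonneg en_nonneg)
  have r: "r < 1" "F a \<le> r"
    using small mult_right_mono[OF G1 F0[of a]] by (simp_all add: r_def F_def)
  have "component_solution (\<lambda>t. m (sg (u t))) u u'" using g by (simp add: galerkin_def)
  from en_continuous[OF this] have contF: "continuous_on {0..} F"
    unfolding F_def by (intro continuous_intros)
  have Fr: "F b \<le> r" if b: "a \<le> b" "b \<le> a + h" and "\<And>t. t \<in> {a..b} \<Longrightarrow> F t \<le> 1" for b
  proof -
    have "en k (u b) (u' b) \<le> growth C0 h n * en k (u a) (u' a)" for k
      by (rule en_bound_of_high_energy[OF g a b]) (use that in \<open>auto simp: F_def\<close>)
    then have "F b \<le> (\<Sum>k\<in>{n<..<N}. lam k * (growth C0 h n * en k (u a) (u' a)))"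
      unfolding F_def by (intro sum_mono mult_left_mono lam_nonneg)
    then show ?thesis by (simp add: r_def F_def sum_distrib_left mult_ac)
  qed
  have "F t < 1" if t: "t \<in> {a..a + h}" for t
  proof (rule ccontr)
    assume neg: "\<not> F t < 1"
    define Z where "Z = {s \<in> {a..a + h}. 1 \<le> F s}"
    have "Z = {a..a + h} \<inter> F -` {1..}" by (auto simp: Z_def)
    moreover have "closed ({a..a + h} \<inter> F -` {1..})"
      by (intro continuous_closed_preimage continuous_on_subset[OF contF]) (use a in auto)
    moreover have "bounded Z" by (rule bounded_subset[of "{a..a+h}"]) (auto simp: Z_def)
    ultimately have "compact Z" by (simp add: compact_eq_bounded_closed)
    moreover have "t \<in> Z" using t neg by (simp add: Z_def)
    ultimately obtain z where z: "z \<in> Z" "\<And>s. s \<in> Z \<Longrightarrow> z \<le> s" using compact_attains_inf[of Z] by blast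
    have zz: "a \<le> z" "z \<le> a + h" "1 \<le> F z" using z(1) by (auto simp: Z_def)
    \<comment> \<open>A time before the first arrival \<open>z\<close> at level 1, with a value
      strictly between \<open>r\<close> and 1. Up to \<open>b\<close> the budget holds, so the
      improved bound \<open>r\<close> contradicts this value.\<close>
    obtain b where b: "a \<le> b" "b \<le> z" "F b = (r + 1) / 2"
    proof (rule IVT'[of F a "(r + 1) / 2" z, THEN exE])
      show "continuous_on {a..z} F" by (rule continuous_on_subset[OF contF]) (use a in auto)
    qed (use r zz in auto)
    have "b \<noteq> z" using b(3) zz(3) r by auto
    have "F s \<le> 1" if "s \<in> {a..b}" for s
      using z(2)[of s] that b \<open>b \<noteq> z\<close> zz by (auto simp: Z_def intro: ccontr)
    from Fr[OF b(1) _ this] have "F b \<le> r" using b zz by simp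
    then show False using b(3) r by simp
  qed
  then show ?thesis
    by (intro en_bound_of_high_energy[OF g a _ order_refl _ t]) (use h in \<open>auto simp: F_def intro: less_imp_le\<close>)
qed

text \<open>Chosen so that the growth exponent per unit of \<open>lam n\<close>, namely
  \<open>\<Lambda> C0 step / \<nu>\<close>, is at most \<open>(4 \<alpha> - 1) / 2\<close>, half the
  decay exponent of the high modes. The added 1 keeps the denominator positive.\<close>

definition step :: "real \<Rightarrow> real" where
  "step C0 = (4 * \<alpha> - 1) * \<nu> / (2 * (\<Lambda> * C0 + 1))"

lemma step_pos: "0 \<le> C0 \<Longrightarrow> 0 < step C0"
  unfolding step_def using \<alpha> \<nu> \<Lambda>_nonneg by (intro divide_pos_pos mult_pos_pos add_nonneg_pos) auto

text \<open>
  Both the growth of the low modes and the smallness of the high ones are exponential in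
  \<open>lam n\<close>; on a time interval of length \<open>step C0\<close>, which does not depend on the size of the
  data in the stronger norm, the latter wins.
\<close>

lemma uniform_step:
  assumes C0: "0 \<le> C0"
  shows "\<exists>G\<ge>1. \<forall>N u u' a t k. galerkin N C0 u u' \<longrightarrow> 0 \<le> a \<longrightarrow>
     (\<Sum>k<N. wt k * en k (u a) (u' a)) \<le> B \<longrightarrow> t \<in> {a..a + step C0} \<longrightarrow>
     en k (u t) (u' t) \<le> G * en k (u a) (u' a)"
proof -
  define h where "h = step C0"
  define q where "q = (4 * \<alpha> - 1) / 2"
  \<comment> \<open>Collects the factors of growth and data that do not depend on \<open>n\<close>,
    so that \<open>n\<close> can be chosen with \<open>K < exp (q lam n)\<close>.\<close>
  define K where "K = max 1 M / min 1 \<nu> * exp ((\<Lambda> / \<nu> + 1) * h) * \<bar>B\<bar>"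
  have q: "0 < q" using \<alpha> by (simp add: q_def)
  have h: "0 \<le> h" using step_pos[OF C0] by (simp add: h_def)
  have K0: "0 \<le> K" using \<nu> by (auto simp: K_def)
  obtain n where n: "K / q < real n" using reals_Archimedean2 by blast
  have "K < q * real n" using n q by (simp add: field_simps)
  also have "\<dots> \<le> q * lam n" using lam_ge[of n] q by simp
  also have "\<dots> < exp (q * lam n)" using exp_ge_add_one_self[of "q * lam n"] by linarith
  finally have Kn: "K < exp (q * lam n)" .
  \<comment> \<open>Growth contributes at most \<open>exp (q lam n)\<close> and the high modes
    \<open>exp (- 2 q lam n)\<close>; the surplus \<open>exp (- q lam n)\<close> beats
    \<open>K\<close>. Since \<open>n\<close> depends on the solution only through \<open>C0\<close>
    and \<open>B\<close>, the estimate is uniform in \<open>N\<close> and in the starting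
    time.\<close>
  have key: "growth C0 h n * exp (- (4 * \<alpha> - 1) * lam n) * \<bar>B\<bar> < 1"
  proof -
    have "\<Lambda> * C0 * h / \<nu> \<le> q"
    proof -
      define d where "d = \<Lambda> * C0 + 1"
      have d: "0 < d" "\<Lambda> * C0 \<le> d" using C0 \<Lambda>_nonneg by (auto simp: d_def intro: add_nonneg_pos)
      have "\<Lambda> * C0 * h / \<nu> = q * (\<Lambda> * C0 / d)"
        using \<nu> d(1) by (simp add: h_def step_def q_def d_def[symmetric])
      also have "\<dots> \<le> q * 1" using q d by (intro mult_left_mono) auto
      finally show ?thesis by simp
    qed
    then have "\<Lambda> * C0 * h / \<nu> * lam n \<le> q * lam n" using lam_nonneg by (rule mult_right_mono)
    moreover have "(\<Lambda> * (lam n * C0 + 1) / \<nu> + 1) * h = \<Lambda> * C0 * h / \<nu> * lam n + (\<Lambda> / \<nu> + 1) * h"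
      using \<nu> by (simp add: field_simps)
    ultimately have ex: "exp ((\<Lambda> * (lam n * C0 + 1) / \<nu> + 1) * h) \<le> exp (q * lam n) * exp ((\<Lambda> / \<nu> + 1) * h)"
      by (simp add: mult_exp_exp)
    have "growth C0 h n * exp (- (4 * \<alpha> - 1) * lam n) * \<bar>B\<bar>
      \<le> max 1 M / min 1 \<nu> * (exp (q * lam n) * exp ((\<Lambda> / \<nu> + 1) * h)) * exp (- (4 * \<alpha> - 1) * lam n) * \<bar>B\<bar>"
      unfolding growth_def using ex \<nu> by (intro mult_right_mono mult_left_mono) auto
    also have "\<dots> = K * (exp (q * lam n) * exp (- (4 * \<alpha> - 1) * lam n))" by (simp add: K_def mult_ac)
    also have "exp (q * lam n) * exp (- (4 * \<alpha> - 1) * lam n) = exp (- (q * lam n))"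
      unfolding mult_exp_exp by (simp add: q_def field_simps)
    also have "K * exp (- (q * lam n)) < exp (q * lam n) * exp (- (q * lam n))" using Kn by simp
    also have "\<dots> = 1" by (simp add: mult_exp_exp)
    finally show ?thesis .
  qed
  have "en k (u t) (u' t) \<le> growth C0 h n * en k (u a) (u' a)"
    if g: "galerkin N C0 u u'" and a: "0 \<le> a" and B: "(\<Sum>k<N. wt k * en k (u a) (u' a)) \<le> B" and t: "t \<in> {a..a + h}"
    for N u u' a t k
  proof (rule energy_step[OF g a h _ t])
    let ?x = "exp (- (4 * \<alpha> - 1) * lam n)"
    have "(\<Sum>k\<in>{n<..<N}. lam k * en k (u a) (u' a)) \<le> (\<Sum>k\<in>{n<..<N}. ?x * (wt k * en k (u a) (u' a)))"
    proof (rule sum_mono)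
      fix k assume "k \<in> {n<..<N}"
      then have "lam k \<le> ?x * (aw k)\<^sup>2" by (intro lam_le_aw_sq) auto
      also have "\<dots> \<le> ?x * wt k" by (simp add: wt_ge)
      finally have "lam k * en k (u a) (u' a) \<le> ?x * wt k * en k (u a) (u' a)" by (rule mult_right_mono[OF _ en_nonneg])
      then show "lam k * en k (u a) (u' a) \<le> ?x * (wt k * en k (u a) (u' a))" by (simp add: mult_ac)
    qed
    also have "\<dots> = ?x * (\<Sum>k\<in>{n<..<N}. wt k * en k (u a) (u' a))" by (simp add: sum_distrib_left)
    also have "\<dots> \<le> ?x * \<bar>B\<bar>"
    proof (intro mult_left_mono)
      have "0 \<le> wt k * en k (u a) (u' a)" for k using wt_ge(1)[of k] by (intro mult_nonneg_nonneg en_nonneg) auto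
      then have "(\<Sum>k\<in>{n<..<N}. wt k * en k (u a) (u' a)) \<le> (\<Sum>k<N. wt k * en k (u a) (u' a))"
        by (intro sum_mono2) auto
      then show "(\<Sum>k\<in>{n<..<N}. wt k * en k (u a) (u' a)) \<le> \<bar>B\<bar>" using B by linarith
    qed simp
    finally have "growth C0 h n * (\<Sum>k\<in>{n<..<N}. lam k * en k (u a) (u' a)) \<le> growth C0 h n * (?x * \<bar>B\<bar>)"
      using growth_ge_1[OF C0 h, of n] by (intro mult_left_mono) auto
    also have "\<dots> < 1" using key by (simp add: mult_ac)
    finally show "growth C0 h n * (\<Sum>k\<in>{n<..<N}. lam k * en k (u a) (u' a)) < 1" .
  qed
  then show ?thesis using growth_ge_1[OF C0 h, of n] unfolding h_def by blast
qed

text \<open>A step enlarges the energies by a factor depending on their current bound, but the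
  length of the next step depends on \<open>C0\<close> alone. The steps do not shrink, so finitely
  many of them reach any given time.\<close>

lemma uniform_bound_steps:
  assumes C0: "0 \<le> C0" and B: "0 \<le> B"
  shows "\<exists>G\<ge>1. \<forall>N u u' t k. galerkin N C0 u u' \<longrightarrow>
     (\<Sum>k<N. wt k * en k (u 0) (u' 0)) \<le> B \<longrightarrow> t \<in> {0..real j * step C0} \<longrightarrow>
     en k (u t) (u' t) \<le> G * en k (u 0) (u' 0)"
proof (induction j)
  case 0
  show ?case by (intro exI[of _ 1]) auto
next
  case (Suc j)
  then obtain G where G: "1 \<le> G" "\<And>N u u' t k. galerkin N C0 u u' \<Longrightarrow>
     (\<Sum>k<N. wt k * en k (u 0) (u' 0)) \<le> B \<Longrightarrow> t \<in> {0..real j * step C0} \<Longrightarrow>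
     en k (u t) (u' t) \<le> G * en k (u 0) (u' 0)" by blast
  obtain G' where G': "1 \<le> G'" "\<And>N u u' a t k. galerkin N C0 u u' \<Longrightarrow> 0 \<le> a \<Longrightarrow>
     (\<Sum>k<N. wt k * en k (u a) (u' a)) \<le> G * B \<Longrightarrow> t \<in> {a..a + step C0} \<Longrightarrow>
     en k (u t) (u' t) \<le> G' * en k (u a) (u' a)" using uniform_step[OF C0, of "G * B"] by blast
  have "en k (u t) (u' t) \<le> (G' * G) * en k (u 0) (u' 0)"
    if g: "galerkin N C0 u u'" and b: "(\<Sum>k<N. wt k * en k (u 0) (u' 0)) \<le> B" and t: "t \<in> {0..real (Suc j) * step C0}"
    for N u u' t k
  proof (cases "t \<le> real j * step C0")
    case True
    then have "en k (u t) (u' t) \<le> G * en k (u 0) (u' 0)" using G(2)[OF g b] t by simp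
    also have "\<dots> \<le> (G' * G) * en k (u 0) (u' 0)"
      using G(1) G'(1) by (intro mult_right_mono en_nonneg) (simp add: mult_le_cancel_right1)
    finally show ?thesis .
  next
    case False
    let ?a = "real j * step C0"
    have a: "0 \<le> ?a" using step_pos[OF C0] by simp
    have ga: "en k (u ?a) (u' ?a) \<le> G * en k (u 0) (u' 0)" for k using G(2)[OF g b] a by simp
    have "(\<Sum>k<N. wt k * en k (u ?a) (u' ?a)) \<le> (\<Sum>k<N. wt k * (G * en k (u 0) (u' 0)))"
    proof (intro sum_mono mult_left_mono ga)
      show "0 \<le> wt k" for k using wt_ge(1)[of k] by linarith
    qed
    also have "\<dots> = G * (\<Sum>k<N. wt k * en k (u 0) (u' 0))" by (simp add: sum_distrib_left mult_ac)
    also have "\<dots> \<le> G * B" using b G(1) by (intro mult_left_mono) auto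
    finally have "en k (u t) (u' t) \<le> G' * en k (u ?a) (u' ?a)"
      using False t by (intro G'(2)[OF g a]) (auto simp: algebra_simps)
    also have "\<dots> \<le> G' * (G * en k (u 0) (u' 0))" using ga[of k] G'(1) by (intro mult_left_mono) auto
    finally show ?thesis by (simp add: mult_ac)
  qed
  moreover have "1 \<le> G' * G" using mult_mono[OF G'(1) G(1)] G'(1) by simp
  ultimately show ?case by blast
qed

lemma uniform_bound:
  assumes C0: "0 \<le> C0" and B: "0 \<le> B"
  obtains G where "1 \<le> G" "\<And>N u u' t k. galerkin N C0 u u' \<Longrightarrow>
     (\<Sum>k<N. wt k * en k (u 0) (u' 0)) \<le> B \<Longrightarrow> t \<in> {0..T} \<Longrightarrow>
     en k (u t) (u' t) \<le> G * en k (u 0) (u' 0)"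
proof -
  obtain j where j: "T / step C0 < real j" using reals_Archimedean2 by blast
  then have T: "T \<le> real j * step C0" using step_pos[OF C0] by (simp add: field_simps)
  have sub: "t \<in> {0..T} \<Longrightarrow> t \<in> {0..real j * step C0}" for t using T by auto
  show thesis using uniform_bound_steps[OF C0 B, of j] that sub by blast
qed

end

section \<open>Global existence\<close>

lemma uniform_limit_Pair:
  assumes "uniform_limit S f l F" "uniform_limit S g r F"
  shows "uniform_limit S (\<lambda>n x. (f n x, g n x)) (\<lambda>x. (l x, r x)) F"
proof (rule uniform_limitI)
  fix e :: real assume "e > 0"
  then have "e / 2 > 0" by simp
  then have "\<forall>\<^sub>F n in F. \<forall>x\<in>S. dist (f n x) (l x) < e / 2" "\<forall>\<^sub>F n in F. \<forall>x\<in>S. dist (g n x) (r x) < e / 2"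
    using assms uniform_limitD by blast+
  then show "\<forall>\<^sub>F n in F. \<forall>x\<in>S. dist (f n x, g n x) (l x, r x) < e"
  proof eventually_elim
    case (elim n)
    show ?case
    proof
      fix x assume "x \<in> S"
      then have "dist (f n x) (l x) + dist (g n x) (r x) < e" using elim by fastforce
      moreover have "dist (f n x, g n x) (l x, r x) \<le> dist (f n x) (l x) + dist (g n x) (r x)"
        unfolding dist_Pair_Pair by (rule sqrt_sum_squares_le_sum) auto
      ultimately show "dist (f n x, g n x) (l x, r x) < e" by linarith
    qed
  qed
qed

lemma continuous_on_atLeast:
  fixes f :: "real \<Rightarrow> 'b::metric_space"
  assumes "\<And>T. continuous_on {0..T} f"
  shows "continuous_on {0..} f"
  unfolding continuous_on_iff
proof (intro ballI allI impI)
  fix x e :: real assume x: "x \<in> {0..}" and e: "e > 0"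
  obtain d where d: "d > 0" "\<And>y. y \<in> {0..x + 1} \<Longrightarrow> dist y x < d \<Longrightarrow> dist (f y) (f x) < e"
  proof -
    have "x \<in> {0..x + 1}" using x by simp
    then show thesis using assms[of "x + 1"] e that unfolding continuous_on_iff by blast
  qed
  have "dist (f y) (f x) < e" if "y \<in> {0..}" "dist y x < min d 1" for y
    using that by (intro d(2)) (auto simp: dist_real_def)
  then show "\<exists>d>0. \<forall>x'\<in>{0..}. dist x' x < d \<longrightarrow> dist (f x') (f x) < e"
    using d(1) by (intro exI[of _ "min d 1"]) auto
qed

context orthogonal_decomposition
begin

text \<open>Closedness of the multiplier identifies the limit of \<open>mop h (f N t)\<close>. The
  limit is written with \<open>lim\<close> so that one function serves for all
  \<open>T\<close>.\<close>

lemma uniform_limit_mop: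
  fixes f :: "nat \<Rightarrow> real \<Rightarrow> 'a"
  assumes dom: "\<And>N t. 0 \<le> t \<Longrightarrow> f N t \<in> mdom h"
    and C: "\<And>T e. e > 0 \<Longrightarrow> \<exists>N0. \<forall>N\<ge>N0. \<forall>N'\<ge>N0. \<forall>t\<in>{0..T}. norm (f N t - f N' t) \<le> e"
    and Ch: "\<And>T e. e > 0 \<Longrightarrow> \<exists>N0. \<forall>N\<ge>N0. \<forall>N'\<ge>N0. \<forall>t\<in>{0..T}. norm (mop h (f N t - f N' t)) \<le> e"
  shows "uniform_limit {0..T} f (\<lambda>t. lim (\<lambda>N. f N t)) sequentially"
    and "0 \<le> t \<Longrightarrow> lim (\<lambda>N. f N t) \<in> mdom h"
    and "uniform_limit {0..T} (\<lambda>N t. mop h (f N t)) (\<lambda>t. mop h (lim (\<lambda>N. f N t))) sequentially"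
proof -
  have UC: "uniformly_Cauchy_on {0..T} g"
    if gC: "\<And>e. e > 0 \<Longrightarrow> \<exists>N0. \<forall>N\<ge>N0. \<forall>N'\<ge>N0. \<forall>t\<in>{0..T}. norm (g N t - g N' t) \<le> e" for T and g :: "nat \<Rightarrow> real \<Rightarrow> 'a"
  proof (rule uniformly_Cauchy_onI)
    fix e :: real assume "e > 0"
    then obtain N0 where "\<forall>N\<ge>N0. \<forall>N'\<ge>N0. \<forall>t\<in>{0..T}. norm (g N t - g N' t) \<le> e/2"
      using gC[of "e/2"] by auto
    moreover have "e / 2 < e" using \<open>e > 0\<close> by simp
    ultimately show "\<exists>M. \<forall>x\<in>{0..T}. \<forall>m\<ge>M. \<forall>n\<ge>M. dist (g m x) (g n x) < e"
      unfolding dist_norm by (intro exI[of _ N0]) (meson le_less_trans)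
  qed
  have lim1: "uniform_limit {0..T} f (\<lambda>t. lim (\<lambda>N. f N t)) sequentially" for T
    using Cauchy_uniformly_convergent[OF UC[OF C]] by (simp add: uniformly_convergent_uniform_limit_iff)
  have Ch': "\<exists>N0. \<forall>N\<ge>N0. \<forall>N'\<ge>N0. \<forall>t\<in>{0..T}. norm (mop h (f N t) - mop h (f N' t)) \<le> e" if "e > 0" for T e
  proof -
    have "mop h (f N t - f N' t) = mop h (f N t) - mop h (f N' t)" if "t \<in> {0..T}" for N N' t
      using that by (intro mop_diff dom) auto
    then show ?thesis using Ch[OF that, of T] by auto
  qed
  have lim2: "uniform_limit {0..T} (\<lambda>N t. mop h (f N t)) (\<lambda>t. lim (\<lambda>N. mop h (f N t))) sequentially" for T
    using Cauchy_uniformly_convergent[OF UC[OF Ch']] by (simp add: uniformly_convergent_uniform_limit_iff)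
  have pt: "lim (\<lambda>N. f N t) \<in> mdom h \<and> mop h (lim (\<lambda>N. f N t)) = lim (\<lambda>N. mop h (f N t))" if t: "0 \<le> t" for t
  proof -
    have "(\<lambda>N. f N t) \<longlonglongrightarrow> lim (\<lambda>N. f N t)" "(\<lambda>N. mop h (f N t)) \<longlonglongrightarrow> lim (\<lambda>N. mop h (f N t))"
      using tendsto_uniform_limitI[OF lim1[of t], of t] tendsto_uniform_limitI[OF lim2[of t], of t] t by auto
    from mop_closed[of "\<lambda>N. f N t", OF dom[OF t] this] show ?thesis by blast
  qed
  show "uniform_limit {0..T} f (\<lambda>t. lim (\<lambda>N. f N t)) sequentially" by (rule lim1)
  show "0 \<le> t \<Longrightarrow> lim (\<lambda>N. f N t) \<in> mdom h" using pt by blast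
  show "uniform_limit {0..T} (\<lambda>N t. mop h (f N t)) (\<lambda>t. mop h (lim (\<lambda>N. f N t))) sequentially"
    using lim2[of T] by (rule uniform_limit_eq_rhs[THEN uniform_limit_cong'[THEN iffD1, rotated -1]]) (use pt in auto)
qed

end

section \<open>Convergence of the Galerkin approximations\<close>

context kirchhoff_gap
begin

lemma weights_le:
  "(aw k)\<^sup>2 \<le> 1 + (aw k * lam k)\<^sup>2" "(lam k)\<^sup>2 \<le> 1 + (aw k * lam k)\<^sup>2"
proof -
  have "(aw k)\<^sup>2 \<le> 1 + (aw k * lam k)\<^sup>2 \<and> (lam k)\<^sup>2 \<le> 1 + (aw k * lam k)\<^sup>2"
  proof (cases "1 \<le> lam k")
    case True
    have "1 \<le> lam k powr (4 * \<alpha> - 1)" using True \<alpha> by (intro ge_one_powr_ge_zero) auto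
    then have "1 * 1 \<le> (aw k)\<^sup>2" unfolding aw_sq[OF True] using True by (intro mult_mono) auto
    moreover have "1 \<le> (lam k)\<^sup>2" using True by (simp add: one_le_power)
    ultimately have "(aw k)\<^sup>2 * 1 \<le> (aw k)\<^sup>2 * (lam k)\<^sup>2" "1 * (lam k)\<^sup>2 \<le> (aw k)\<^sup>2 * (lam k)\<^sup>2"
      by (intro mult_left_mono mult_right_mono; simp)+
    then show ?thesis by (simp add: power_mult_distrib)
  next
    case False
    then have l: "(lam k)\<^sup>2 \<le> 1" using lam_nonneg[of k] by (simp add: power_le_one)
    then have "aw k \<le> 1 powr \<alpha>" unfolding aw_def using \<alpha> by (intro powr_mono2) auto
    then have "(aw k)\<^sup>2 \<le> 1" unfolding aw_def by (simp add: power_le_one)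
    then show ?thesis using l zero_le_power2[of "aw k * lam k"] by linarith
  qed
  then show "(aw k)\<^sup>2 \<le> 1 + (aw k * lam k)\<^sup>2" "(lam k)\<^sup>2 \<le> 1 + (aw k * lam k)\<^sup>2" by auto
qed

lemma energy_domain:
  assumes "x \<in> mdom (\<lambda>k. aw k * lam k)"
  shows "x \<in> mdom aw" "x \<in> mdom lam"
  using mdom_mono[of aw 1 "\<lambda>k. aw k * lam k"] mdom_mono[of lam 1 "\<lambda>k. aw k * lam k"] weights_le assms by auto

lemma wt_en_eq: "wt k * en k x y = (norm (P k y))\<^sup>2 + (aw k)\<^sup>2 * (norm (P k y))\<^sup>2 +
    ((norm (P k x))\<^sup>2 + (lam k)\<^sup>2 * (norm (P k x))\<^sup>2 + (aw k)\<^sup>2 * (norm (P k x))\<^sup>2 + (aw k * lam k)\<^sup>2 * (norm (P k x))\<^sup>2)"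
  by (simp add: wt_def en_def algebra_simps power_mult_distrib)

lemma wt_en_ge:
  "(norm (P k x))\<^sup>2 \<le> wt k * en k x y" "(lam k)\<^sup>2 * (norm (P k x))\<^sup>2 \<le> wt k * en k x y"
  "(aw k)\<^sup>2 * (norm (P k x))\<^sup>2 \<le> wt k * en k x y" "(aw k * lam k)\<^sup>2 * (norm (P k x))\<^sup>2 \<le> wt k * en k x y"
  "(norm (P k y))\<^sup>2 \<le> wt k * en k x y" "(aw k)\<^sup>2 * (norm (P k y))\<^sup>2 \<le> wt k * en k x y"
  unfolding wt_en_eq by simp_all

lemma summable_wt_en:
  assumes x: "x \<in> mdom (\<lambda>k. aw k * lam k)" and y: "y \<in> mdom aw"
  shows "summable (\<lambda>k. wt k * en k x y)"
  unfolding wt_en_eq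
  using x y energy_domain[OF x] sums_summable[OF norm_sums]
  by (intro summable_add) (simp_all add: mdom_def)

lemma norm_mop_le_energy:
  assumes "z \<in> mdom h" "\<And>k. (h k)\<^sup>2 * (norm (P k z))\<^sup>2 \<le> wt k * en k x y"
    and "\<And>n. (\<Sum>k<n. wt k * en k x y) \<le> e\<^sup>2" "0 \<le> e"
  shows "norm (mop h z) \<le> e"
proof (rule power2_le_imp_le)
  have "(\<lambda>n. \<Sum>k<n. (h k)\<^sup>2 * (norm (P k z))\<^sup>2) \<longlonglongrightarrow> (norm (mop h z))\<^sup>2"
    using norm_mop[OF assms(1)] by (simp add: sums_def)
  moreover have "(\<Sum>k<n. (h k)\<^sup>2 * (norm (P k z))\<^sup>2) \<le> e\<^sup>2" for n
    by (rule order_trans[OF sum_mono assms(3)]) (rule assms(2))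
  ultimately show "(norm (mop h z))\<^sup>2 \<le> e\<^sup>2" by (intro LIMSEQ_le_const2) auto
qed (rule assms(4))

lemma sg_eq: "x \<in> mdom lam \<Longrightarrow> sg x = (norm (mop lam x))\<^sup>2"
  using norm_mop[of x lam] by (simp add: sg_def sums_iff)

definition cut :: "nat \<Rightarrow> 'a \<Rightarrow> 'a" where
  "cut N x = (\<Sum>k<N. P k x)"

lemma P_cut: "P k (cut N x) = (if k < N then P k x else 0)"
proof -
  have "P k (cut N x) = (\<Sum>j<N. P k (P j x))"
    unfolding cut_def using bounded_linear.linear[OF P_bl] by (rule linear_sum)
  also have "\<dots> = (\<Sum>j<N. if k = j then P k x else 0)" by (intro sum.cong) (auto simp: P_P)
  finally show ?thesis by simp
qed

lemma truncated_cut: "truncated N (cut N x)"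
  by (simp add: truncated_def P_cut)

lemma truncated_diff:
  assumes "truncated N x" "truncated N' y"
  shows "truncated (max N N') (x - y)"
  using assms by (simp add: truncated_def P_diff)

lemma truncated_mdom: "truncated N x \<Longrightarrow> x \<in> mdom h"
  by (rule mdom_finite[of N]) (simp add: truncated_def)

text \<open>Cutting the multiplier off after \<open>N\<close> modes makes it bounded. This carries
  continuity and differentiability of Galerkin solutions over to their images under unbounded
  multipliers.\<close>

lemma bounded_linear_on_truncated:
  obtains S where "bounded_linear S" "\<And>x. truncated N x \<Longrightarrow> mop h x = S x"
proof -
  let ?h = "\<lambda>k. if k < N then h k else 0"
  have b: "\<bar>?h k\<bar> \<le> (\<Sum>k<N. \<bar>h k\<bar>)" for k
    by (auto intro: member_le_sum sum_nonneg)
  have "mop h x = mop ?h x" if "truncated N x" for x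
    by (rule mop_eqI(2)) (use that in \<open>auto simp: P_mop[OF bounded_mop(1)[of ?h, OF b]] truncated_def\<close>)
  then show thesis using that bounded_mop(3)[of ?h, OF b] by blast
qed

lemma cut_le:
  assumes "x \<in> mdom lam"
  shows "sg (cut N x) \<le> sg x"
proof -
  have "sg (cut N x) = (\<Sum>k<N. (lam k)\<^sup>2 * (norm (P k x))\<^sup>2)"
    unfolding norm_mop_truncated(2)[OF truncated_cut] by (simp add: P_cut)
  also have "\<dots> \<le> sg x" unfolding sg_def by (rule sum_le_suminf) (use assms in \<open>auto simp: mdom_def\<close>)
  finally show "sg (cut N x) \<le> sg x" .
qed

lemma norm_cut_le: "norm (cut N x) \<le> norm x"
proof (rule power2_le_imp_le)
  have "(norm (cut N x))\<^sup>2 = (\<Sum>k<N. (norm (P k x))\<^sup>2)"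
    unfolding norm_mop_truncated(1)[OF truncated_cut] by (simp add: P_cut)
  also have "\<dots> \<le> (\<Sum>k. (norm (P k x))\<^sup>2)"
    by (rule sum_le_suminf) (use sums_summable[OF norm_sums] in auto)
  also have "\<dots> = (norm x)\<^sup>2" using norm_sums by (simp add: sums_iff)
  finally show "(norm (cut N x))\<^sup>2 \<le> (norm x)\<^sup>2" .
qed simp

text \<open>Continuous dependence controls differences only with the weight
  \<open>1 / (1 + lam)\<close>. The first \<open>j\<close> modes lose a finite factor
  \<open>Q\<close> when this weight is changed to \<open>wt\<close>; the others are uniformly small,
  since \<open>uniform_bound\<close> dominates each of them by \<open>G\<close> times the same mode
  of the data.\<close>

lemma galerkin_Cauchy:
  assumes sol: "\<And>N. galerkin N C0 (U N) (U' N)"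
    and init: "\<And>N. U N 0 = cut N u0" "\<And>N. U' N 0 = cut N u1"
    and dom: "u0 \<in> mdom (\<lambda>k. aw k * lam k)" "u1 \<in> mdom aw" and e: "e > 0"
  shows "\<exists>N0. \<forall>N\<ge>N0. \<forall>N'\<ge>N0. \<forall>t\<in>{0..T}. \<forall>n.
    (\<Sum>k<n. wt k * en k (U N t - U N' t) (U' N t - U' N' t)) \<le> e"
proof (cases "0 \<le> T")
  case T: True
  define w0 where "w0 = (\<lambda>k. wt k * en k u0 u1)"
  have w00: "0 \<le> w0 k" for k using wt_ge(1)[of k] by (simp add: w0_def en_nonneg)
  have e0_le: "en k u0 u1 \<le> w0 k" for k
    using mult_right_mono[OF wt_ge(1)[of k] en_nonneg[of k u0 u1]] by (simp add: w0_def)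
  have summ: "summable w0" unfolding w0_def by (rule summable_wt_en[OF dom])
  define B where "B = suminf w0"
  have B0: "0 \<le> B" unfolding B_def using summ w00 by (rule suminf_nonneg)
  have partB: "(\<Sum>k<n. w0 k) \<le> B" for n unfolding B_def using summ w00 by (intro sum_le_suminf) auto
  obtain G where G: "1 \<le> G" "\<And>N u u' t k. galerkin N C0 u u' \<Longrightarrow>
     (\<Sum>k<N. wt k * en k (u 0) (u' 0)) \<le> B \<Longrightarrow> t \<in> {0..T} \<Longrightarrow>
     en k (u t) (u' t) \<le> G * en k (u 0) (u' 0)"
    using uniform_bound[OF galerkin_C0_nonneg[OF sol] B0] by blast
  have en0: "en k (U N 0) (U' N 0) \<le> en k u0 u1" for k N
    by (simp add: init en_def P_cut)
  have wt0: "0 \<le> wt k" for k using wt_ge(1)[of k] by linarith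
  have enb: "en k (U N t) (U' N t) \<le> G * en k u0 u1" if t: "t \<in> {0..T}" for k N t
  proof -
    have "(\<Sum>k<N. wt k * en k (U N 0) (U' N 0)) \<le> (\<Sum>k<N. w0 k)"
      unfolding w0_def by (intro sum_mono mult_left_mono en0 wt0)
    then have "en k (U N t) (U' N t) \<le> G * en k (U N 0) (U' N 0)"
      using partB[of N] by (intro G(2)[OF sol _ t]) auto
    also have "\<dots> \<le> G * en k u0 u1" using G(1) by (intro mult_left_mono en0) auto
    finally show ?thesis .
  qed
  have low: "(\<Sum>k<n. (1 + lam k) * en k (U N t) (U' N t)) \<le> 2 * G * B" if t: "t \<in> {0..T}" for n N t
  proof -
    have "(\<Sum>k<n. (1 + lam k) * en k (U N t) (U' N t)) \<le> (\<Sum>k<n. 2 * wt k * (G * en k u0 u1))"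
      using wt_ge(3) wt0 by (intro sum_mono mult_mono enb[OF t] en_nonneg) auto
    also have "\<dots> = 2 * G * (\<Sum>k<n. w0 k)" by (simp add: w0_def sum_distrib_left mult_ac)
    also have "\<dots> \<le> 2 * G * B" using partB[of n] G(1) by (intro mult_left_mono) auto
    finally show ?thesis .
  qed
  define C where "C = 2 * (max 1 M / min 1 \<nu>) * exp ((\<Lambda> * (2 * G * B) / \<nu> + 1 + 8 * \<Lambda> * (2 * G * B) / min 1 \<nu> + 1) * T)"
  have C0: "0 \<le> C" using \<nu> by (simp add: C_def)
  have csol: "component_solution (\<lambda>t. m (sg (U N t))) (U N) (U' N)" for N
    using sol by (simp add: galerkin_def)
  have cd: "(\<Sum>k<n. en k (U N t - U N' t) (U' N t - U' N' t) / (1 + lam k)) \<le> C * W0"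
    if "\<And>n. (\<Sum>k<n. en k (U N 0 - U N' 0) (U' N 0 - U' N' 0) / (1 + lam k)) \<le> W0" "t \<in> {0..T}" for N N' W0 n t
    unfolding C_def
    by (rule continuous_dependence[where m = m, OF csol csol T low low])
       (use that m_Lipschitz m_lower m_upper \<nu> \<Lambda>_nonneg in auto)
  have tail: "\<exists>K. \<forall>n. (\<Sum>k=K..<n. w0 k) \<le> r" if "r > 0" for r
  proof -
    obtain K where "\<And>n. norm (\<Sum>k=K..<n. w0 k) < r" using summ \<open>r > 0\<close> unfolding summable_Cauchy by (meson order_refl)
    then have "(\<Sum>k=K..<n. w0 k) \<le> r" for n using norm_ge_zero[of "\<Sum>k=K..<n. w0 k"] by (smt (verit) real_norm_def)
    then show ?thesis by blast
  qed
  \<comment> \<open>A mode of a difference of two dominated solutions is at most \<open>4 G\<close>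
    times that of the data, so the modes from \<open>j\<close> on contribute at most
    \<open>e / 2\<close>.\<close>
  obtain j where j: "\<And>n. (\<Sum>k=j..<n. w0 k) \<le> e / (8 * G)" using tail[of "e / (8 * G)"] e G(1) by auto
  define Q where "Q = (\<Sum>k<j. wt k * (1 + lam k))"
  have Q0: "0 \<le> Q" unfolding Q_def using wt0 lam_nonneg by (intro sum_nonneg mult_nonneg_nonneg add_nonneg_nonneg) auto
  \<comment> \<open>A size of the initial tail that continuous dependence and the change of weight
    amplify to at most \<open>e / 2\<close>.\<close>
  define r where "r = e / (2 * (Q * C + 1))"
  have QC: "0 < Q * C + 1" using Q0 C0 by (intro add_nonneg_pos mult_nonneg_nonneg) auto
  then have r: "0 < r" using e by (simp add: r_def)
  obtain N0 where N0: "\<And>n. (\<Sum>k=N0..<n. w0 k) \<le> r" using tail[OF r] by auto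
  have "(\<Sum>k<n. wt k * en k (U N t - U N' t) (U' N t - U' N' t)) \<le> e"
    if N: "N0 \<le> N" "N0 \<le> N'" and t: "t \<in> {0..T}" for N N' t n
  proof -
    let ?d = "\<lambda>k t. en k (U N t - U N' t) (U' N t - U' N' t)"
    have d0: "?d k 0 / (1 + lam k) \<le> (if k < N0 then 0 else w0 k)" for k
    proof -
      have "?d k 0 \<le> (if k < N0 then 0 else en k u0 u1)"
        using N by (auto simp: init en_def P_diff P_cut)
      moreover have "?d k 0 / (1 + lam k) \<le> ?d k 0"
        using divide_left_mono[of 1 "1 + lam k" "?d k 0"] lam_nonneg[of k] en_nonneg by simp
      ultimately show ?thesis using e0_le[of k] by (auto split: if_splits)
    qed
    have W0: "(\<Sum>k<n. ?d k 0 / (1 + lam k)) \<le> r" for n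
    proof -
      have "(\<Sum>k<n. ?d k 0 / (1 + lam k)) \<le> (\<Sum>k<n. if k < N0 then 0 else w0 k)" by (intro sum_mono d0)
      also have "\<dots> = (\<Sum>k\<in>{N0..<n}. w0 k)" by (rule sum.mono_neutral_cong_right) auto
      finally show ?thesis using N0[of n] by simp
    qed
    have "(\<Sum>k<n. wt k * ?d k t) \<le> (\<Sum>k<n. (if k < j then Q * (?d k t / (1 + lam k)) else 0) + (if k < j then 0 else 4 * G * w0 k))"
    proof (rule sum_mono)
      fix k
      have a: "wt k * (1 + lam k) \<le> Q" if "k < j"
        unfolding Q_def using that wt0 lam_nonneg by (intro member_le_sum mult_nonneg_nonneg add_nonneg_nonneg) auto
      have 1: "wt k * ?d k t = wt k * (1 + lam k) * (?d k t / (1 + lam k))" using lam_nonneg[of k] by simp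
      have 2: "0 \<le> ?d k t / (1 + lam k)" using lam_nonneg[of k] en_nonneg by (simp add: divide_nonneg_nonneg)
      have "?d k t \<le> 4 * (G * en k u0 u1)"
        using en_diff_le[of k "U N t" "U N' t" "U' N t" "U' N' t"] enb[OF t, of k N] enb[OF t, of k N'] by linarith
      then have "wt k * ?d k t \<le> wt k * (4 * (G * en k u0 u1))" by (rule mult_left_mono[OF _ wt0])
      then have 3: "wt k * ?d k t \<le> 4 * G * w0 k" by (simp add: w0_def mult_ac)
      show "wt k * ?d k t \<le> (if k < j then Q * (?d k t / (1 + lam k)) else 0) + (if k < j then 0 else 4 * G * w0 k)"
        using mult_right_mono[OF a 2] 1 3 by (cases "k < j") auto
    qed
    also have "\<dots> = (\<Sum>k<n. if k < j then Q * (?d k t / (1 + lam k)) else 0) + (\<Sum>k<n. if k < j then 0 else 4 * G * w0 k)"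
      by (rule sum.distrib)
    also have "(\<Sum>k<n. if k < j then Q * (?d k t / (1 + lam k)) else 0) \<le> (\<Sum>k<n. Q * (?d k t / (1 + lam k)))"
      using Q0 lam_nonneg en_nonneg by (intro sum_mono) (auto intro!: mult_nonneg_nonneg divide_nonneg_nonneg add_nonneg_nonneg)
    also have "\<dots> = Q * (\<Sum>k<n. ?d k t / (1 + lam k))" by (simp only: sum_distrib_left)
    also have "\<dots> \<le> Q * (C * r)" by (intro mult_left_mono cd[OF W0 t] Q0)
    also have "\<dots> \<le> e / 2"
    proof -
      have "Q * (C * r) \<le> (Q * C + 1) * r" using r by (simp add: algebra_simps)
      also have "\<dots> = e / 2"
      proof -
        have "x * (e / (2 * x)) = e / 2" if "0 < x" for x using that by simp
        from this[OF QC] show ?thesis by (simp only: r_def)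
      qed
      finally show ?thesis .
    qed
    also have "(\<Sum>k<n. if k < j then 0 else 4 * G * w0 k) = (\<Sum>k\<in>{j..<n}. 4 * G * w0 k)"
      by (rule sum.mono_neutral_cong_right) auto
    also have "\<dots> = 4 * G * (\<Sum>k=j..<n. w0 k)" by (simp add: sum_distrib_left)
    also have "\<dots> \<le> 4 * G * (e / (8 * G))" using G(1) by (intro mult_left_mono j) auto
    also have "\<dots> = e / 2" using G(1) by simp
    finally show ?thesis by simp
  qed
  then show ?thesis by blast
qed auto

end

section \<open>Passage to the limit\<close>

context kirchhoff_gap
begin

text \<open>The bound for \<open>sg (u t)\<close> is expressed through \<open>M0\<close>, which
  concerns \<open>m\<close> only on values up to \<open>sg u0\<close>; it allows the clamping to be
  undone afterwards.\<close>

theorem global_existence: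
  assumes dom: "u0 \<in> mdom (\<lambda>k. aw k * lam k)" "u1 \<in> mdom aw"
    and R: "0 \<le> R" "\<And>s. R \<le> s \<Longrightarrow> m s = m R"
    and M0: "\<And>s. 0 \<le> s \<Longrightarrow> s \<le> sg u0 \<Longrightarrow> m s \<le> M0"
  obtains u u' where "u 0 = u0" "u' 0 = u1"
    "\<And>t. 0 \<le> t \<Longrightarrow> u t \<in> mdom (\<lambda>k. aw k * lam k)" "\<And>t. 0 \<le> t \<Longrightarrow> u' t \<in> mdom aw"
    "\<And>t. 0 \<le> t \<Longrightarrow> sg (u t) \<le> ((norm u1)\<^sup>2 + M0 * sg u0) / \<nu>"
    "continuous_on {0..} (\<lambda>t. sg (u t))"
    "continuous_on {0..} (\<lambda>t. (u t, mop (\<lambda>k. aw k * lam k) (u t)))"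
    "continuous_on {0..} (\<lambda>t. (u' t, mop aw (u' t)))"
    "\<And>t. 0 \<le> t \<Longrightarrow> ((\<lambda>s. (u s, mop aw (u s))) has_vector_derivative (u' t, mop aw (u' t))) (at t within {0..})"
    "\<And>t v. 0 \<le> t \<Longrightarrow> v \<in> mdom (\<lambda>k. (lam k)\<^sup>2) \<Longrightarrow>
      ((\<lambda>s. inner (u' s) v) has_real_derivative - (m (sg (u t)) * inner (u t) (mop (\<lambda>k. (lam k)\<^sup>2) v))) (at t within {0..})"
proof -
  let ?A = "mop (\<lambda>k. (lam k)\<^sup>2)"
  have m0: "0 \<le> m s" for s using m_lower[of s] \<nu> by linarith
  have "\<exists>U U'. U 0 = cut N u0 \<and> U' 0 = cut N u1 \<and> (\<forall>t\<ge>0. truncated N (U t) \<and> truncated N (U' t)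
      \<and> (U has_vector_derivative U' t) (at t within {0..})
      \<and> (U' has_vector_derivative - (m (sg (U t))) *\<^sub>R ?A (U t)) (at t within {0..}))" for N
    by (rule truncated_solution_exists[OF m_Lipschitz m0 m_upper R(2) \<Lambda>_nonneg R(1) truncated_cut truncated_cut]) blast+
  then obtain U U' where U0: "\<And>N. U N 0 = cut N u0" "\<And>N. U' N 0 = cut N u1"
    and tr: "\<And>N t. 0 \<le> t \<Longrightarrow> truncated N (U N t)" "\<And>N t. 0 \<le> t \<Longrightarrow> truncated N (U' N t)"
    and dU: "\<And>N t. 0 \<le> t \<Longrightarrow> (U N has_vector_derivative U' N t) (at t within {0..})"
    and dU': "\<And>N t. 0 \<le> t \<Longrightarrow> (U' N has_vector_derivative - (m (sg (U N t))) *\<^sub>R ?A (U N t)) (at t within {0..})"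
    by metis
  define H0 where "H0 = (norm u1)\<^sup>2 + M0 * sg u0"
  note dlam = energy_domain[OF dom(1)]
  have sg0: "0 \<le> sg u0" by (simp add: sg_eq[OF dlam(2)])
  have M00: "0 \<le> M0" using M0[of 0] m0[of 0] sg0 by simp
  have ham: "(norm (U' N t))\<^sup>2 + \<nu> * sg (U N t) \<le> H0" if t: "0 \<le> t" for N t
  proof -
    have contm: "continuous_on {0..} m"
      by (rule lipschitz_on_continuous_on[of \<Lambda>]) (auto intro!: lipschitz_onI m_Lipschitz simp: dist_real_def \<Lambda>_nonneg)
    have "(norm (U' N t))\<^sup>2 + \<nu> * sg (U N t) \<le> (norm (U' N 0))\<^sup>2 + M0 * sg (U N 0)"
    proof (rule Hamiltonian_bound[OF tr(1) dU dU' contm m_lower _ t])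
      show "m s \<le> M0" if "0 \<le> s" "s \<le> sg (U N 0)" for s
        using that cut_le[OF dlam(2), of N] M0[of s] by (simp add: U0)
    qed
    also have "\<dots> \<le> H0"
      unfolding H0_def U0 using M00 cut_le[OF dlam(2), of N] norm_cut_le[of N u1]
      by (intro add_mono mult_left_mono power_mono) auto
    finally show ?thesis .
  qed
  have sgU0: "0 \<le> sg (U N t)" if "0 \<le> t" for N t
    using sg_eq[OF truncated_mdom[OF tr(1)[OF that]]] by simp
  have sgU: "sg (U N t) \<le> H0 / \<nu>" if "0 \<le> t" for N t
  proof -
    have "\<nu> * sg (U N t) \<le> H0" using ham[OF that, of N] zero_le_power2[of "norm (U' N t)"] by linarith
    then show ?thesis using \<nu> by (simp add: field_simps)
  qed
  \<comment> \<open>\<open>H0\<close> bounds \<open>|u'|^2\<close> and \<open>H0 / \<nu>\<close>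
    bounds \<open>sg\<close>; their sum is a constant valid for all \<open>N\<close>.\<close>
  have gal: "galerkin N (H0 + H0 / \<nu>) (U N) (U' N)" for N
    unfolding galerkin_def component_solution_def
  proof (intro conjI allI impI tr)
    fix k and t :: real assume t: "0 \<le> t"
    show "((\<lambda>s. P k (U N s)) has_vector_derivative P k (U' N t)) (at t within {0..})"
      by (rule bounded_linear.has_vector_derivative[OF P_bl dU[OF t]])
    have "P k (- (m (sg (U N t))) *\<^sub>R ?A (U N t)) = - (m (sg (U N t)) * (lam k)\<^sup>2) *\<^sub>R P k (U N t)"
      by (simp add: P_scaleR P_minus P_mop[OF truncated_mdom[OF tr(1)[OF t]]])
    then show "((\<lambda>s. P k (U' N s)) has_vector_derivative - (m (sg (U N t)) * (lam k)\<^sup>2) *\<^sub>R P k (U N t)) (at t within {0..})"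
      using bounded_linear.has_vector_derivative[OF P_bl dU'[OF t]] by metis
  next
    fix t :: real assume t: "0 \<le> t"
    have "(norm (U' N t))\<^sup>2 \<le> H0"
      using ham[OF t, of N] mult_nonneg_nonneg[OF less_imp_le[OF \<nu>] sgU0[OF t, of N]] by linarith
    then show "(norm (U' N t))\<^sup>2 + sg (U N t) \<le> H0 + H0 / \<nu>" using sgU[OF t, of N] by linarith
  qed
  note Cauchy = galerkin_Cauchy[OF gal U0 dom]
  have CX: "\<exists>N0. \<forall>N\<ge>N0. \<forall>N'\<ge>N0. \<forall>t\<in>{0..T}. norm (mop h (U N t - U N' t)) \<le> e"
    if h: "\<And>k x y. (h k)\<^sup>2 * (norm (P k x))\<^sup>2 \<le> wt k * en k x y" and e: "0 < e" for h T e
  proof -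
    have "0 < e\<^sup>2" using e by simp
    then obtain N0 where N0: "\<And>N N' t n. N0 \<le> N \<Longrightarrow> N0 \<le> N' \<Longrightarrow> t \<in> {0..T} \<Longrightarrow>
      (\<Sum>k<n. wt k * en k (U N t - U N' t) (U' N t - U' N' t)) \<le> e\<^sup>2" using Cauchy by blast
    have "norm (mop h (U N t - U N' t)) \<le> e" if "N0 \<le> N" "N0 \<le> N'" "t \<in> {0..T}" for N N' t
      using that by (intro norm_mop_le_energy[OF truncated_mdom[OF truncated_diff[OF tr(1) tr(1)]] h N0 less_imp_le[OF e]]) auto
    then show ?thesis by blast
  qed
  have CY: "\<exists>N0. \<forall>N\<ge>N0. \<forall>N'\<ge>N0. \<forall>t\<in>{0..T}. norm (mop h (U' N t - U' N' t)) \<le> e"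
    if h: "\<And>k x y. (h k)\<^sup>2 * (norm (P k y))\<^sup>2 \<le> wt k * en k x y" and e: "0 < e" for h T e
  proof -
    have "0 < e\<^sup>2" using e by simp
    then obtain N0 where N0: "\<And>N N' t n. N0 \<le> N \<Longrightarrow> N0 \<le> N' \<Longrightarrow> t \<in> {0..T} \<Longrightarrow>
      (\<Sum>k<n. wt k * en k (U N t - U N' t) (U' N t - U' N' t)) \<le> e\<^sup>2" using Cauchy by blast
    have "norm (mop h (U' N t - U' N' t)) \<le> e" if "N0 \<le> N" "N0 \<le> N'" "t \<in> {0..T}" for N N' t
      using that by (intro norm_mop_le_energy[OF truncated_mdom[OF truncated_diff[OF tr(2) tr(2)]] h N0 less_imp_le[OF e]]) auto
    then show ?thesis by blast
  qed
  have id: "mop (\<lambda>_. 1) x = x" for x by (rule mop_eqI(2)) simp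
  have CX1: "\<exists>N0. \<forall>N\<ge>N0. \<forall>N'\<ge>N0. \<forall>t\<in>{0..T}. norm (U N t - U N' t) \<le> e" if "0 < e" for T e
    using CX[of "\<lambda>_. 1", unfolded id] that wt_en_ge(1) by simp
  have CY1: "\<exists>N0. \<forall>N\<ge>N0. \<forall>N'\<ge>N0. \<forall>t\<in>{0..T}. norm (U' N t - U' N' t) \<le> e" if "0 < e" for T e
    using CY[of "\<lambda>_. 1", unfolded id] that wt_en_ge(5) by simp
  define u where "u = (\<lambda>t. lim (\<lambda>N. U N t))"
  define u' where "u' = (\<lambda>t. lim (\<lambda>N. U' N t))"
  have domU: "U N t \<in> mdom h" "U' N t \<in> mdom h" if "0 \<le> t" for N t h
    using truncated_mdom tr that by blast+
  have limX: "uniform_limit {0..T} U u sequentially" "0 \<le> t \<Longrightarrow> u t \<in> mdom h"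
    "uniform_limit {0..T} (\<lambda>N t. mop h (U N t)) (\<lambda>t. mop h (u t)) sequentially"
    if h: "\<And>k x y. (h k)\<^sup>2 * (norm (P k x))\<^sup>2 \<le> wt k * en k x y" for h T t
    unfolding u_def by (rule uniform_limit_mop[OF domU(1) CX1 CX[OF h]]; assumption)+
  have limY: "uniform_limit {0..T} U' u' sequentially" "0 \<le> t \<Longrightarrow> u' t \<in> mdom h"
    "uniform_limit {0..T} (\<lambda>N t. mop h (U' N t)) (\<lambda>t. mop h (u' t)) sequentially"
    if h: "\<And>k x y. (h k)\<^sup>2 * (norm (P k y))\<^sup>2 \<le> wt k * en k x y" for h T t
    unfolding u'_def by (rule uniform_limit_mop[OF domU(2) CY1 CY[OF h]]; assumption)+
  note Xu = limX(1)[OF wt_en_ge(2)] and Yu = limY(1)[OF wt_en_ge(6)]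
    and u_aw = limX(2)[OF wt_en_ge(4)] and u'_aw = limY(2)[OF wt_en_ge(6)]
    and Xh = limX(3) and Yh = limY(3)[OF wt_en_ge(6)]
  have contU: "continuous_on {0..T} (\<lambda>t. mop h (U N t))" "continuous_on {0..T} (\<lambda>t. mop h (U' N t))"
    "continuous_on {0..T} (U N)" "continuous_on {0..T} (U' N)" for N h T
  proof -
    obtain S where S: "bounded_linear S" "\<And>x. truncated N x \<Longrightarrow> mop h x = S x"
      using bounded_linear_on_truncated by blast
    show c: "continuous_on {0..T} (U N)" "continuous_on {0..T} (U' N)"
      by (rule continuous_on_subset[OF continuous_on_vector_derivative_within], erule dU dU', simp)+
    have S': "continuous_on {0..T} (\<lambda>t. S (U N t))" "continuous_on {0..T} (\<lambda>t. S (U' N t))"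
      by (intro bounded_linear.continuous_on[OF S(1)] c)+
    show "continuous_on {0..T} (\<lambda>t. mop h (U N t))"
      by (rule continuous_on_eq[OF S'(1)]) (simp add: S(2)[OF tr(1)])
    show "continuous_on {0..T} (\<lambda>t. mop h (U' N t))"
      by (rule continuous_on_eq[OF S'(2)]) (simp add: S(2)[OF tr(2)])
  qed
  have cont_limit: "continuous_on {0..} g"
    if "\<And>T. uniform_limit {0..T} f g sequentially" "\<And>T N. continuous_on {0..T} (f N)" for f :: "nat \<Rightarrow> real \<Rightarrow> 'b::metric_space" and g
    by (rule continuous_on_atLeast, rule uniform_limit_theorem[OF _ that(1)]) (use that(2) in auto)
  have usg: "sg (u t) = (norm (mop lam (u t)))\<^sup>2" if "0 \<le> t" for t
    by (rule sg_eq[OF energy_domain(2)[OF u_aw[OF that]]])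
  have contlam: "continuous_on {0..} (\<lambda>t. mop lam (u t))"
    by (rule cont_limit[OF Xh[OF wt_en_ge(2)] contU(1)])
  have contsg: "continuous_on {0..} (\<lambda>t. sg (u t))"
  proof -
    have "continuous_on {0..} (\<lambda>t. (norm (mop lam (u t)))\<^sup>2)" by (intro continuous_intros contlam)
    then show ?thesis by (rule continuous_on_eq) (simp add: usg)
  qed
  show thesis
  proof (rule that[of u u'])
    have lim0: "(\<lambda>N. U N t) \<longlonglongrightarrow> u t" "(\<lambda>N. U' N t) \<longlonglongrightarrow> u' t" "(\<lambda>N. mop lam (U N t)) \<longlonglongrightarrow> mop lam (u t)" if "0 \<le> t" for t
      using tendsto_uniform_limitI[OF Xu[of t]] tendsto_uniform_limitI[OF Yu[of t]]
        tendsto_uniform_limitI[OF Xh[OF wt_en_ge(2), of t]] that by auto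
    have cutlim: "(\<lambda>N. cut N x) \<longlonglongrightarrow> x" for x using P_sums[of x] by (simp add: sums_def cut_def)
    show "u 0 = u0" using lim0(1)[of 0] cutlim[of u0] LIMSEQ_unique by (auto simp: U0)
    show "u' 0 = u1" using lim0(2)[of 0] cutlim[of u1] LIMSEQ_unique by (auto simp: U0)
    show "u t \<in> mdom (\<lambda>k. aw k * lam k)" if "0 \<le> t" for t by (rule u_aw[OF that])
    show "u' t \<in> mdom aw" if "0 \<le> t" for t by (rule u'_aw[OF that])
    show "continuous_on {0..} (\<lambda>t. sg (u t))" by (rule contsg)
    show "sg (u t) \<le> ((norm u1)\<^sup>2 + M0 * sg u0) / \<nu>" if t: "0 \<le> t" for t
    proof -
      have "(\<lambda>N. (norm (mop lam (U N t)))\<^sup>2) \<longlonglongrightarrow> (norm (mop lam (u t)))\<^sup>2" by (intro tendsto_intros lim0 t)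
      moreover have "(norm (mop lam (U N t)))\<^sup>2 \<le> H0 / \<nu>" for N
        using sgU[OF t, of N] sg_eq[OF domU(1)[OF t]] by simp
      ultimately have "(norm (mop lam (u t)))\<^sup>2 \<le> H0 / \<nu>" by (intro LIMSEQ_le_const2) auto
      then show ?thesis using usg[OF t] by (simp add: H0_def)
    qed
    show "continuous_on {0..} (\<lambda>t. (u t, mop (\<lambda>k. aw k * lam k) (u t)))"
      by (intro continuous_on_Pair cont_limit[OF Xu contU(3)] cont_limit[OF Xh[OF wt_en_ge(4)] contU(1)])
    show "continuous_on {0..} (\<lambda>t. (u' t, mop aw (u' t)))"
      by (intro continuous_on_Pair cont_limit[OF Yu contU(4)] cont_limit[OF Yh contU(2)])
    fix t :: real assume t: "0 \<le> t"
    show "((\<lambda>s. (u s, mop aw (u s))) has_vector_derivative (u' t, mop aw (u' t))) (at t within {0..})"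
    proof (rule has_vector_derivative_uniform_limit[OF _ _ _ t])
      show "uniform_limit {0..T} (\<lambda>N t. (U' N t, mop aw (U' N t))) (\<lambda>t. (u' t, mop aw (u' t))) sequentially" for T
        by (rule uniform_limit_Pair[OF Yu Yh])
      show "(\<lambda>N. (U N s, mop aw (U N s))) \<longlonglongrightarrow> (u s, mop aw (u s))" if "0 \<le> s" for s
        using tendsto_uniform_limitI[OF uniform_limit_Pair[OF Xu Xh[OF wt_en_ge(3)]], of s s] that by simp
      fix N and s :: real assume s: "0 \<le> s"
      obtain S where S: "bounded_linear S" "\<And>x. truncated N x \<Longrightarrow> mop aw x = S x"
        using bounded_linear_on_truncated by blast
      have "((\<lambda>s. (U N s, S (U N s))) has_vector_derivative (U' N s, S (U' N s))) (at s within {0..})"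
        by (intro has_vector_derivative_Pair dU s bounded_linear.has_vector_derivative[OF S(1)])
      then have "((\<lambda>s. (U N s, S (U N s))) has_vector_derivative (U' N s, mop aw (U' N s))) (at s within {0..})"
        by (simp add: S(2)[OF tr(2)[OF s]])
      then show "((\<lambda>s. (U N s, mop aw (U N s))) has_vector_derivative (U' N s, mop aw (U' N s))) (at s within {0..})"
        by (rule has_vector_derivative_transform[rotated 2]) (use s S(2) tr in auto)
    qed
    fix v assume v: "v \<in> mdom (\<lambda>k. (lam k)\<^sup>2)"
    \<comment> \<open>Testing with \<open>v\<close> moves A off the approximations, so convergence
      of \<open>U N\<close> and of the coefficient suffices; \<open>A u\<close> itself need not
      exist.\<close>
    have "((\<lambda>s. inner (u' s) v) has_vector_derivative - (m (sg (u t)) * inner (u t) (?A v))) (at t within {0..})"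
    proof (rule has_vector_derivative_uniform_limit[OF _ _ _ t])
      show "(\<lambda>N. inner (U' N s) v) \<longlonglongrightarrow> inner (u' s) v" if "0 \<le> s" for s
        by (intro tendsto_intros lim0 that)
      show "((\<lambda>s. inner (U' N s) v) has_vector_derivative - (m (sg (U N s)) * inner (U N s) (?A v))) (at s within {0..})"
        if s: "0 \<le> s" for s N
      proof -
        have "inner (?A (U N s)) v = inner (U N s) (?A v)"
          using sums_unique2[OF inner_mop[OF domU(1)[OF s], of "\<lambda>k. (lam k)\<^sup>2" N v]] inner_mop[OF v, of "U N s"]
          by (simp add: inner_commute)
        then show ?thesis
          using bounded_linear.has_vector_derivative[OF bounded_linear_inner_left dU'[OF s, of N], of v] by simp
      qed
      show "uniform_limit {0..T} (\<lambda>N s. - (m (sg (U N s)) * inner (U N s) (?A v)))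
          (\<lambda>s. - (m (sg (u s)) * inner (u s) (?A v))) sequentially" for T
      proof -
        have bdd: "bounded (f ` {0..T})" if "continuous_on {0..} f" for f :: "real \<Rightarrow> real"
          by (intro compact_imp_bounded compact_continuous_image continuous_on_subset[OF that]) auto
        have n: "uniform_limit {0..T} (\<lambda>N s. norm (mop lam (U N s))) (\<lambda>s. norm (mop lam (u s))) sequentially"
          by (rule uniform_limit_norm[OF Xh[OF wt_en_ge(2)]])
        have cn: "continuous_on {0..} (\<lambda>s. norm (mop lam (u s)))" by (intro continuous_intros contlam)
        have "uniform_limit {0..T} (\<lambda>N s. norm (mop lam (U N s)) * norm (mop lam (U N s)))
            (\<lambda>s. norm (mop lam (u s)) * norm (mop lam (u s))) sequentially"
          by (rule uniform_lim_mult[OF n n bdd[OF cn] bdd[OF cn]])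
        then have "uniform_limit {0..T} (\<lambda>N s. sg (U N s)) (\<lambda>s. sg (u s)) sequentially"
          by (rule uniform_limit_cong'[THEN iffD1, rotated -1])
             (auto simp: usg sg_eq[OF domU(1)] power2_eq_square)
        moreover have ucm: "uniformly_continuous_on UNIV m"
          by (rule lipschitz_on_uniformly_continuous[of \<Lambda>]) (auto intro!: lipschitz_onI m_Lipschitz simp: dist_real_def \<Lambda>_nonneg)
        ultimately have mm: "uniform_limit {0..T} (\<lambda>N s. m (sg (U N s))) (\<lambda>s. m (sg (u s))) sequentially"
          by (rule uniform_limit_compose_uniformly_continuous_on) auto
        have cm: "continuous_on {0..} (\<lambda>s. m (sg (u s)))"
          by (rule continuous_on_compose2[OF uniformly_continuous_imp_continuous[OF ucm] contsg]) auto
        have ci: "continuous_on {0..} (\<lambda>s. inner (u s) (?A v))"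
          by (intro continuous_intros cont_limit[OF Xu contU(3)])
        have ii: "uniform_limit {0..T} (\<lambda>N s. inner (U N s) (?A v)) (\<lambda>s. inner (u s) (?A v)) sequentially"
          by (rule bounded_linear.uniform_limit[OF bounded_linear_inner_left Xu])
        show ?thesis by (intro uniform_limit_uminus uniform_lim_mult[OF mm ii bdd[OF cm] bdd[OF ci]])
      qed
    qed
    then show "((\<lambda>s. inner (u' s) v) has_real_derivative - (m (sg (u t)) * inner (u t) (?A v))) (at t within {0..})"
      by (simp add: has_real_derivative_iff_has_vector_derivative)
  qed
qed

end

section \<open>Uniqueness\<close>

lemma at_within_atLeast_neq_bot:
  fixes t :: real
  assumes "0 \<le> t"
  shows "at t within {0..} \<noteq> bot"
proof
  assume "at t within {0..} = bot"
  moreover have "at_right t \<le> at t within {0..}" using assms by (intro at_le) auto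
  ultimately show False using trivial_limit_at_right_real[of t] by (simp add: bot_unique)
qed

context kirchhoff_gap
begin

lemma norm_mop_lam_le:
  assumes "x \<in> mdom (\<lambda>k. aw k * lam k)"
  shows "(norm (mop lam x))\<^sup>2 \<le> (norm x)\<^sup>2 + (norm (mop (\<lambda>k. aw k * lam k) x))\<^sup>2"
proof (rule sums_le)
  show "(lam k)\<^sup>2 * (norm (P k x))\<^sup>2 \<le> (norm (P k x))\<^sup>2 + (aw k * lam k)\<^sup>2 * (norm (P k x))\<^sup>2" for k
    using mult_right_mono[OF weights_le(2)[of k], of "(norm (P k x))\<^sup>2"] by (simp add: algebra_simps)
  show "(\<lambda>k. (norm (P k x))\<^sup>2 + (aw k * lam k)\<^sup>2 * (norm (P k x))\<^sup>2) sums
      ((norm x)\<^sup>2 + (norm (mop (\<lambda>k. aw k * lam k) x))\<^sup>2)"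
    by (intro sums_add norm_sums norm_mop assms)
qed (rule norm_mop[OF energy_domain(2)[OF assms]])

lemma continuous_on_mop_lam:
  fixes u :: "real \<Rightarrow> 'a"
  assumes dom: "\<And>t. 0 \<le> t \<Longrightarrow> u t \<in> mdom (\<lambda>k. aw k * lam k)"
    and cont: "continuous_on {0..} (\<lambda>t. (u t, mop (\<lambda>k. aw k * lam k) (u t)))"
  shows "continuous_on {0..} (\<lambda>t. mop lam (u t))" "continuous_on {0..} (\<lambda>t. sg (u t))"
proof -
  let ?h = "\<lambda>k. aw k * lam k"
  have le: "dist (mop lam (u s)) (mop lam (u t)) \<le> dist (u s, mop ?h (u s)) (u t, mop ?h (u t))"
    if st: "0 \<le> s" "0 \<le> t" for s t
  proof -
    note d = mop_diff[OF dom[OF st(1)] dom[OF st(2)]]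
    note dl = mop_diff(2)[OF energy_domain(2)[OF dom[OF st(1)]] energy_domain(2)[OF dom[OF st(2)]]]
    have "(dist (mop lam (u s)) (mop lam (u t)))\<^sup>2 \<le> (dist (u s) (u t))\<^sup>2 + (dist (mop ?h (u s)) (mop ?h (u t)))\<^sup>2"
      using norm_mop_lam_le[OF d(1)] by (simp add: dist_norm dl d(2))
    then show ?thesis unfolding dist_Pair_Pair by (intro real_le_rsqrt)
  qed
  show c: "continuous_on {0..} (\<lambda>t. mop lam (u t))"
    unfolding continuous_on_iff
  proof (intro ballI allI impI)
    fix x e :: real assume "x \<in> {0..}" "0 < e"
    then obtain d where d: "0 < d" "\<And>y. y \<in> {0..} \<Longrightarrow> dist y x < d \<Longrightarrow> dist (u y, mop ?h (u y)) (u x, mop ?h (u x)) < e"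
      using cont unfolding continuous_on_iff by blast
    then show "\<exists>d>0. \<forall>y\<in>{0..}. dist y x < d \<longrightarrow> dist (mop lam (u y)) (mop lam (u x)) < e"
      using le \<open>x \<in> {0..}\<close> by (intro exI[of _ d]) (auto intro: le_less_trans)
  qed
  have "continuous_on {0..} (\<lambda>t. (norm (mop lam (u t)))\<^sup>2)" by (intro continuous_intros c)
  then show "continuous_on {0..} (\<lambda>t. sg (u t))"
    by (rule continuous_on_eq) (simp add: sg_eq[OF energy_domain(2)[OF dom]])
qed

text \<open>Testing with \<open>P k z\<close> gives weak derivatives of components. They become
  derivatives in norm because the right-hand side is continuous: its antiderivative differs from
  \<open>P k (u' t)\<close> by a vector that is constant when tested with any
  \<open>z\<close>.\<close>

lemma component_solution_of_weak:
  assumes du: "\<And>t. 0 \<le> t \<Longrightarrow> (u has_vector_derivative u' t) (at t within {0..})"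
    and c: "continuous_on {0..} c"
    and weak: "\<And>t k z. 0 \<le> t \<Longrightarrow>
      ((\<lambda>s. inner (u' s) (P k z)) has_real_derivative - (c t * (lam k)\<^sup>2 * inner (u t) (P k z))) (at t within {0..})"
  shows "component_solution c u u'"
  unfolding component_solution_def
proof (intro allI impI conjI)
  fix k t assume t: "(0::real) \<le> t"
  show "((\<lambda>s. P k (u s)) has_vector_derivative P k (u' t)) (at t within {0..})"
    by (rule bounded_linear.has_vector_derivative[OF P_bl du[OF t]])
  define f where "f = (\<lambda>t. (- (c t * (lam k)\<^sup>2)) *\<^sub>R P k (u t))"
  have cu: "continuous_on {0..} u" by (rule continuous_on_vector_derivative_within[OF du])
  have "continuous_on {0..} f"
    unfolding f_def by (intro continuous_intros c bounded_linear.continuous_on[OF P_bl cu])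
  then obtain F where F: "F 0 = 0" "\<And>t. 0 \<le> t \<Longrightarrow> (F has_vector_derivative f t) (at t within {0..})"
    using antiderivative_exists by blast
  have eq: "P k (u' s) = P k (u' 0) + F s" if s: "0 \<le> s" for s
  proof -
    have "inner (P k (u' s) - F s) z = inner (P k (u' 0) - F 0) z" for z
    proof (rule zero_derivative_constant[OF _ s, of "\<lambda>s. inner (P k (u' s) - F s) z"])
      fix r :: real assume r: "0 \<le> r"
      have "((\<lambda>s. inner (u' s) (P k z) - inner (F s) z) has_vector_derivative
          (- (c r * (lam k)\<^sup>2 * inner (u r) (P k z)) - inner (f r) z)) (at r within {0..})"
        using weak[OF r, of k z] bounded_linear.has_vector_derivative[OF bounded_linear_inner_left F(2)[OF r], of z]
        by (intro has_vector_derivative_diff) (simp_all add: has_real_derivative_iff_has_vector_derivative)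
      then show "((\<lambda>s. inner (P k (u' s) - F s) z) has_vector_derivative 0) (at r within {0..})"
        by (simp add: inner_diff_left P_sym f_def)
    qed
    from this[of "(P k (u' s) - F s) - P k (u' 0)"]
    have "inner ((P k (u' s) - F s) - P k (u' 0)) ((P k (u' s) - F s) - P k (u' 0)) = 0"
      by (simp add: F(1) inner_diff_left)
    then have "P k (u' s) - F s - P k (u' 0) = 0" by (simp only: inner_eq_zero_iff)
    then show ?thesis by (simp add: algebra_simps)
  qed
  have "((\<lambda>s. P k (u' 0) + F s) has_vector_derivative f t) (at t within {0..})"
    using has_vector_derivative_add[OF has_vector_derivative_const F(2)[OF t]] by simp
  then have "((\<lambda>s. P k (u' s)) has_vector_derivative f t) (at t within {0..})"
    by (rule has_vector_derivative_transform[rotated 2]) (use t in simp, rule eq, simp)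
  then show "((\<lambda>s. P k (u' s)) has_vector_derivative (- (c t * (lam k)\<^sup>2)) *\<^sub>R P k (u t)) (at t within {0..})"
    by (simp add: f_def)
qed

lemma energy_bounded:
  fixes u u' :: "real \<Rightarrow> 'a"
  assumes dom: "\<And>t. 0 \<le> t \<Longrightarrow> u t \<in> mdom (\<lambda>k. aw k * lam k)" "\<And>t. 0 \<le> t \<Longrightarrow> u' t \<in> mdom aw"
    and cont: "continuous_on {0..} (\<lambda>t. (u t, mop (\<lambda>k. aw k * lam k) (u t)))"
      "continuous_on {0..} (\<lambda>t. (u' t, mop aw (u' t)))"
  obtains B where "\<And>n t. t \<in> {0..T} \<Longrightarrow> (\<Sum>k<n. (1 + lam k) * en k (u t) (u' t)) \<le> B"
proof -
  let ?h = "\<lambda>k. aw k * lam k"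
  \<comment> \<open>The factors 3 come from \<open>wt_en_eq\<close>: by \<open>weights_le\<close>
    the terms with the squares of \<open>lam k\<close> and of \<open>aw k\<close> each add one copy
    to the two terms already there. The 2 is that of
    \<open>1 + lam k \<le> 2 * wt k\<close>.\<close>
  define q where "q = (\<lambda>t. 2 * ((norm (u' t))\<^sup>2 + (norm (mop aw (u' t)))\<^sup>2 + 3 * (norm (u t))\<^sup>2 + 3 * (norm (mop ?h (u t)))\<^sup>2))"
  have "continuous_on {0..} q"
    unfolding q_def
    by (intro continuous_intros continuous_on_fst[OF cont(1), simplified] continuous_on_snd[OF cont(1), simplified]
        continuous_on_fst[OF cont(2), simplified] continuous_on_snd[OF cont(2), simplified])
  then have "continuous_on {0..T} q" by (rule continuous_on_subset) simp
  then have "compact (q ` {0..T})" by (rule compact_continuous_image) simp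
  then obtain B where B': "\<And>x. x \<in> q ` {0..T} \<Longrightarrow> norm x \<le> B"
    using compact_imp_bounded bounded_iff by metis
  have B: "q t \<le> B" if "t \<in> {0..T}" for t using B'[of "q t"] that by (auto simp: abs_le_iff)
  have "(\<Sum>k<n. (1 + lam k) * en k (u t) (u' t)) \<le> q t" if t: "0 \<le> t" for n t
  proof -
    let ?s = "\<lambda>k. 2 * ((norm (P k (u' t)))\<^sup>2 + (aw k)\<^sup>2 * (norm (P k (u' t)))\<^sup>2 + 3 * (norm (P k (u t)))\<^sup>2 + 3 * ((?h k)\<^sup>2 * (norm (P k (u t)))\<^sup>2))"
    have s: "?s sums q t"
      unfolding q_def by (intro sums_mult sums_add norm_sums norm_mop dom t)
    have "(1 + lam k) * en k (u t) (u' t) \<le> ?s k" for k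
    proof -
      have 1: "(1 + lam k) * en k (u t) (u' t) \<le> 2 * (wt k * en k (u t) (u' t))"
        using mult_right_mono[OF wt_ge(3)[of k] en_nonneg[of k "u t" "u' t"]] by simp
      have 2: "(aw k)\<^sup>2 * (norm (P k (u t)))\<^sup>2 \<le> (norm (P k (u t)))\<^sup>2 + (?h k)\<^sup>2 * (norm (P k (u t)))\<^sup>2"
        using mult_right_mono[OF weights_le(1)[of k], of "(norm (P k (u t)))\<^sup>2"] by (simp add: algebra_simps)
      have 3: "(lam k)\<^sup>2 * (norm (P k (u t)))\<^sup>2 \<le> (norm (P k (u t)))\<^sup>2 + (?h k)\<^sup>2 * (norm (P k (u t)))\<^sup>2"
        using mult_right_mono[OF weights_le(2)[of k], of "(norm (P k (u t)))\<^sup>2"] by (simp add: algebra_simps)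
      show ?thesis using 1 2 3 unfolding wt_en_eq by argo
    qed
    then have "(\<Sum>k<n. (1 + lam k) * en k (u t) (u' t)) \<le> (\<Sum>k<n. ?s k)" by (intro sum_mono)
    also have "\<dots> \<le> suminf ?s" by (rule sum_le_suminf) (use sums_summable[OF s] in auto)
    also have "\<dots> = q t" using s by (simp add: sums_iff)
    finally show ?thesis .
  qed
  then show thesis using that B by (meson atLeastAtMost_iff order_trans)
qed

text \<open>\<open>continuous_dependence\<close> with equal data, that is with
  \<open>W0 = 0\<close>. The coefficient \<open>n\<close> is the original one, Lipschitz on bounded
  intervals; up to time \<open>t\<close> the values of \<open>sg\<close> along both solutions stay
  below a common \<open>B\<close>.\<close>

theorem uniqueness:
  fixes n :: "real \<Rightarrow> real"
  assumes u: "\<And>t. 0 \<le> t \<Longrightarrow> u t \<in> mdom (\<lambda>k. aw k * lam k)" "\<And>t. 0 \<le> t \<Longrightarrow> u' t \<in> mdom aw"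
      "continuous_on {0..} (\<lambda>t. (u t, mop (\<lambda>k. aw k * lam k) (u t)))"
      "continuous_on {0..} (\<lambda>t. (u' t, mop aw (u' t)))"
      "component_solution (\<lambda>t. n (sg (u t))) u u'"
    and v: "\<And>t. 0 \<le> t \<Longrightarrow> v t \<in> mdom (\<lambda>k. aw k * lam k)" "\<And>t. 0 \<le> t \<Longrightarrow> v' t \<in> mdom aw"
      "continuous_on {0..} (\<lambda>t. (v t, mop (\<lambda>k. aw k * lam k) (v t)))"
      "continuous_on {0..} (\<lambda>t. (v' t, mop aw (v' t)))"
      "component_solution (\<lambda>t. n (sg (v t))) v v'"
    and init: "u 0 = v 0" "u' 0 = v' 0"
    and n: "\<And>B. \<exists>L. L-lipschitz_on {0..B} n" "0 < \<nu>'" "\<And>s. 0 \<le> s \<Longrightarrow> \<nu>' \<le> n s"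
    and t: "0 \<le> t"
  shows "u t = v t"
proof -
  obtain B1 where B1: "\<And>n r. r \<in> {0..t} \<Longrightarrow> (\<Sum>k<n. (1 + lam k) * en k (u r) (u' r)) \<le> B1"
    using energy_bounded[OF u(1-4)] by blast
  obtain B2 where B2: "\<And>n r. r \<in> {0..t} \<Longrightarrow> (\<Sum>k<n. (1 + lam k) * en k (v r) (v' r)) \<le> B2"
    using energy_bounded[OF v(1-4)] by blast
  define B where "B = max B1 B2"
  have Bu: "(\<Sum>k<n. (1 + lam k) * en k (u r) (u' r)) \<le> B" and Bv: "(\<Sum>k<n. (1 + lam k) * en k (v r) (v' r)) \<le> B"
    if "r \<in> {0..t}" for n r
    using B1[OF that, of n] B2[OF that, of n] by (auto simp: B_def)
  have B0: "0 \<le> B" using Bu[of 0 0] t by simp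
  obtain L where L: "L-lipschitz_on {0..B} n" using n(1) by blast
  have L0: "0 \<le> L" using L by (rule lipschitz_on_nonneg)
  have nL: "\<bar>n x - n y\<bar> \<le> L * \<bar>x - y\<bar>" if "x \<in> {0..B}" "y \<in> {0..B}" for x y
    using lipschitz_onD[OF L that] by (simp add: dist_real_def)
  have nM: "n x \<le> n 0 + L * B" if x: "x \<in> {0..B}" for x
  proof -
    have "n x - n 0 \<le> L * \<bar>x - 0\<bar>" using nL[OF x, of 0] B0 by simp
    also have "\<dots> \<le> L * B" using x L0 by (intro mult_left_mono) auto
    finally show ?thesis by simp
  qed
  have z: "(\<Sum>k<j. en k (u 0 - v 0) (u' 0 - v' 0) / (1 + lam k)) \<le> 0" for j
    using init by (simp add: en_def P_zero)
  have tt: "t \<in> {0..t}" using t by simp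
  have le: "(\<Sum>k<j. en k (u t - v t) (u' t - v' t) / (1 + lam k)) \<le>
      2 * (max 1 (n 0 + L * B) / min 1 \<nu>') * exp ((L * B / \<nu>' + 1 + 8 * L * B / min 1 \<nu>' + 1) * t) * 0" for j
    by (rule continuous_dependence[where m = n, OF u(5) v(5) t Bu Bv nL n(3) nM refl refl n(2) L0 z tt]) auto
  have "P k (u t) = P k (v t)" for k
  proof -
    have nn: "0 \<le> en i (u t - v t) (u' t - v' t) / (1 + lam i)" for i
      using lam_nonneg[of i] en_nonneg by (simp add: divide_nonneg_nonneg)
    have "en k (u t - v t) (u' t - v' t) / (1 + lam k) \<le> (\<Sum>i<Suc k. en i (u t - v t) (u' t - v' t) / (1 + lam i))"
      using nn by (intro member_le_sum[of k]) auto
    then have "en k (u t - v t) (u' t - v' t) / (1 + lam k) \<le> 0" using le[of "Suc k"] by simp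
    then have "en k (u t - v t) (u' t - v' t) \<le> 0"
      using lam_nonneg[of k] by (simp add: divide_le_0_iff)
    then have "(norm (P k (u t - v t)))\<^sup>2 \<le> 0" using norm_P_fst_le_en order_trans by blast
    then show ?thesis by (simp add: P_diff)
  qed
  then show ?thesis by (rule decomposition_eqI)
qed

end

section \<open>The Cauchy problem\<close>

lemma power_fun_measurable: "power_fun \<beta> \<in> borel_measurable borel"
  unfolding power_fun_def[abs_def] by measurable

text \<open>Since \<open>exp x \<ge> x + 1\<close>, the gap condition separates the eigenvalues by
  at least 1, as the decomposition theorem demands. From here on A and its powers can be handled as
  explicit multipliers.\<close>

lemma spectral_gap_decomposition:
  assumes "self_adjoint_operator D A" and lam0: "\<And>k. 0 \<le> lam k"
    and spec: "op_spectrum D A = range (\<lambda>k. (lam k)\<^sup>2)" "\<And>k. op_eigenvalue D A ((lam k)\<^sup>2)"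
    and gap: "\<And>k. exp (lam k) \<le> lam (Suc k)"
  obtains P where "orthogonal_decomposition P" "\<And>k x. P k x \<in> D" "\<And>k x. A (P k x) = (lam k)\<^sup>2 *\<^sub>R P k x"
    "D = orthogonal_decomposition.mdom P (\<lambda>k. (lam k)\<^sup>2)"
    "\<And>x. x \<in> D \<Longrightarrow> A x = orthogonal_decomposition.mop P (\<lambda>k. (lam k)\<^sup>2) x"
    "\<And>\<beta>. op_power_dom D A \<beta> = orthogonal_decomposition.mdom P (\<lambda>k. power_fun \<beta> ((lam k)\<^sup>2))"
    "\<And>\<beta> x. x \<in> orthogonal_decomposition.mdom P (\<lambda>k. power_fun \<beta> ((lam k)\<^sup>2)) \<Longrightarrow>
      op_power D A \<beta> x = orthogonal_decomposition.mop P (\<lambda>k. power_fun \<beta> ((lam k)\<^sup>2)) x"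
proof -
  interpret self_adjoint D A by unfold_locales fact
  have Suc: "lam k + 1 \<le> lam (Suc k)" for k
    using gap[of k] exp_ge_add_one_self[of "lam k"] by linarith
  have mono: "lam j + 1 \<le> lam k" if "j < k" for j k
    using that
  proof (induction rule: strict_inc_induct)
    case (base i)
    then show ?case using Suc by simp
  next
    case (step i)
    then show ?case using Suc[of i] by simp
  qed
  have sq: "1 \<le> (lam k)\<^sup>2 - (lam j)\<^sup>2" if "j < k" for j k
  proof -
    have "1 * 1 \<le> (lam k - lam j) * (lam k + lam j)"
      using mono[OF that] lam0[of j] by (intro mult_mono) auto
    then show ?thesis by (simp add: power2_eq_square algebra_simps)
  qed
  have sep: "1 \<le> \<bar>(lam j)\<^sup>2 - (lam k)\<^sup>2\<bar>" if "j \<noteq> k" for j k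
    using sq[of j k] sq[of k j] that by (cases "j < k") auto
  obtain P where P: "orthogonal_decomposition P" "\<And>k x. P k x \<in> eigenspace ((lam k)\<^sup>2)"
    using discrete_spectrum_decomposition[OF spec(1) zero_less_one sep] by metis
  interpret orthogonal_decomposition P by fact
  \<comment> \<open>Indices 1 and 2, because \<open>lam 0\<close> may be 0 whereas these two
    eigenvalues are nonzero and distinct, as \<open>E_singleton_zero\<close> demands.\<close>
  obtain e where e: "e \<in> eigenspace ((lam 1)\<^sup>2)" "e \<noteq> 0"
    using spec(2)[of 1] by (auto simp: op_eigenvalue_def eigenspace_def)
  obtain e' where e': "e' \<in> eigenspace ((lam 2)\<^sup>2)" "e' \<noteq> 0"
    using spec(2)[of 2] by (auto simp: op_eigenvalue_def eigenspace_def)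
  have nz: "(lam 1)\<^sup>2 \<noteq> 0" "(lam 2)\<^sup>2 \<noteq> 0" "(lam 1)\<^sup>2 \<noteq> (lam 2)\<^sup>2"
    using mono[of 0 1] mono[of 0 2] sq[of 1 2] lam0[of 0] by auto
  note E = spectral_measure_of_discrete[OF P e nz(1) e' nz(2,3)]
  note D = domain_eq_mdom[OF P]
  show thesis
  proof (rule that[OF P(1)])
    show "P k x \<in> D" "A (P k x) = (lam k)\<^sup>2 *\<^sub>R P k x" for k x
      using P(2)[of k x] by (auto simp: eigenspace_def)
    show "op_power_dom D A \<beta> = mdom (\<lambda>k. power_fun \<beta> ((lam k)\<^sup>2))" for \<beta>
      unfolding op_power_dom_def by (rule spectral_dom_discrete[OF E power_fun_measurable])
    show "op_power D A \<beta> x = mop (\<lambda>k. power_fun \<beta> ((lam k)\<^sup>2)) x"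
      if "x \<in> mdom (\<lambda>k. power_fun \<beta> ((lam k)\<^sup>2))" for \<beta> x
      unfolding op_power_def by (rule spectral_integral_discrete[OF E power_fun_measurable that])
  qed (rule D, rule D)
qed

lemma C1_intoD:
  fixes X :: "'a::real_normed_vector set"
  assumes "C1_into X B u"
  obtains u' where "C0_into X B u'" "\<And>t. 0 \<le> t \<Longrightarrow> (u has_vector_derivative u' t) (at t within {0..})"
proof -
  obtain u' where u': "C0_into X B u'"
    "\<And>t. 0 \<le> t \<Longrightarrow> ((\<lambda>s. graph_embed B (u s)) has_vector_derivative graph_embed B (u' t)) (at t within {0..})"
    using assms by (auto simp: C1_into_def)
  have "(u has_vector_derivative u' t) (at t within {0..})" if "0 \<le> t" for t
    using bounded_linear.has_vector_derivative[OF bounded_linear_fst u'(2)[OF that]] by (simp add: graph_embed_def)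
  then show thesis using that u'(1) by blast
qed

theorem theorem4p1:
  fixes D :: "'a::{real_inner, complete_space} set"
    and A :: "'a \<Rightarrow> 'a"
    and lam :: "nat \<Rightarrow> real"
    and m :: "real \<Rightarrow> real"
    and \<alpha> :: real
    and u0 u1 :: 'a
  assumes "separable_space (euclidean :: 'a topology)"
    and "self_adjoint_operator D A"
    and "nonnegative_operator D A"
    and "\<And>k. 0 \<le> lam k"
    and "op_spectrum D A = range (\<lambda>k. (lam k)\<^sup>2)"
    and "\<And>k. op_eigenvalue D A ((lam k)\<^sup>2)"
    and "\<And>k. exp (lam k) \<le> lam (Suc k)"
    and "\<And>\<sigma>. 0 \<le> \<sigma> \<Longrightarrow> 0 < m \<sigma>"
    and "local_lipschitz (UNIV :: real set) {0..} (\<lambda>_. m)"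
    and "0 < (INF \<sigma>\<in>{0..}. m \<sigma>)"
    and "1/4 < \<alpha>"
    and "u0 \<in> op_power_dom D A (\<alpha> + 1/2)"
    and "u1 \<in> op_power_dom D A \<alpha>"
  shows "(\<exists>u. kirchhoff_class_solution D A m \<alpha> u0 u1 u) \<and>
    (\<forall>u w. kirchhoff_class_solution D A m \<alpha> u0 u1 u \<longrightarrow>
       kirchhoff_class_solution D A m \<alpha> u0 u1 w \<longrightarrow> (\<forall>t\<ge>0. u t = w t))"
proof -
  obtain P where P: "orthogonal_decomposition P" "\<And>k x. P k x \<in> D" "\<And>k x. A (P k x) = (lam k)\<^sup>2 *\<^sub>R P k x"
    "D = orthogonal_decomposition.mdom P (\<lambda>k. (lam k)\<^sup>2)"
    "\<And>x. x \<in> D \<Longrightarrow> A x = orthogonal_decomposition.mop P (\<lambda>k. (lam k)\<^sup>2) x"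
    "\<And>\<beta>. op_power_dom D A \<beta> = orthogonal_decomposition.mdom P (\<lambda>k. power_fun \<beta> ((lam k)\<^sup>2))"
    "\<And>\<beta> x. x \<in> orthogonal_decomposition.mdom P (\<lambda>k. power_fun \<beta> ((lam k)\<^sup>2)) \<Longrightarrow>
      op_power D A \<beta> x = orthogonal_decomposition.mop P (\<lambda>k. power_fun \<beta> ((lam k)\<^sup>2)) x"
    using spectral_gap_decomposition[OF assms(2,4-7)] by blast
  interpret orthogonal_decomposition P by fact
  interpret wave_frame P lam by unfold_locales (rule assms(4))
  define \<nu> where "\<nu> = (INF \<sigma>\<in>{0..}. m \<sigma>)"
  have \<nu>: "0 < \<nu>" using assms(10) by (simp add: \<nu>_def)
  have m\<nu>: "\<nu> \<le> m s" if "0 \<le> s" for s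
    unfolding \<nu>_def using that assms(8) by (intro cINF_lower bdd_belowI2[where m=0]) (auto intro: less_imp_le)
  have lip: "\<exists>L. L-lipschitz_on {0..B} m" for B
  proof -
    have "local_lipschitz (UNIV :: real set) {0..B} (\<lambda>_. m)"
      by (rule local_lipschitz_subset[OF assms(9)]) auto
    then have ll: "local_lipschitz {0::real} {0..B} (\<lambda>_. m)"
      by (rule local_lipschitz_subset) auto
    obtain L where "\<And>t. t \<in> {0::real} \<Longrightarrow> L-lipschitz_on {0..B} m"
      by (rule local_lipschitz_compact_implies_lipschitz[OF ll]) auto
    then show ?thesis by blast
  qed
  have contm: "continuous_on {0..} m"
    using lip by (intro continuous_on_atLeast) (metis lipschitz_on_continuous_on)
  let ?sig = "sg u0"
  obtain L0 where L0: "L0-lipschitz_on {0..?sig} m" using lip by blast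
  define M0 where "M0 = m 0 + L0 * ?sig"
  have M0: "m s \<le> M0" if "0 \<le> s" "s \<le> ?sig" for s
  proof -
    have "m s - m 0 \<le> L0 * \<bar>s - 0\<bar>"
      using lipschitz_onD[OF L0, of s 0] that by (auto simp: dist_real_def)
    also have "\<dots> \<le> L0 * ?sig" using that lipschitz_on_nonneg[OF L0] by (intro mult_left_mono) auto
    finally show ?thesis by (simp add: M0_def)
  qed
  \<comment> \<open>At least the a priori bound of \<open>sg\<close> obtained from
    \<open>M0\<close>. As \<open>M0\<close> involves \<open>m\<close> only up to
    \<open>sg u0\<close>, the radius and the bound do not depend on each other circularly.\<close>
  define R where "R = max (max 0 ?sig) (((norm u1)\<^sup>2 + M0 * ?sig) / \<nu>)"
  have R: "0 \<le> R" "?sig \<le> R" "((norm u1)\<^sup>2 + M0 * ?sig) / \<nu> \<le> R" by (auto simp: R_def)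
  obtain \<Lambda> where \<Lambda>: "\<Lambda>-lipschitz_on {0..R} m" using lip by blast
  \<comment> \<open>Clamping the argument makes the coefficient globally Lipschitz and bounded,
    keeps the lower bound \<nu>, and makes it constant beyond \<open>R\<close>.\<close>
  define mt where "mt = (\<lambda>s. m (max 0 (min s R)))"
  have mt_eq: "mt s = m s" if "0 \<le> s" "s \<le> R" for s using that by (simp add: mt_def)
  have clamp: "max 0 (min s R) \<in> {0..R}" for s using R by auto
  have \<Lambda>0: "0 \<le> \<Lambda>" by (rule lipschitz_on_nonneg[OF \<Lambda>])
  interpret kirchhoff_gap P lam \<alpha> mt \<Lambda> \<nu> "m 0 + \<Lambda> * R"
  proof
    show "\<bar>mt s - mt t\<bar> \<le> \<Lambda> * \<bar>s - t\<bar>" for s t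
    proof -
      have "\<bar>mt s - mt t\<bar> \<le> \<Lambda> * \<bar>max 0 (min s R) - max 0 (min t R)\<bar>"
        using lipschitz_onD[OF \<Lambda> clamp clamp] by (simp add: mt_def dist_real_def)
      also have "\<dots> \<le> \<Lambda> * \<bar>s - t\<bar>" by (intro mult_left_mono \<Lambda>0) (auto simp: max_def min_def)
      finally show ?thesis .
    qed
    show "mt s \<le> m 0 + \<Lambda> * R" for s
    proof -
      have "m (max 0 (min s R)) - m 0 \<le> \<Lambda> * \<bar>max 0 (min s R) - 0\<bar>"
        using lipschitz_onD[OF \<Lambda> clamp[of s], of 0] R(1) by (auto simp: dist_real_def)
      also have "\<dots> \<le> \<Lambda> * R" using clamp[of s] by (intro mult_left_mono \<Lambda>0) auto
      finally show ?thesis by (simp add: mt_def)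
    qed
  qed (use assms(7,11) m\<nu> \<nu> in \<open>auto simp: mt_def\<close>)
  have pa: "(\<lambda>k. power_fun \<alpha> ((lam k)\<^sup>2)) = aw"
    using assms(11) by (auto simp: power_fun_def aw_def)
  have pl: "(\<lambda>k. power_fun (1/2) ((lam k)\<^sup>2)) = lam"
    using lam_nonneg by (auto simp: power_fun_def powr_half_sqrt)
  have pal: "(\<lambda>k. power_fun (\<alpha> + 1/2) ((lam k)\<^sup>2)) = (\<lambda>k. aw k * lam k)"
  proof
    fix k
    have "((lam k)\<^sup>2) powr (\<alpha> + 1/2) = ((lam k)\<^sup>2) powr \<alpha> * ((lam k)\<^sup>2) powr (1/2)" by (rule powr_add)
    then show "power_fun (\<alpha> + 1/2) ((lam k)\<^sup>2) = aw k * lam k"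
      using assms(11) lam_nonneg[of k] by (simp add: power_fun_def aw_def powr_half_sqrt)
  qed
  note dom_a = P(6)[of \<alpha>, unfolded pa] and dom_al = P(6)[of "\<alpha> + 1/2", unfolded pal]
  note pow_a = P(7)[of _ \<alpha>, unfolded pa] and pow_al = P(7)[of _ "\<alpha> + 1/2", unfolded pal]
    and pow_l = P(7)[of _ "1/2", unfolded pl]
  have sg_pow: "(norm (op_power D A (1/2) x))\<^sup>2 = sg x" if "x \<in> mdom (\<lambda>k. aw k * lam k)" for x
    using energy_domain(2)[OF that] by (simp add: pow_l sg_eq)
  have C0a: "C0_into (op_power_dom D A \<alpha>) (op_power D A \<alpha>) u \<longleftrightarrow>
      (\<forall>t\<ge>0. u t \<in> mdom aw) \<and> continuous_on {0..} (\<lambda>t. (u t, mop aw (u t)))" for u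
    unfolding C0_into_def dom_a graph_embed_def
    by (rule conj_cong[OF refl], rule continuous_on_cong) (auto simp: pow_a)
  have C0al: "C0_into (op_power_dom D A (\<alpha> + 1/2)) (op_power D A (\<alpha> + 1/2)) u \<longleftrightarrow>
      (\<forall>t\<ge>0. u t \<in> mdom (\<lambda>k. aw k * lam k)) \<and> continuous_on {0..} (\<lambda>t. (u t, mop (\<lambda>k. aw k * lam k) (u t)))" for u
    unfolding C0_into_def dom_al graph_embed_def
    by (rule conj_cong[OF refl], rule continuous_on_cong) (auto simp: pow_al)
  have "\<exists>u. kirchhoff_class_solution D A m \<alpha> u0 u1 u"
  proof -
    have mtM0: "mt s \<le> M0" if "0 \<le> s" "s \<le> ?sig" for s using M0[OF that] that R by (simp add: mt_eq)
    have mtR: "mt s = mt R" if "R \<le> s" for s using that by (simp add: mt_def)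
    obtain u u' where u: "u 0 = u0" "u' 0 = u1"
      "\<And>t. 0 \<le> t \<Longrightarrow> u t \<in> mdom (\<lambda>k. aw k * lam k)" "\<And>t. 0 \<le> t \<Longrightarrow> u' t \<in> mdom aw"
      "\<And>t. 0 \<le> t \<Longrightarrow> sg (u t) \<le> ((norm u1)\<^sup>2 + M0 * sg u0) / \<nu>"
      "continuous_on {0..} (\<lambda>t. sg (u t))"
      "continuous_on {0..} (\<lambda>t. (u t, mop (\<lambda>k. aw k * lam k) (u t)))"
      "continuous_on {0..} (\<lambda>t. (u' t, mop aw (u' t)))"
      "\<And>t. 0 \<le> t \<Longrightarrow> ((\<lambda>s. (u s, mop aw (u s))) has_vector_derivative (u' t, mop aw (u' t))) (at t within {0..})"
      "\<And>t v. 0 \<le> t \<Longrightarrow> v \<in> mdom (\<lambda>k. (lam k)\<^sup>2) \<Longrightarrow>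
        ((\<lambda>s. inner (u' s) v) has_real_derivative - (mt (sg (u t)) * inner (u t) (mop (\<lambda>k. (lam k)\<^sup>2) v))) (at t within {0..})"
      using global_existence[OF assms(12)[unfolded dom_al] assms(13)[unfolded dom_a] R(1) mtR mtM0] by blast
    have du: "(u has_vector_derivative u' t) (at t within {0..})" if "0 \<le> t" for t
      using bounded_linear.has_vector_derivative[OF bounded_linear_fst u(9)[OF that]] by simp
    have cu: "continuous_on {0..} u" by (rule continuous_on_vector_derivative_within[OF du])
    \<comment> \<open>Along the solution of the clamped equation \<open>sg\<close> stays below
      \<open>R\<close>, where \<open>mt\<close> and \<open>m\<close> agree, so it solves the
      original equation.\<close>
    have sgu: "0 \<le> sg (u t)" "mt (sg (u t)) = m (sg (u t))" if "0 \<le> t" for t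
    proof -
      show 1: "0 \<le> sg (u t)" using sg_pow[OF u(3)[OF that]] by (metis zero_le_power2)
      show "mt (sg (u t)) = m (sg (u t))" using 1 u(5)[OF that] R(3) by (intro mt_eq) auto
    qed
    have "kirchhoff_solution D A m u0 u1 u"
      unfolding kirchhoff_solution_def
    proof (intro conjI ballI)
      show "u 0 = u0" by (rule u(1))
      show "(u has_vector_derivative u1) (at 0 within {0..})" using du[of 0] u(2) by simp
      fix v assume v: "v \<in> D"
      let ?g1 = "\<lambda>t. inner (u' t) v" and ?g2 = "\<lambda>t. - (m (sg (u t)) * inner (u t) (A v))"
      have 1: "((\<lambda>s. inner (u s) v) has_real_derivative ?g1 t) (at t within {0..})" if "0 \<le> t" for t
        using bounded_linear.has_vector_derivative[OF bounded_linear_inner_left du[OF that], of v]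
        by (simp add: has_real_derivative_iff_has_vector_derivative)
      have 2: "(?g1 has_real_derivative ?g2 t) (at t within {0..})" if "0 \<le> t" for t
        using u(10)[OF that, of v] v P(4) P(5)[OF v] sgu(2)[OF that] by simp
      have 3: "continuous_on {0..} ?g2"
        using sgu(1) by (intro continuous_intros cu continuous_on_compose2[OF contm u(6)]) auto
      have 4: "?g2 t + m ((norm (op_power D A (1/2) (u t)))\<^sup>2) * inner (u t) (A v) = 0" if "0 \<le> t" for t
        using sg_pow[OF u(3)[OF that]] by simp
      show "\<exists>g1 g2. (\<forall>t\<ge>0. ((\<lambda>s. inner (u s) v) has_real_derivative g1 t) (at t within {0..})) \<and>
          (\<forall>t\<ge>0. (g1 has_real_derivative g2 t) (at t within {0..})) \<and> continuous_on {0..} g2 \<and>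
          (\<forall>t\<ge>0. g2 t + m ((norm (op_power D A (1/2) (u t)))\<^sup>2) * inner (u t) (A v) = 0)"
        by (intro exI[of _ ?g1] exI[of _ ?g2] conjI allI impI) (erule 1 2 4 | rule 3)+
    qed
    moreover have "C1_into (op_power_dom D A \<alpha>) (op_power D A \<alpha>) u"
      unfolding C1_into_def
    proof (intro conjI exI[of _ u'])
      show "C0_into (op_power_dom D A \<alpha>) (op_power D A \<alpha>) u"
        unfolding C0a using energy_domain(1)[OF u(3)] continuous_on_vector_derivative_within[OF u(9)] by blast
      show "C0_into (op_power_dom D A \<alpha>) (op_power D A \<alpha>) u'" unfolding C0a using u(4,8) by blast
      show "\<forall>t\<ge>0. ((\<lambda>s. graph_embed (op_power D A \<alpha>) (u s)) has_vector_derivative graph_embed (op_power D A \<alpha>) (u' t)) (at t within {0..})"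
      proof (intro allI impI)
        fix t :: real assume t: "0 \<le> t"
        have "((\<lambda>s. (u s, mop aw (u s))) has_vector_derivative graph_embed (op_power D A \<alpha>) (u' t)) (at t within {0..})"
          using u(9)[OF t] pow_a[OF u(4)[OF t]] by (simp add: graph_embed_def)
        then show "((\<lambda>s. graph_embed (op_power D A \<alpha>) (u s)) has_vector_derivative graph_embed (op_power D A \<alpha>) (u' t)) (at t within {0..})"
          by (rule has_vector_derivative_transform[rotated 2])
             (use t energy_domain(1)[OF u(3)] in \<open>auto simp: graph_embed_def pow_a\<close>)
      qed
    qed
    moreover have "C0_into (op_power_dom D A (\<alpha> + 1/2)) (op_power D A (\<alpha> + 1/2)) u"
      unfolding C0al using u(3,7) by blast
    ultimately show ?thesis unfolding kirchhoff_class_solution_def by blast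
  qed
  moreover have "u t = w t"
    if u: "kirchhoff_class_solution D A m \<alpha> u0 u1 u" and w: "kirchhoff_class_solution D A m \<alpha> u0 u1 w" and t: "0 \<le> t" for u w t
  proof -
    \<comment> \<open>Brings a class solution for the original \<open>m\<close> into the form that
      \<open>uniqueness\<close> asks for, by using the weak equation with \<open>v = P k z\<close>,
      which lies in \<open>D\<close>.\<close>
    have regular: "\<exists>u'. (\<forall>t\<ge>0. u t \<in> mdom (\<lambda>k. aw k * lam k)) \<and> (\<forall>t\<ge>0. u' t \<in> mdom aw) \<and>
      continuous_on {0..} (\<lambda>t. (u t, mop (\<lambda>k. aw k * lam k) (u t))) \<and>
      continuous_on {0..} (\<lambda>t. (u' t, mop aw (u' t))) \<and>
      component_solution (\<lambda>t. m (sg (u t))) u u' \<and> u 0 = u0 \<and> u' 0 = u1"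
      if u: "kirchhoff_class_solution D A m \<alpha> u0 u1 u" for u
    proof -
      have ks: "kirchhoff_solution D A m u0 u1 u" using u by (simp add: kirchhoff_class_solution_def)
      obtain u' where u': "C0_into (op_power_dom D A \<alpha>) (op_power D A \<alpha>) u'"
        "\<And>t. 0 \<le> t \<Longrightarrow> (u has_vector_derivative u' t) (at t within {0..})"
      proof -
        have "C1_into (op_power_dom D A \<alpha>) (op_power D A \<alpha>) u"
          using u by (simp add: kirchhoff_class_solution_def)
        then show thesis by (rule C1_intoD) (rule that)
      qed
      have ru: "\<And>t. 0 \<le> t \<Longrightarrow> u t \<in> mdom (\<lambda>k. aw k * lam k)"
        "continuous_on {0..} (\<lambda>t. (u t, mop (\<lambda>k. aw k * lam k) (u t)))"
        using u by (auto simp: kirchhoff_class_solution_def C0al)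
      \<comment> \<open>Derivatives at 0 within the half-line are unique, so \<open>u1\<close> is
        the value at 0 of the derivative supplied by \<open>C1_into\<close>.\<close>
      have init: "u 0 = u0" "u' 0 = u1"
        using ks u'(2)[of 0] vector_derivative_unique_within[OF at_within_atLeast_neq_bot[of 0]]
        by (auto simp: kirchhoff_solution_def)
      have csg: "continuous_on {0..} (\<lambda>t. sg (u t))" by (rule continuous_on_mop_lam(2)[OF ru])
      have sgu: "0 \<le> sg (u t)" if "0 \<le> t" for t
        using sg_pow[OF ru(1)[OF that]] by (metis zero_le_power2)
      have "component_solution (\<lambda>t. m (sg (u t))) u u'"
      proof (rule component_solution_of_weak[OF u'(2)])
        show "continuous_on {0..} (\<lambda>t. m (sg (u t)))"
          using sgu by (intro continuous_on_compose2[OF contm csg]) auto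
        fix t k z assume t: "(0::real) \<le> t"
        obtain g1 g2 where g: "\<And>t. 0 \<le> t \<Longrightarrow> ((\<lambda>s. inner (u s) (P k z)) has_real_derivative g1 t) (at t within {0..})"
          "\<And>t. 0 \<le> t \<Longrightarrow> (g1 has_real_derivative g2 t) (at t within {0..})"
          "\<And>t. 0 \<le> t \<Longrightarrow> g2 t + m ((norm (op_power D A (1/2) (u t)))\<^sup>2) * inner (u t) (A (P k z)) = 0"
          using ks P(2)[of k z] unfolding kirchhoff_solution_def by blast
        have g1: "inner (u' s) (P k z) = g1 s" if s: "0 \<le> s" for s
          using vector_derivative_unique_within[OF at_within_atLeast_neq_bot[OF s]
              bounded_linear.has_vector_derivative[OF bounded_linear_inner_left u'(2)[OF s], of "P k z"]] g(1)[OF s]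
          by (simp add: has_real_derivative_iff_has_vector_derivative)
        have "g2 t = - (m (sg (u t)) * (lam k)\<^sup>2 * inner (u t) (P k z))"
          using g(3)[OF t] by (simp add: sg_pow[OF ru(1)[OF t]] P(3))
        with g(2)[OF t] have "(g1 has_vector_derivative - (m (sg (u t)) * (lam k)\<^sup>2 * inner (u t) (P k z))) (at t within {0..})"
          by (simp add: has_real_derivative_iff_has_vector_derivative)
        then have "((\<lambda>s. inner (u' s) (P k z)) has_vector_derivative - (m (sg (u t)) * (lam k)\<^sup>2 * inner (u t) (P k z))) (at t within {0..})"
          by (rule has_vector_derivative_transform[rotated 2]) (use t g1 in auto)
        then show "((\<lambda>s. inner (u' s) (P k z)) has_real_derivative - (m (sg (u t)) * (lam k)\<^sup>2 * inner (u t) (P k z))) (at t within {0..})"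
          by (simp add: has_real_derivative_iff_has_vector_derivative)
      qed
      then show ?thesis using ru u'(1)[unfolded C0a] init by blast
    qed
    obtain u' where u': "\<And>t. 0 \<le> t \<Longrightarrow> u t \<in> mdom (\<lambda>k. aw k * lam k)" "\<And>t. 0 \<le> t \<Longrightarrow> u' t \<in> mdom aw"
      "continuous_on {0..} (\<lambda>t. (u t, mop (\<lambda>k. aw k * lam k) (u t)))"
      "continuous_on {0..} (\<lambda>t. (u' t, mop aw (u' t)))"
      "component_solution (\<lambda>t. m (sg (u t))) u u'" "u 0 = u0" "u' 0 = u1" using regular[OF u] by blast
    obtain w' where w': "\<And>t. 0 \<le> t \<Longrightarrow> w t \<in> mdom (\<lambda>k. aw k * lam k)" "\<And>t. 0 \<le> t \<Longrightarrow> w' t \<in> mdom aw"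
      "continuous_on {0..} (\<lambda>t. (w t, mop (\<lambda>k. aw k * lam k) (w t)))"
      "continuous_on {0..} (\<lambda>t. (w' t, mop aw (w' t)))"
      "component_solution (\<lambda>t. m (sg (w t))) w w'" "w 0 = u0" "w' 0 = u1" using regular[OF w] by blast
    show ?thesis
      by (rule uniqueness[OF u'(1-5) w'(1-5) _ _ lip \<nu> m\<nu> t]) (simp_all add: u'(6,7) w'(6,7))
  qed
  ultimately show ?thesis by blast
qed

end
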